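(* Let $\mathbb D,\mathbb E$ be pseudodouble categories. If $\mathbb E$ is conjoint closed, then so is the pseudodouble category $\mathsf{Lax}_{\mathsf{lax}}(\mathbb D,\mathbb E)$. Dually, if $\mathbb E$ is companion closed, then so is the pseudodouble category $\mathsf{Lax}_{\mathsf{opl}}(\mathbb D,\mathbb E)$.
   Context: **Pseudodouble categories.** A pseudodouble category $\mathbb D$ has a category $\mathbb D_0$ (0-cells, vertical 1-cells), a category $\mathbb D_1$ (horizontal 1-cells $r\colon x\nrightarrow y$, 2-cells), functors $\mathrm{dom},\mathrm{cod}\colon\mathbb D_1\to\mathbb D_0$, $1\colon\mathbb D_0\to\mathbb D_1$ and horizontal composition $-\cdot-\colon\mathbb D_1\times_{\mathbb D_0}\mathbb D_1\to\mathbb D_1$ (strictly compatible with dom, cod), and globular natural isomorphisms $\lambda_r\colon1_y\cdot r\to r$, $\rho_r\colon r\cdot1_x\to r$, $\alpha\colon(t\cdot s)\cdot r\to t\cdot(s\cdot r)$ satisfying the unit triangle and the pentagon. $\circ$ is vertical composition; a 2-cell is globular if its dom and cod are identities. Put $\gamma=\rho^{-1}\circ\lambda$. **Conjoints, companions.** A conjoint of a vertical $f\colon a\to b$ is a horizontal $r\colon b\nrightarrow a$ with 2-cells $\eta\colon1_a\to r$ (dom $f$, cod $\mathrm{id}_a$) and $\epsilon\colon r\to1_b$ (dom $\mathrm{id}_b$, cod $f$) such that $\epsilon\circ\eta=1_f$ and $\eta\cdot\epsilon=\rho^{-1}\circ\lambda$. A companion is the horizontal dual: $r\colon a\nrightarrow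 b$ with $\nu\colon1_a\to r$ (dom $\mathrm{id}$, cod $f$), $\delta\colon r\to1_b$ (dom $f$, cod $\mathrm{id}$), $\delta\circ\nu=1_f$, $\delta\cdot\nu=\lambda^{-1}\circ\rho$. Conjoint (companion) closed: every vertical 1-cell has a conjoint (companion). **Lax functors, vertical transformations.** A lax functor $F\colon\mathbb D\to\mathbb E$ consists of functors $F_0,F_1$ compatible with dom, cod, and globular natural 2-cells $\mathsf e^F_x\colon1_{Fx}\to F1_x$, $\mathsf m^F\colon Fs\cdot Fr\to F(s\cdot r)$ with the usual unit and associativity coherence. A vertical transformation $\phi\colon F\to G$ is a pair of natural transformations $F_0\to G_0$, $F_1\to G_1$ compatible with dom, cod with $\phi_{1_x}\circ\mathsf e^F=\mathsf e^G\circ1_{\phi_x}$, $\phi_{s\cdot r}\circ\mathsf m^F=\mathsf m^G\circ(\phi_s\cdot\phi_r)$. **Horizontal transformations.** A lax horizontal transformation $\phi\colon F\nrightarrow G$ of lax functors is a functor $\phi\colon\mathbb D_0\to\mathbb E_1$ with $\mathrm{dom}\,\phi=F_0$, $\mathrm{cod}\,\phi=G_0$, and globular 2-cells $\mathsf n^\phi_r\colon Gr\cdot\phi_x\to\phi_y\cdot Fr$ natural in $r\colon x\nrightarrow y$ in $\mathbb D_1$, such that $\mathsf n^\phi_{1_x}\circ(\mathsf e^G\cdot\mathrm{id})=(\mathrm{id}\cdot\mathsf e^F)\circ\gamma$ and $\mathsf n^\phi_{s\cdot r}\circ(\mathsf m^G\cdot\mathrm{id})=(\mathrm{id}\cdot\mathsf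 m^F)\circ\alpha\circ(\mathsf n^\phi_s\cdot\mathrm{id})\circ\alpha^{-1}\circ(\mathrm{id}\cdot\mathsf n^\phi_r)\circ\alpha$. An oplax horizontal transformation has instead $\mathsf n^\phi_r\colon\phi_y\cdot Fr\to Gr\cdot\phi_x$ with $\mathsf n^\phi_{1_x}\circ(\mathrm{id}\cdot\mathsf e^F)=(\mathsf e^G\cdot\mathrm{id})\circ\gamma^{-1}$ and $\mathsf n^\phi_{s\cdot r}\circ(\mathrm{id}\cdot\mathsf m^F)=(\mathsf m^G\cdot\mathrm{id})\circ\alpha^{-1}\circ(\mathrm{id}\cdot\mathsf n^\phi_r)\circ\alpha\circ(\mathsf n^\phi_s\cdot\mathrm{id})\circ\alpha^{-1}$. **Modifications.** Given $\zeta\colon F\nrightarrow H$, $\xi\colon G\nrightarrow K$ and vertical transformations $\phi\colon F\to G$, $\psi\colon H\to K$, a modification $\Gamma\colon\zeta\to\xi$ with dom $\phi$ and cod $\psi$ is a natural transformation of the underlying functors $\mathbb D_0\to\mathbb E_1$, with $\Gamma_x$ of dom $\phi_x$ and cod $\psi_x$, such that $(\Gamma_y\cdot\phi_r)\circ\mathsf n^\zeta_r=\mathsf n^\xi_r\circ(\psi_r\cdot\Gamma_x)$ (lax case), respectively $(\psi_r\cdot\Gamma_x)\circ\mathsf n^\zeta_r=\mathsf n^\xi_r\circ(\Gamma_y\cdot\phi_r)$ (oplax case). **The pseudodouble categories.** $\mathsf{Lax}_{\mathsf{lax}}(\mathbb D,\mathbb E)$ (resp. $\mathsf{Lax}_{\mathsf{opl}}(\mathbb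 D,\mathbb E)$) has lax functors $\mathbb D\to\mathbb E$ as 0-cells, vertical transformations as vertical 1-cells, lax (resp. oplax) horizontal transformations as horizontal 1-cells, modifications as 2-cells. Horizontal units and composites are pointwise: $(1_F)_x=1_{Fx}$, $(\psi\cdot\phi)_x=\psi_x\cdot\phi_x$, with $\mathsf n^{1_F}_r=\gamma_{Fr}^{-1}$ and $\mathsf n^{\psi\cdot\phi}_r=\alpha^{-1}\circ(\mathrm{id}\cdot\mathsf n^\phi_r)\circ\alpha\circ(\mathsf n^\psi_r\cdot\mathrm{id})\circ\alpha^{-1}$ in the lax case, and $\mathsf n^{1_F}_r=\gamma_{Fr}$, $\mathsf n^{\psi\cdot\phi}_r=\alpha\circ(\mathsf n^\psi_r\cdot\mathrm{id})\circ\alpha^{-1}\circ(\mathrm{id}\cdot\mathsf n^\phi_r)\circ\alpha$ in the oplax case; unitors and associators are pointwise those of $\mathbb E$. *)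

theory Defs
  imports Main "HOL-Library.FuncSet"
begin

section \<open>Categories, functors and natural transformations on explicit carriers\<close>

record ('o, 'a) cat =
  Obj :: "'o set"
  Arr :: "'a set"
  Src :: "'a \<Rightarrow> 'o"
  Trg :: "'a \<Rightarrow> 'o"
  Idt :: "'o \<Rightarrow> 'a"
  Cmp :: "'a \<Rightarrow> 'a \<Rightarrow> 'a"   \<comment> \<open>\<open>Cmp C g f\<close> is \<open>g\<close> after \<open>f\<close>\<close>

definition Hom :: "('o, 'a) cat \<Rightarrow> 'o \<Rightarrow> 'o \<Rightarrow> 'a set" where
  "Hom C x y = {f \<in> Arr C. Src C f = x \<and> Trg C f = y}"

locale category =
  fixes C :: "('o, 'a) cat"
  assumes src_in: "f \<in> Arr C \<Longrightarrow> Src C f \<in> Obj C"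
    and trg_in: "f \<in> Arr C \<Longrightarrow> Trg C f \<in> Obj C"
    and idt_in: "x \<in> Obj C \<Longrightarrow> Idt C x \<in> Hom C x x"
    and cmp_in: "f \<in> Hom C x y \<Longrightarrow> g \<in> Hom C y z \<Longrightarrow> Cmp C g f \<in> Hom C x z"
    and idt_left: "f \<in> Hom C x y \<Longrightarrow> Cmp C (Idt C y) f = f"
    and idt_right: "f \<in> Hom C x y \<Longrightarrow> Cmp C f (Idt C x) = f"
    and cmp_assoc: "f \<in> Hom C w x \<Longrightarrow> g \<in> Hom C x y \<Longrightarrow> h \<in> Hom C y z \<Longrightarrow>
      Cmp C (Cmp C h g) f = Cmp C h (Cmp C g f)"

definition inverse_arrows :: "('o, 'a) cat \<Rightarrow> 'a \<Rightarrow> 'a \<Rightarrow> bool" where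
  "inverse_arrows C f g \<longleftrightarrow> f \<in> Arr C \<and> g \<in> Hom C (Trg C f) (Src C f) \<and>
     Cmp C g f = Idt C (Src C f) \<and> Cmp C f g = Idt C (Trg C f)"

definition iso_arrow :: "('o, 'a) cat \<Rightarrow> 'a \<Rightarrow> bool" where
  "iso_arrow C f \<longleftrightarrow> (\<exists>g. inverse_arrows C f g)"

definition inv_arrow :: "('o, 'a) cat \<Rightarrow> 'a \<Rightarrow> 'a" where
  "inv_arrow C f = (THE g. inverse_arrows C f g)"

record ('o, 'a, 'p, 'b) fctr =
  ob :: "'o \<Rightarrow> 'p"
  ar :: "'a \<Rightarrow> 'b"

locale is_functor =
  fixes C :: "('o, 'a) cat" and D :: "('p, 'b) cat" and F :: "('o, 'a, 'p, 'b) fctr"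
  assumes ob_in: "x \<in> Obj C \<Longrightarrow> ob F x \<in> Obj D"
    and ar_in: "f \<in> Hom C x y \<Longrightarrow> ar F f \<in> Hom D (ob F x) (ob F y)"
    and ar_idt: "x \<in> Obj C \<Longrightarrow> ar F (Idt C x) = Idt D (ob F x)"
    and ar_cmp: "f \<in> Hom C x y \<Longrightarrow> g \<in> Hom C y z \<Longrightarrow>
      ar F (Cmp C g f) = Cmp D (ar F g) (ar F f)"

definition id_fctr :: "('o, 'a, 'o, 'a) fctr" where
  "id_fctr = \<lparr>ob = (\<lambda>x. x), ar = (\<lambda>f. f)\<rparr>"

definition fcomp :: "('p, 'b, 'q, 'c) fctr \<Rightarrow> ('o, 'a, 'p, 'b) fctr \<Rightarrow> ('o, 'a, 'q, 'c) fctr" where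
  "fcomp G F = \<lparr>ob = (\<lambda>x. ob G (ob F x)), ar = (\<lambda>f. ar G (ar F f))\<rparr>"

definition fst_fctr :: "('o \<times> 'p, 'a \<times> 'b, 'o, 'a) fctr" where
  "fst_fctr = \<lparr>ob = fst, ar = fst\<rparr>"

definition snd_fctr :: "('o \<times> 'p, 'a \<times> 'b, 'p, 'b) fctr" where
  "snd_fctr = \<lparr>ob = snd, ar = snd\<rparr>"

definition pair_fctr ::
  "('o, 'a, 'p, 'b) fctr \<Rightarrow> ('o, 'a, 'q, 'c) fctr \<Rightarrow> ('o, 'a, 'p \<times> 'q, 'b \<times> 'c) fctr" where
  "pair_fctr F G = \<lparr>ob = (\<lambda>x. (ob F x, ob G x)), ar = (\<lambda>f. (ar F f, ar G f))\<rparr>"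

text \<open>Equality of functors with domain \<open>C\<close>: values outside \<open>C\<close> are irrelevant.\<close>

definition fctr_eq :: "('o, 'a) cat \<Rightarrow> ('o, 'a, 'p, 'b) fctr \<Rightarrow> ('o, 'a, 'p, 'b) fctr \<Rightarrow> bool" where
  "fctr_eq C F G \<longleftrightarrow> (\<forall>x\<in>Obj C. ob F x = ob G x) \<and> (\<forall>f\<in>Arr C. ar F f = ar G f)"

definition fctr_restrict :: "('o, 'a) cat \<Rightarrow> ('o, 'a, 'p, 'b) fctr \<Rightarrow> ('o, 'a, 'p, 'b) fctr" where
  "fctr_restrict C F = \<lparr>ob = restrict (ob F) (Obj C), ar = restrict (ar F) (Arr C)\<rparr>"

definition fctr_ext :: "('o, 'a) cat \<Rightarrow> ('o, 'a, 'p, 'b) fctr \<Rightarrow> bool" where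
  "fctr_ext C F \<longleftrightarrow> ob F \<in> extensional (Obj C) \<and> ar F \<in> extensional (Arr C)"

locale nat_trans =
  fixes C :: "('o, 'a) cat" and D :: "('p, 'b) cat"
    and F G :: "('o, 'a, 'p, 'b) fctr" and \<tau> :: "'o \<Rightarrow> 'b"
  assumes component: "x \<in> Obj C \<Longrightarrow> \<tau> x \<in> Hom D (ob F x) (ob G x)"
    and natural: "f \<in> Hom C x y \<Longrightarrow> Cmp D (\<tau> y) (ar F f) = Cmp D (ar G f) (\<tau> x)"

definition nat_iso :: "('o, 'a) cat \<Rightarrow> ('p, 'b) cat \<Rightarrow> ('o, 'a, 'p, 'b) fctr \<Rightarrow>
    ('o, 'a, 'p, 'b) fctr \<Rightarrow> ('o \<Rightarrow> 'b) \<Rightarrow> bool" where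
  "nat_iso C D F G \<tau> \<longleftrightarrow> nat_trans C D F G \<tau> \<and> (\<forall>x\<in>Obj C. iso_arrow D (\<tau> x))"

section \<open>Pseudodouble categories\<close>

text \<open>
  \<open>cat0\<close> consists of the 0-cells and vertical 1-cells, \<open>cat1\<close> of the horizontal 1-cells and
  2-cells. Composable pairs are listed in the order in which they are written: \<open>(s, r)\<close> with
  \<open>dom s = cod r\<close>.
\<close>

record ('o, 'v, 'h, 'c) pdcat =
  cat0 :: "('o, 'v) cat"
  cat1 :: "('h, 'c) cat"
  hdom :: "('h, 'c, 'o, 'v) fctr"
  hcod :: "('h, 'c, 'o, 'v) fctr"
  hunit :: "('o, 'v, 'h, 'c) fctr"
  hcomp :: "('h \<times> 'h, 'c \<times> 'c, 'h, 'c) fctr"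
  lunitor :: "'h \<Rightarrow> 'c"
  runitor :: "'h \<Rightarrow> 'c"
  associator :: "'h \<times> 'h \<times> 'h \<Rightarrow> 'c"

abbreviation hcomp1 :: "('o, 'v, 'h, 'c) pdcat \<Rightarrow> 'h \<Rightarrow> 'h \<Rightarrow> 'h" (infixr "\<odot>\<index>" 75) where
  "s \<odot>\<^bsub>D\<^esub> r \<equiv> ob (hcomp D) (s, r)"

abbreviation hcomp2 :: "('o, 'v, 'h, 'c) pdcat \<Rightarrow> 'c \<Rightarrow> 'c \<Rightarrow> 'c" (infixr "\<star>\<index>" 70) where
  "b \<star>\<^bsub>D\<^esub> a \<equiv> ar (hcomp D) (b, a)"

abbreviation vcomp2 :: "('o, 'v, 'h, 'c) pdcat \<Rightarrow> 'c \<Rightarrow> 'c \<Rightarrow> 'c" (infixr "\<bullet>\<index>" 60) where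
  "b \<bullet>\<^bsub>D\<^esub> a \<equiv> Cmp (cat1 D) b a"

abbreviation vid2 :: "('o, 'v, 'h, 'c) pdcat \<Rightarrow> 'h \<Rightarrow> 'c" where
  "vid2 D r \<equiv> Idt (cat1 D) r"

abbreviation vinv2 :: "('o, 'v, 'h, 'c) pdcat \<Rightarrow> 'c \<Rightarrow> 'c" where
  "vinv2 D a \<equiv> inv_arrow (cat1 D) a"

definition composable_pairs :: "('o, 'v, 'h, 'c) pdcat \<Rightarrow> ('h \<times> 'h, 'c \<times> 'c) cat" where
  "composable_pairs D = \<lparr>
     Obj = {(s, r). s \<in> Obj (cat1 D) \<and> r \<in> Obj (cat1 D) \<and> ob (hdom D) s = ob (hcod D) r},
     Arr = {(b, a). b \<in> Arr (cat1 D) \<and> a \<in> Arr (cat1 D) \<and> ar (hdom D) b = ar (hcod D) a},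
     Src = (\<lambda>(b, a). (Src (cat1 D) b, Src (cat1 D) a)),
     Trg = (\<lambda>(b, a). (Trg (cat1 D) b, Trg (cat1 D) a)),
     Idt = (\<lambda>(s, r). (Idt (cat1 D) s, Idt (cat1 D) r)),
     Cmp = (\<lambda>(b', a') (b, a). (Cmp (cat1 D) b' b, Cmp (cat1 D) a' a))\<rparr>"

definition composable_triples ::
  "('o, 'v, 'h, 'c) pdcat \<Rightarrow> ('h \<times> 'h \<times> 'h, 'c \<times> 'c \<times> 'c) cat" where
  "composable_triples D = \<lparr>
     Obj = {(t, s, r). t \<in> Obj (cat1 D) \<and> s \<in> Obj (cat1 D) \<and> r \<in> Obj (cat1 D) \<and>
              ob (hdom D) t = ob (hcod D) s \<and> ob (hdom D) s = ob (hcod D) r},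
     Arr = {(c, b, a). c \<in> Arr (cat1 D) \<and> b \<in> Arr (cat1 D) \<and> a \<in> Arr (cat1 D) \<and>
              ar (hdom D) c = ar (hcod D) b \<and> ar (hdom D) b = ar (hcod D) a},
     Src = (\<lambda>(c, b, a). (Src (cat1 D) c, Src (cat1 D) b, Src (cat1 D) a)),
     Trg = (\<lambda>(c, b, a). (Trg (cat1 D) c, Trg (cat1 D) b, Trg (cat1 D) a)),
     Idt = (\<lambda>(t, s, r). (Idt (cat1 D) t, Idt (cat1 D) s, Idt (cat1 D) r)),
     Cmp = (\<lambda>(c', b', a') (c, b, a).
              (Cmp (cat1 D) c' c, Cmp (cat1 D) b' b, Cmp (cat1 D) a' a))\<rparr>"

definition hcomp_fctr :: "('o, 'v, 'h, 'c) pdcat \<Rightarrow> ('x, 'y, 'h, 'c) fctr \<Rightarrow>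
    ('x, 'y, 'h, 'c) fctr \<Rightarrow> ('x, 'y, 'h, 'c) fctr" where
  "hcomp_fctr D S R = fcomp (hcomp D) (pair_fctr S R)"

definition globular :: "('o, 'v, 'h, 'c) pdcat \<Rightarrow> 'c \<Rightarrow> bool" where
  "globular D a \<longleftrightarrow> a \<in> Arr (cat1 D) \<and>
     ar (hdom D) a \<in> Idt (cat0 D) ` Obj (cat0 D) \<and> ar (hcod D) a \<in> Idt (cat0 D) ` Obj (cat0 D)"

locale pseudodouble_category =
  fixes D :: "('o, 'v, 'h, 'c) pdcat"
  assumes category0: "category (cat0 D)"
    and category1: "category (cat1 D)"
    and functor_hdom: "is_functor (cat1 D) (cat0 D) (hdom D)"
    and functor_hcod: "is_functor (cat1 D) (cat0 D) (hcod D)"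
    and functor_hunit: "is_functor (cat0 D) (cat1 D) (hunit D)"
    and functor_hcomp: "is_functor (composable_pairs D) (cat1 D) (hcomp D)"
    and hdom_hunit: "fctr_eq (cat0 D) (fcomp (hdom D) (hunit D)) id_fctr"
    and hcod_hunit: "fctr_eq (cat0 D) (fcomp (hcod D) (hunit D)) id_fctr"
    and hdom_hcomp: "fctr_eq (composable_pairs D)
      (fcomp (hdom D) (hcomp D)) (fcomp (hdom D) snd_fctr)"
    and hcod_hcomp: "fctr_eq (composable_pairs D)
      (fcomp (hcod D) (hcomp D)) (fcomp (hcod D) fst_fctr)"
    and lunitor_iso: "nat_iso (cat1 D) (cat1 D)
      (hcomp_fctr D (fcomp (hunit D) (hcod D)) id_fctr) id_fctr (lunitor D)"
    and runitor_iso: "nat_iso (cat1 D) (cat1 D)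
      (hcomp_fctr D id_fctr (fcomp (hunit D) (hdom D))) id_fctr (runitor D)"
    and associator_iso: "nat_iso (composable_triples D) (cat1 D)
      \<lparr>ob = (\<lambda>(t, s, r). (t \<odot>\<^bsub>D\<^esub> s) \<odot>\<^bsub>D\<^esub> r), ar = (\<lambda>(c, b, a). (c \<star>\<^bsub>D\<^esub> b) \<star>\<^bsub>D\<^esub> a)\<rparr>
      \<lparr>ob = (\<lambda>(t, s, r). t \<odot>\<^bsub>D\<^esub> (s \<odot>\<^bsub>D\<^esub> r)), ar = (\<lambda>(c, b, a). c \<star>\<^bsub>D\<^esub> (b \<star>\<^bsub>D\<^esub> a))\<rparr>
      (associator D)"
    and lunitor_globular: "r \<in> Obj (cat1 D) \<Longrightarrow> globular D (lunitor D r)"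
    and runitor_globular: "r \<in> Obj (cat1 D) \<Longrightarrow> globular D (runitor D r)"
    and associator_globular:
      "(t, s, r) \<in> Obj (composable_triples D) \<Longrightarrow> globular D (associator D (t, s, r))"
    and triangle: "(s, r) \<in> Obj (composable_pairs D) \<Longrightarrow>
      (vid2 D s \<star>\<^bsub>D\<^esub> lunitor D r) \<bullet>\<^bsub>D\<^esub> associator D (s, ob (hunit D) (ob (hcod D) r), r)
      = runitor D s \<star>\<^bsub>D\<^esub> vid2 D r"
    and pentagon: "(u, t, s) \<in> Obj (composable_triples D) \<Longrightarrow>
      (s, r) \<in> Obj (composable_pairs D) \<Longrightarrow>
      associator D (u, t, s \<odot>\<^bsub>D\<^esub> r) \<bullet>\<^bsub>D\<^esub> associator D (u \<odot>\<^bsub>D\<^esub> t, s, r)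
      = (vid2 D u \<star>\<^bsub>D\<^esub> associator D (t, s, r)) \<bullet>\<^bsub>D\<^esub> associator D (u, t \<odot>\<^bsub>D\<^esub> s, r)
        \<bullet>\<^bsub>D\<^esub> (associator D (u, t, s) \<star>\<^bsub>D\<^esub> vid2 D r)"

definition gamma :: "('o, 'v, 'h, 'c) pdcat \<Rightarrow> 'h \<Rightarrow> 'c" where
  "gamma D r = vinv2 D (runitor D r) \<bullet>\<^bsub>D\<^esub> lunitor D r"

section \<open>Conjoints and companions\<close>

definition cells :: "('o, 'v, 'h, 'c) pdcat \<Rightarrow> 'h \<Rightarrow> 'h \<Rightarrow> 'v \<Rightarrow> 'v \<Rightarrow> 'c set" where
  "cells D r s f g = {a \<in> Hom (cat1 D) r s. ar (hdom D) a = f \<and> ar (hcod D) a = g}"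

definition horizontal :: "('o, 'v, 'h, 'c) pdcat \<Rightarrow> 'o \<Rightarrow> 'o \<Rightarrow> 'h set" where
  "horizontal D x y = {r \<in> Obj (cat1 D). ob (hdom D) r = x \<and> ob (hcod D) r = y}"

definition is_conjoint :: "('o, 'v, 'h, 'c) pdcat \<Rightarrow> 'v \<Rightarrow> 'h \<Rightarrow> 'c \<Rightarrow> 'c \<Rightarrow> bool" where
  "is_conjoint D f r \<eta> \<epsilon> \<longleftrightarrow>
     (let a = Src (cat0 D) f; b = Trg (cat0 D) f in
       r \<in> horizontal D b a \<and>
       \<eta> \<in> cells D (ob (hunit D) a) r f (Idt (cat0 D) a) \<and>
       \<epsilon> \<in> cells D r (ob (hunit D) b) (Idt (cat0 D) b) f \<and>
       \<epsilon> \<bullet>\<^bsub>D\<^esub> \<eta> = ar (hunit D) f \<and>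
       \<eta> \<star>\<^bsub>D\<^esub> \<epsilon> = vinv2 D (runitor D r) \<bullet>\<^bsub>D\<^esub> lunitor D r)"

definition is_companion :: "('o, 'v, 'h, 'c) pdcat \<Rightarrow> 'v \<Rightarrow> 'h \<Rightarrow> 'c \<Rightarrow> 'c \<Rightarrow> bool" where
  "is_companion D f r \<nu> \<delta> \<longleftrightarrow>
     (let a = Src (cat0 D) f; b = Trg (cat0 D) f in
       r \<in> horizontal D a b \<and>
       \<nu> \<in> cells D (ob (hunit D) a) r (Idt (cat0 D) a) f \<and>
       \<delta> \<in> cells D r (ob (hunit D) b) f (Idt (cat0 D) b) \<and>
       \<delta> \<bullet>\<^bsub>D\<^esub> \<nu> = ar (hunit D) f \<and>
       \<delta> \<star>\<^bsub>D\<^esub> \<nu> = vinv2 D (lunitor D r) \<bullet>\<^bsub>D\<^esub> runitor D r)"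

definition conjoint_closed :: "('o, 'v, 'h, 'c) pdcat \<Rightarrow> bool" where
  "conjoint_closed D \<longleftrightarrow> (\<forall>f\<in>Arr (cat0 D). \<exists>r \<eta> \<epsilon>. is_conjoint D f r \<eta> \<epsilon>)"

definition companion_closed :: "('o, 'v, 'h, 'c) pdcat \<Rightarrow> bool" where
  "companion_closed D \<longleftrightarrow> (\<forall>f\<in>Arr (cat0 D). \<exists>r \<nu> \<delta>. is_companion D f r \<nu> \<delta>)"

section \<open>Lax functors and vertical transformations\<close>

text \<open>
  Lax functors, transformations and modifications become cells of new pseudodouble categories, so
  HOL equality of the records below must be equality of the mathematical objects. Their functions
  are therefore required to be extensional (constantly \<open>undefined\<close> outside the carriers).
\<close>

record ('o, 'v, 'h, 'c, 'p, 'w, 'k, 'd) lax_fun =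
  lf0 :: "('o, 'v, 'p, 'w) fctr"
  lf1 :: "('h, 'c, 'k, 'd) fctr"
  lf_e :: "'o \<Rightarrow> 'd"
  lf_m :: "'h \<times> 'h \<Rightarrow> 'd"

locale lax_functor =
  fixes D :: "('o, 'v, 'h, 'c) pdcat" and E :: "('p, 'w, 'k, 'd) pdcat"
    and F :: "('o, 'v, 'h, 'c, 'p, 'w, 'k, 'd) lax_fun"
  assumes ext: "fctr_ext (cat0 D) (lf0 F)" "fctr_ext (cat1 D) (lf1 F)"
      "lf_e F \<in> extensional (Obj (cat0 D))" "lf_m F \<in> extensional (Obj (composable_pairs D))"
    and functor0: "is_functor (cat0 D) (cat0 E) (lf0 F)"
    and functor1: "is_functor (cat1 D) (cat1 E) (lf1 F)"
    and compat_hdom: "fctr_eq (cat1 D) (fcomp (hdom E) (lf1 F)) (fcomp (lf0 F) (hdom D))"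
    and compat_hcod: "fctr_eq (cat1 D) (fcomp (hcod E) (lf1 F)) (fcomp (lf0 F) (hcod D))"
    and e_natural: "nat_trans (cat0 D) (cat1 E)
      (fcomp (hunit E) (lf0 F)) (fcomp (lf1 F) (hunit D)) (lf_e F)"
    and e_globular: "x \<in> Obj (cat0 D) \<Longrightarrow> globular E (lf_e F x)"
    and m_natural: "nat_trans (composable_pairs D) (cat1 E)
      (hcomp_fctr E (fcomp (lf1 F) fst_fctr) (fcomp (lf1 F) snd_fctr))
      (fcomp (lf1 F) (hcomp D)) (lf_m F)"
    and m_globular: "(s, r) \<in> Obj (composable_pairs D) \<Longrightarrow> globular E (lf_m F (s, r))"
    and left_unit: "r \<in> Obj (cat1 D) \<Longrightarrow>
      ar (lf1 F) (lunitor D r) \<bullet>\<^bsub>E\<^esub> lf_m F (ob (hunit D) (ob (hcod D) r), r)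
        \<bullet>\<^bsub>E\<^esub> (lf_e F (ob (hcod D) r) \<star>\<^bsub>E\<^esub> vid2 E (ob (lf1 F) r))
      = lunitor E (ob (lf1 F) r)"
    and right_unit: "r \<in> Obj (cat1 D) \<Longrightarrow>
      ar (lf1 F) (runitor D r) \<bullet>\<^bsub>E\<^esub> lf_m F (r, ob (hunit D) (ob (hdom D) r))
        \<bullet>\<^bsub>E\<^esub> (vid2 E (ob (lf1 F) r) \<star>\<^bsub>E\<^esub> lf_e F (ob (hdom D) r))
      = runitor E (ob (lf1 F) r)"
    and associativity: "(t, s, r) \<in> Obj (composable_triples D) \<Longrightarrow>
      ar (lf1 F) (associator D (t, s, r)) \<bullet>\<^bsub>E\<^esub> lf_m F (t \<odot>\<^bsub>D\<^esub> s, r)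
        \<bullet>\<^bsub>E\<^esub> (lf_m F (t, s) \<star>\<^bsub>E\<^esub> vid2 E (ob (lf1 F) r))
      = lf_m F (t, s \<odot>\<^bsub>D\<^esub> r) \<bullet>\<^bsub>E\<^esub> (vid2 E (ob (lf1 F) t) \<star>\<^bsub>E\<^esub> lf_m F (s, r))
        \<bullet>\<^bsub>E\<^esub> associator E (ob (lf1 F) t, ob (lf1 F) s, ob (lf1 F) r)"

record ('o, 'v, 'h, 'c, 'p, 'w, 'k, 'd) vtrans =
  vt_src :: "('o, 'v, 'h, 'c, 'p, 'w, 'k, 'd) lax_fun"
  vt_trg :: "('o, 'v, 'h, 'c, 'p, 'w, 'k, 'd) lax_fun"
  vt0 :: "'o \<Rightarrow> 'w"
  vt1 :: "'h \<Rightarrow> 'd"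

locale vertical_transformation =
  fixes D :: "('o, 'v, 'h, 'c) pdcat" and E :: "('p, 'w, 'k, 'd) pdcat"
    and \<phi> :: "('o, 'v, 'h, 'c, 'p, 'w, 'k, 'd) vtrans"
  assumes lax_src: "lax_functor D E (vt_src \<phi>)"
    and lax_trg: "lax_functor D E (vt_trg \<phi>)"
    and ext: "vt0 \<phi> \<in> extensional (Obj (cat0 D))" "vt1 \<phi> \<in> extensional (Obj (cat1 D))"
    and natural0: "nat_trans (cat0 D) (cat0 E) (lf0 (vt_src \<phi>)) (lf0 (vt_trg \<phi>)) (vt0 \<phi>)"
    and natural1: "nat_trans (cat1 D) (cat1 E) (lf1 (vt_src \<phi>)) (lf1 (vt_trg \<phi>)) (vt1 \<phi>)"
    and compat_hdom: "r \<in> Obj (cat1 D) \<Longrightarrow> ar (hdom E) (vt1 \<phi> r) = vt0 \<phi> (ob (hdom D) r)"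
    and compat_hcod: "r \<in> Obj (cat1 D) \<Longrightarrow> ar (hcod E) (vt1 \<phi> r) = vt0 \<phi> (ob (hcod D) r)"
    and unit: "x \<in> Obj (cat0 D) \<Longrightarrow>
      vt1 \<phi> (ob (hunit D) x) \<bullet>\<^bsub>E\<^esub> lf_e (vt_src \<phi>) x
      = lf_e (vt_trg \<phi>) x \<bullet>\<^bsub>E\<^esub> ar (hunit E) (vt0 \<phi> x)"
    and comp: "(s, r) \<in> Obj (composable_pairs D) \<Longrightarrow>
      vt1 \<phi> (s \<odot>\<^bsub>D\<^esub> r) \<bullet>\<^bsub>E\<^esub> lf_m (vt_src \<phi>) (s, r)
      = lf_m (vt_trg \<phi>) (s, r) \<bullet>\<^bsub>E\<^esub> (vt1 \<phi> s \<star>\<^bsub>E\<^esub> vt1 \<phi> r)"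

definition lax_cat0 :: "('o, 'v, 'h, 'c) pdcat \<Rightarrow> ('p, 'w, 'k, 'd) pdcat \<Rightarrow>
    (('o, 'v, 'h, 'c, 'p, 'w, 'k, 'd) lax_fun, ('o, 'v, 'h, 'c, 'p, 'w, 'k, 'd) vtrans) cat" where
  "lax_cat0 D E = \<lparr>
     Obj = {F. lax_functor D E F},
     Arr = {\<phi>. vertical_transformation D E \<phi>},
     Src = vt_src,
     Trg = vt_trg,
     Idt = (\<lambda>F. \<lparr>vt_src = F, vt_trg = F,
              vt0 = (\<lambda>x\<in>Obj (cat0 D). Idt (cat0 E) (ob (lf0 F) x)),
              vt1 = (\<lambda>r\<in>Obj (cat1 D). vid2 E (ob (lf1 F) r))\<rparr>),
     Cmp = (\<lambda>\<psi> \<phi>. \<lparr>vt_src = vt_src \<phi>, vt_trg = vt_trg \<psi>,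
              vt0 = (\<lambda>x\<in>Obj (cat0 D). Cmp (cat0 E) (vt0 \<psi> x) (vt0 \<phi> x)),
              vt1 = (\<lambda>r\<in>Obj (cat1 D). vt1 \<psi> r \<bullet>\<^bsub>E\<^esub> vt1 \<phi> r)\<rparr>)\<rparr>"

section \<open>Horizontal transformations\<close>

text \<open>
  The same record carries lax and oplax horizontal transformations; they differ in the direction
  of the 2-cells \<open>ht_n\<close>.
\<close>

record ('o, 'v, 'h, 'c, 'p, 'w, 'k, 'd) htrans =
  ht_dom :: "('o, 'v, 'h, 'c, 'p, 'w, 'k, 'd) lax_fun"
  ht_cod :: "('o, 'v, 'h, 'c, 'p, 'w, 'k, 'd) lax_fun"
  ht_fun :: "('o, 'v, 'k, 'd) fctr"
  ht_n :: "'h \<Rightarrow> 'd"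

locale horizontal_transformation =
  fixes D :: "('o, 'v, 'h, 'c) pdcat" and E :: "('p, 'w, 'k, 'd) pdcat"
    and \<phi> :: "('o, 'v, 'h, 'c, 'p, 'w, 'k, 'd) htrans"
  assumes lax_dom: "lax_functor D E (ht_dom \<phi>)"
    and lax_cod: "lax_functor D E (ht_cod \<phi>)"
    and ext: "fctr_ext (cat0 D) (ht_fun \<phi>)" "ht_n \<phi> \<in> extensional (Obj (cat1 D))"
    and functor_fun: "is_functor (cat0 D) (cat1 E) (ht_fun \<phi>)"
    and hdom_fun: "fctr_eq (cat0 D) (fcomp (hdom E) (ht_fun \<phi>)) (lf0 (ht_dom \<phi>))"
    and hcod_fun: "fctr_eq (cat0 D) (fcomp (hcod E) (ht_fun \<phi>)) (lf0 (ht_cod \<phi>))"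
    and n_globular: "r \<in> Obj (cat1 D) \<Longrightarrow> globular E (ht_n \<phi> r)"

locale lax_transformation = horizontal_transformation +
  assumes n_natural: "nat_trans (cat1 D) (cat1 E)
      (hcomp_fctr E (lf1 (ht_cod \<phi>)) (fcomp (ht_fun \<phi>) (hdom D)))
      (hcomp_fctr E (fcomp (ht_fun \<phi>) (hcod D)) (lf1 (ht_dom \<phi>))) (ht_n \<phi>)"
    and n_unit: "x \<in> Obj (cat0 D) \<Longrightarrow>
      ht_n \<phi> (ob (hunit D) x) \<bullet>\<^bsub>E\<^esub> (lf_e (ht_cod \<phi>) x \<star>\<^bsub>E\<^esub> vid2 E (ob (ht_fun \<phi>) x))
      = (vid2 E (ob (ht_fun \<phi>) x) \<star>\<^bsub>E\<^esub> lf_e (ht_dom \<phi>) x) \<bullet>\<^bsub>E\<^esub> gamma E (ob (ht_fun \<phi>) x)"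
    and n_comp: "\<lbrakk>(s, r) \<in> Obj (composable_pairs D);
        \<phi>x = ob (ht_fun \<phi>) (ob (hdom D) r); \<phi>y = ob (ht_fun \<phi>) (ob (hcod D) r);
        \<phi>z = ob (ht_fun \<phi>) (ob (hcod D) s);
        Fr = ob (lf1 (ht_dom \<phi>)) r; Fs = ob (lf1 (ht_dom \<phi>)) s;
        Gr = ob (lf1 (ht_cod \<phi>)) r; Gs = ob (lf1 (ht_cod \<phi>)) s\<rbrakk> \<Longrightarrow>
      ht_n \<phi> (s \<odot>\<^bsub>D\<^esub> r) \<bullet>\<^bsub>E\<^esub> (lf_m (ht_cod \<phi>) (s, r) \<star>\<^bsub>E\<^esub> vid2 E \<phi>x)
      = (vid2 E \<phi>z \<star>\<^bsub>E\<^esub> lf_m (ht_dom \<phi>) (s, r)) \<bullet>\<^bsub>E\<^esub> associator E (\<phi>z, Fs, Fr)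
        \<bullet>\<^bsub>E\<^esub> (ht_n \<phi> s \<star>\<^bsub>E\<^esub> vid2 E Fr) \<bullet>\<^bsub>E\<^esub> vinv2 E (associator E (Gs, \<phi>y, Fr))
        \<bullet>\<^bsub>E\<^esub> (vid2 E Gs \<star>\<^bsub>E\<^esub> ht_n \<phi> r) \<bullet>\<^bsub>E\<^esub> associator E (Gs, Gr, \<phi>x)"

locale oplax_transformation = horizontal_transformation +
  assumes n_natural: "nat_trans (cat1 D) (cat1 E)
      (hcomp_fctr E (fcomp (ht_fun \<phi>) (hcod D)) (lf1 (ht_dom \<phi>)))
      (hcomp_fctr E (lf1 (ht_cod \<phi>)) (fcomp (ht_fun \<phi>) (hdom D))) (ht_n \<phi>)"
    and n_unit: "x \<in> Obj (cat0 D) \<Longrightarrow>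
      ht_n \<phi> (ob (hunit D) x) \<bullet>\<^bsub>E\<^esub> (vid2 E (ob (ht_fun \<phi>) x) \<star>\<^bsub>E\<^esub> lf_e (ht_dom \<phi>) x)
      = (lf_e (ht_cod \<phi>) x \<star>\<^bsub>E\<^esub> vid2 E (ob (ht_fun \<phi>) x))
        \<bullet>\<^bsub>E\<^esub> vinv2 E (gamma E (ob (ht_fun \<phi>) x))"
    and n_comp: "\<lbrakk>(s, r) \<in> Obj (composable_pairs D);
        \<phi>x = ob (ht_fun \<phi>) (ob (hdom D) r); \<phi>y = ob (ht_fun \<phi>) (ob (hcod D) r);
        \<phi>z = ob (ht_fun \<phi>) (ob (hcod D) s);
        Fr = ob (lf1 (ht_dom \<phi>)) r; Fs = ob (lf1 (ht_dom \<phi>)) s;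
        Gr = ob (lf1 (ht_cod \<phi>)) r; Gs = ob (lf1 (ht_cod \<phi>)) s\<rbrakk> \<Longrightarrow>
      ht_n \<phi> (s \<odot>\<^bsub>D\<^esub> r) \<bullet>\<^bsub>E\<^esub> (vid2 E \<phi>z \<star>\<^bsub>E\<^esub> lf_m (ht_dom \<phi>) (s, r))
      = (lf_m (ht_cod \<phi>) (s, r) \<star>\<^bsub>E\<^esub> vid2 E \<phi>x) \<bullet>\<^bsub>E\<^esub> vinv2 E (associator E (Gs, Gr, \<phi>x))
        \<bullet>\<^bsub>E\<^esub> (vid2 E Gs \<star>\<^bsub>E\<^esub> ht_n \<phi> r) \<bullet>\<^bsub>E\<^esub> associator E (Gs, \<phi>y, Fr)
        \<bullet>\<^bsub>E\<^esub> (ht_n \<phi> s \<star>\<^bsub>E\<^esub> vid2 E Fr) \<bullet>\<^bsub>E\<^esub> vinv2 E (associator E (\<phi>z, Fs, Fr))"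

section \<open>Modifications\<close>

record ('o, 'v, 'h, 'c, 'p, 'w, 'k, 'd) modif =
  md_src :: "('o, 'v, 'h, 'c, 'p, 'w, 'k, 'd) htrans"
  md_trg :: "('o, 'v, 'h, 'c, 'p, 'w, 'k, 'd) htrans"
  md_dom :: "('o, 'v, 'h, 'c, 'p, 'w, 'k, 'd) vtrans"
  md_cod :: "('o, 'v, 'h, 'c, 'p, 'w, 'k, 'd) vtrans"
  md_c :: "'o \<Rightarrow> 'd"

locale modification =
  fixes D :: "('o, 'v, 'h, 'c) pdcat" and E :: "('p, 'w, 'k, 'd) pdcat"
    and \<Gamma> :: "('o, 'v, 'h, 'c, 'p, 'w, 'k, 'd) modif"
  assumes vt_dom: "md_dom \<Gamma> \<in> Hom (lax_cat0 D E) (ht_dom (md_src \<Gamma>)) (ht_dom (md_trg \<Gamma>))"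
    and vt_cod: "md_cod \<Gamma> \<in> Hom (lax_cat0 D E) (ht_cod (md_src \<Gamma>)) (ht_cod (md_trg \<Gamma>))"
    and ext: "md_c \<Gamma> \<in> extensional (Obj (cat0 D))"
    and natural: "nat_trans (cat0 D) (cat1 E)
      (ht_fun (md_src \<Gamma>)) (ht_fun (md_trg \<Gamma>)) (md_c \<Gamma>)"
    and hdom_c: "x \<in> Obj (cat0 D) \<Longrightarrow> ar (hdom E) (md_c \<Gamma> x) = vt0 (md_dom \<Gamma>) x"
    and hcod_c: "x \<in> Obj (cat0 D) \<Longrightarrow> ar (hcod E) (md_c \<Gamma> x) = vt0 (md_cod \<Gamma>) x"

locale lax_modification = modification +
  assumes lax_src: "lax_transformation D E (md_src \<Gamma>)"
    and lax_trg: "lax_transformation D E (md_trg \<Gamma>)"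
    and n_compat: "r \<in> Obj (cat1 D) \<Longrightarrow>
      (md_c \<Gamma> (ob (hcod D) r) \<star>\<^bsub>E\<^esub> vt1 (md_dom \<Gamma>) r) \<bullet>\<^bsub>E\<^esub> ht_n (md_src \<Gamma>) r
      = ht_n (md_trg \<Gamma>) r \<bullet>\<^bsub>E\<^esub> (vt1 (md_cod \<Gamma>) r \<star>\<^bsub>E\<^esub> md_c \<Gamma> (ob (hdom D) r))"

locale oplax_modification = modification +
  assumes oplax_src: "oplax_transformation D E (md_src \<Gamma>)"
    and oplax_trg: "oplax_transformation D E (md_trg \<Gamma>)"
    and n_compat: "r \<in> Obj (cat1 D) \<Longrightarrow>
      (vt1 (md_cod \<Gamma>) r \<star>\<^bsub>E\<^esub> md_c \<Gamma> (ob (hdom D) r)) \<bullet>\<^bsub>E\<^esub> ht_n (md_src \<Gamma>) r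
      = ht_n (md_trg \<Gamma>) r \<bullet>\<^bsub>E\<^esub> (md_c \<Gamma> (ob (hcod D) r) \<star>\<^bsub>E\<^esub> vt1 (md_dom \<Gamma>) r)"

section \<open>The pseudodouble categories of lax functors\<close>

text \<open>
  The two structures differ only in which horizontal transformations and modifications they
  contain and in the 2-cells \<open>ht_n\<close> of horizontal units and composites. The common part is
  parametrised by the set \<open>T\<close> of horizontal 1-cells, the set \<open>M\<close> of 2-cells, the unit constraints
  \<open>nu F\<close> and the composite constraints \<open>nc \<psi> \<phi>\<close>.
\<close>

definition trans_cat1 ::
  "('o, 'v, 'h, 'c) pdcat \<Rightarrow> ('p, 'w, 'k, 'd) pdcat \<Rightarrow>
   ('o, 'v, 'h, 'c, 'p, 'w, 'k, 'd) htrans set \<Rightarrow> ('o, 'v, 'h, 'c, 'p, 'w, 'k, 'd) modif set \<Rightarrow>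
   (('o, 'v, 'h, 'c, 'p, 'w, 'k, 'd) htrans, ('o, 'v, 'h, 'c, 'p, 'w, 'k, 'd) modif) cat" where
  "trans_cat1 D E T M = \<lparr>
     Obj = T,
     Arr = M,
     Src = md_src,
     Trg = md_trg,
     Idt = (\<lambda>\<zeta>. \<lparr>md_src = \<zeta>, md_trg = \<zeta>,
              md_dom = Idt (lax_cat0 D E) (ht_dom \<zeta>), md_cod = Idt (lax_cat0 D E) (ht_cod \<zeta>),
              md_c = (\<lambda>x\<in>Obj (cat0 D). vid2 E (ob (ht_fun \<zeta>) x))\<rparr>),
     Cmp = (\<lambda>\<Delta> \<Gamma>. \<lparr>md_src = md_src \<Gamma>, md_trg = md_trg \<Delta>,
              md_dom = Cmp (lax_cat0 D E) (md_dom \<Delta>) (md_dom \<Gamma>),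
              md_cod = Cmp (lax_cat0 D E) (md_cod \<Delta>) (md_cod \<Gamma>),
              md_c = (\<lambda>x\<in>Obj (cat0 D). md_c \<Delta> x \<bullet>\<^bsub>E\<^esub> md_c \<Gamma> x)\<rparr>)\<rparr>"

definition trans_unit ::
  "('o, 'v, 'h, 'c) pdcat \<Rightarrow> ('p, 'w, 'k, 'd) pdcat \<Rightarrow>
   (('o, 'v, 'h, 'c, 'p, 'w, 'k, 'd) lax_fun \<Rightarrow> 'h \<Rightarrow> 'd) \<Rightarrow>
   ('o, 'v, 'h, 'c, 'p, 'w, 'k, 'd) lax_fun \<Rightarrow> ('o, 'v, 'h, 'c, 'p, 'w, 'k, 'd) htrans" where
  "trans_unit D E nu F = \<lparr>ht_dom = F, ht_cod = F,
     ht_fun = fctr_restrict (cat0 D) (fcomp (hunit E) (lf0 F)),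
     ht_n = restrict (nu F) (Obj (cat1 D))\<rparr>"

definition trans_comp ::
  "('o, 'v, 'h, 'c) pdcat \<Rightarrow> ('p, 'w, 'k, 'd) pdcat \<Rightarrow>
   (('o, 'v, 'h, 'c, 'p, 'w, 'k, 'd) htrans \<Rightarrow>
    ('o, 'v, 'h, 'c, 'p, 'w, 'k, 'd) htrans \<Rightarrow> 'h \<Rightarrow> 'd) \<Rightarrow>
   ('o, 'v, 'h, 'c, 'p, 'w, 'k, 'd) htrans \<Rightarrow> ('o, 'v, 'h, 'c, 'p, 'w, 'k, 'd) htrans \<Rightarrow>
   ('o, 'v, 'h, 'c, 'p, 'w, 'k, 'd) htrans" where
  "trans_comp D E nc \<psi> \<phi> = \<lparr>ht_dom = ht_dom \<phi>, ht_cod = ht_cod \<psi>,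
     ht_fun = fctr_restrict (cat0 D) (hcomp_fctr E (ht_fun \<psi>) (ht_fun \<phi>)),
     ht_n = restrict (nc \<psi> \<phi>) (Obj (cat1 D))\<rparr>"

definition trans_pdcat ::
  "('o, 'v, 'h, 'c) pdcat \<Rightarrow> ('p, 'w, 'k, 'd) pdcat \<Rightarrow>
   ('o, 'v, 'h, 'c, 'p, 'w, 'k, 'd) htrans set \<Rightarrow> ('o, 'v, 'h, 'c, 'p, 'w, 'k, 'd) modif set \<Rightarrow>
   (('o, 'v, 'h, 'c, 'p, 'w, 'k, 'd) lax_fun \<Rightarrow> 'h \<Rightarrow> 'd) \<Rightarrow>
   (('o, 'v, 'h, 'c, 'p, 'w, 'k, 'd) htrans \<Rightarrow>
    ('o, 'v, 'h, 'c, 'p, 'w, 'k, 'd) htrans \<Rightarrow> 'h \<Rightarrow> 'd) \<Rightarrow>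
   (('o, 'v, 'h, 'c, 'p, 'w, 'k, 'd) lax_fun, ('o, 'v, 'h, 'c, 'p, 'w, 'k, 'd) vtrans,
    ('o, 'v, 'h, 'c, 'p, 'w, 'k, 'd) htrans, ('o, 'v, 'h, 'c, 'p, 'w, 'k, 'd) modif) pdcat" where
  "trans_pdcat D E T M nu nc =
    (let un = trans_unit D E nu; hc = trans_comp D E nc;
         glob = (\<lambda>\<zeta> \<xi> c. \<lparr>md_src = \<zeta>, md_trg = \<xi>,
                   md_dom = Idt (lax_cat0 D E) (ht_dom \<xi>), md_cod = Idt (lax_cat0 D E) (ht_cod \<xi>),
                   md_c = restrict c (Obj (cat0 D))\<rparr>)
     in \<lparr>
       cat0 = lax_cat0 D E,
       cat1 = trans_cat1 D E T M,
       hdom = \<lparr>ob = ht_dom, ar = md_dom\<rparr>,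
       hcod = \<lparr>ob = ht_cod, ar = md_cod\<rparr>,
       hunit = \<lparr>ob = un,
         ar = (\<lambda>\<phi>. \<lparr>md_src = un (vt_src \<phi>), md_trg = un (vt_trg \<phi>), md_dom = \<phi>, md_cod = \<phi>,
                 md_c = (\<lambda>x\<in>Obj (cat0 D). ar (hunit E) (vt0 \<phi> x))\<rparr>)\<rparr>,
       hcomp = \<lparr>ob = (\<lambda>(\<psi>, \<phi>). hc \<psi> \<phi>),
         ar = (\<lambda>(\<Delta>, \<Gamma>). \<lparr>md_src = hc (md_src \<Delta>) (md_src \<Gamma>), md_trg = hc (md_trg \<Delta>) (md_trg \<Gamma>),
                 md_dom = md_dom \<Gamma>, md_cod = md_cod \<Delta>,
                 md_c = (\<lambda>x\<in>Obj (cat0 D). md_c \<Delta> x \<star>\<^bsub>E\<^esub> md_c \<Gamma> x)\<rparr>)\<rparr>,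
       lunitor = (\<lambda>\<phi>. glob (hc (un (ht_cod \<phi>)) \<phi>) \<phi> (\<lambda>x. lunitor E (ob (ht_fun \<phi>) x))),
       runitor = (\<lambda>\<phi>. glob (hc \<phi> (un (ht_dom \<phi>))) \<phi> (\<lambda>x. runitor E (ob (ht_fun \<phi>) x))),
       associator = (\<lambda>(\<chi>, \<psi>, \<phi>). glob (hc (hc \<chi> \<psi>) \<phi>) (hc \<chi> (hc \<psi> \<phi>))
         (\<lambda>x. associator E (ob (ht_fun \<chi>) x, ob (ht_fun \<psi>) x, ob (ht_fun \<phi>) x)))\<rparr>)"

definition lax_unit_n ::
  "('p, 'w, 'k, 'd) pdcat \<Rightarrow> ('o, 'v, 'h, 'c, 'p, 'w, 'k, 'd) lax_fun \<Rightarrow> 'h \<Rightarrow> 'd" where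
  "lax_unit_n E F r = vinv2 E (gamma E (ob (lf1 F) r))"

definition oplax_unit_n ::
  "('p, 'w, 'k, 'd) pdcat \<Rightarrow> ('o, 'v, 'h, 'c, 'p, 'w, 'k, 'd) lax_fun \<Rightarrow> 'h \<Rightarrow> 'd" where
  "oplax_unit_n E F r = gamma E (ob (lf1 F) r)"

definition lax_comp_n ::
  "('o, 'v, 'h, 'c) pdcat \<Rightarrow> ('p, 'w, 'k, 'd) pdcat \<Rightarrow>
   ('o, 'v, 'h, 'c, 'p, 'w, 'k, 'd) htrans \<Rightarrow> ('o, 'v, 'h, 'c, 'p, 'w, 'k, 'd) htrans \<Rightarrow>
   'h \<Rightarrow> 'd" where
  "lax_comp_n D E \<psi> \<phi> r =
    (let \<phi>x = ob (ht_fun \<phi>) (ob (hdom D) r); \<phi>y = ob (ht_fun \<phi>) (ob (hcod D) r);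
         \<psi>x = ob (ht_fun \<psi>) (ob (hdom D) r); \<psi>y = ob (ht_fun \<psi>) (ob (hcod D) r);
         Fr = ob (lf1 (ht_dom \<phi>)) r; Gr = ob (lf1 (ht_cod \<phi>)) r; Hr = ob (lf1 (ht_cod \<psi>)) r
     in vinv2 E (associator E (\<psi>y, \<phi>y, Fr)) \<bullet>\<^bsub>E\<^esub> (vid2 E \<psi>y \<star>\<^bsub>E\<^esub> ht_n \<phi> r)
        \<bullet>\<^bsub>E\<^esub> associator E (\<psi>y, Gr, \<phi>x) \<bullet>\<^bsub>E\<^esub> (ht_n \<psi> r \<star>\<^bsub>E\<^esub> vid2 E \<phi>x)
        \<bullet>\<^bsub>E\<^esub> vinv2 E (associator E (Hr, \<psi>x, \<phi>x)))"

definition oplax_comp_n ::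
  "('o, 'v, 'h, 'c) pdcat \<Rightarrow> ('p, 'w, 'k, 'd) pdcat \<Rightarrow>
   ('o, 'v, 'h, 'c, 'p, 'w, 'k, 'd) htrans \<Rightarrow> ('o, 'v, 'h, 'c, 'p, 'w, 'k, 'd) htrans \<Rightarrow>
   'h \<Rightarrow> 'd" where
  "oplax_comp_n D E \<psi> \<phi> r =
    (let \<phi>x = ob (ht_fun \<phi>) (ob (hdom D) r); \<phi>y = ob (ht_fun \<phi>) (ob (hcod D) r);
         \<psi>x = ob (ht_fun \<psi>) (ob (hdom D) r); \<psi>y = ob (ht_fun \<psi>) (ob (hcod D) r);
         Fr = ob (lf1 (ht_dom \<phi>)) r; Gr = ob (lf1 (ht_cod \<phi>)) r; Hr = ob (lf1 (ht_cod \<psi>)) r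
     in associator E (Hr, \<psi>x, \<phi>x) \<bullet>\<^bsub>E\<^esub> (ht_n \<psi> r \<star>\<^bsub>E\<^esub> vid2 E \<phi>x)
        \<bullet>\<^bsub>E\<^esub> vinv2 E (associator E (\<psi>y, Gr, \<phi>x)) \<bullet>\<^bsub>E\<^esub> (vid2 E \<psi>y \<star>\<^bsub>E\<^esub> ht_n \<phi> r)
        \<bullet>\<^bsub>E\<^esub> associator E (\<psi>y, \<phi>y, Fr))"

definition Lax_lax ::
  "('o, 'v, 'h, 'c) pdcat \<Rightarrow> ('p, 'w, 'k, 'd) pdcat \<Rightarrow>
   (('o, 'v, 'h, 'c, 'p, 'w, 'k, 'd) lax_fun, ('o, 'v, 'h, 'c, 'p, 'w, 'k, 'd) vtrans,
    ('o, 'v, 'h, 'c, 'p, 'w, 'k, 'd) htrans, ('o, 'v, 'h, 'c, 'p, 'w, 'k, 'd) modif) pdcat" where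
  "Lax_lax D E = trans_pdcat D E {\<phi>. lax_transformation D E \<phi>} {\<Gamma>. lax_modification D E \<Gamma>}
     (lax_unit_n E) (lax_comp_n D E)"

definition Lax_opl ::
  "('o, 'v, 'h, 'c) pdcat \<Rightarrow> ('p, 'w, 'k, 'd) pdcat \<Rightarrow>
   (('o, 'v, 'h, 'c, 'p, 'w, 'k, 'd) lax_fun, ('o, 'v, 'h, 'c, 'p, 'w, 'k, 'd) vtrans,
    ('o, 'v, 'h, 'c, 'p, 'w, 'k, 'd) htrans, ('o, 'v, 'h, 'c, 'p, 'w, 'k, 'd) modif) pdcat" where
  "Lax_opl D E = trans_pdcat D E {\<phi>. oplax_transformation D E \<phi>} {\<Gamma>. oplax_modification D E \<Gamma>}
     (oplax_unit_n E) (oplax_comp_n D E)"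

end

theory Submission
  imports Defs
begin

text \<open>
  A horizontal or vertical composite, unit, unitor or associator of \<open>Lax_lax D E\<close> is given
  pointwise, so the axioms of a pseudodouble category hold pointwise once the pointwise data are
  known to be transformations and modifications; this is a coherence computation in the
  bicategory of globular cells of \<open>E\<close>.

  If \<open>r\<close> is a conjoint of \<open>f : a \<rightarrow> b\<close> with counit \<open>\<epsilon> : r \<rightarrow> 1\<^sub>b\<close>, then \<open>\<epsilon>\<close> and all the cells
  \<open>\<epsilon> \<cdot> w : r \<cdot> w \<rightarrow> 1\<^sub>b \<cdot> w\<close> are cartesian: a cell into \<open>r \<cdot> w\<close> is determined by its codomain and its
  composite with \<open>\<epsilon> \<cdot> w\<close>. Hence pointwise conjoints of a vertical transformation \<open>\<phi> : F \<rightarrow> G\<close>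
  extend uniquely to a lax horizontal transformation \<open>G \<rightarrow> F\<close> for which the \<open>\<epsilon>\<^sub>x\<close> form a
  modification, and every other equation follows from uniqueness.

  Reversing horizontal cells in \<open>D\<close> and \<open>E\<close> turns oplax transformations into lax ones and
  companions into conjoints, which gives the second half.
\<close>

section \<open>Categories and functors\<close>

text \<open>Lax transformations call for conjoints because of the side on which these sit. For
  \<phi> : F \<rightarrow> G the conjoint R x runs from G x to F x, and a lax constraint
  \<open>F r \<cdot> R x \<rightarrow> R y \<cdot> G r\<close> has a conjoint as left factor of its
  target. The dom of \<epsilon> y is an identity, so \<epsilon> y can be whiskered by G r on the
  right, and the constraint is the lift of the cell that makes \<epsilon> compatible with the unit
  transformation of G. An oplax constraint would end in \<open>F r \<cdot> R x\<close>, and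
  \<epsilon> x, whose cod is \<phi> x, cannot be whiskered by F r on the left.

  The laborious part is coherence: every rebracketing is derived from the pentagon and the triangle.

  Duality acts on the data and not on the finished structure: the multiplication cells of a lax
  functor are indexed by ordered pairs, so \<open>Lax_opl D E\<close> corresponds to the lax
  structure over the opposites through a translation of records.\<close>

context category
begin

lemma idt_cell [simp]:
  assumes "x \<in> Obj C"
  shows "Idt C x \<in> Arr C" "Src C (Idt C x) = x" "Trg C (Idt C x) = x"
  using idt_in[OF assms] by (auto simp: Hom_def)

lemma src_trg_obj [simp]: "f \<in> Arr C \<Longrightarrow> Src C f \<in> Obj C" "f \<in> Arr C \<Longrightarrow> Trg C f \<in> Obj C"
  by (auto intro: src_in trg_in)

lemma cmp_cell [simp]:
  assumes "f \<in> Arr C" "g \<in> Arr C" "Trg C f = Src C g"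
  shows "Cmp C g f \<in> Arr C" "Src C (Cmp C g f) = Src C f" "Trg C (Cmp C g f) = Trg C g"
  using cmp_in[of f "Src C f" "Trg C f" g "Trg C g"] assms by (auto simp: Hom_def)

lemma cmp_idt [simp]:
  "\<lbrakk>f \<in> Arr C; Trg C f = x\<rbrakk> \<Longrightarrow> Cmp C (Idt C x) f = f"
  "\<lbrakk>f \<in> Arr C; Src C f = x\<rbrakk> \<Longrightarrow> Cmp C f (Idt C x) = f"
  using idt_left[of f] idt_right[of f] by (auto simp: Hom_def)

lemma cmp_assoc_arr:
  "\<lbrakk>f \<in> Arr C; g \<in> Arr C; h \<in> Arr C; Trg C f = Src C g; Trg C g = Src C h\<rbrakk> \<Longrightarrow>
    Cmp C (Cmp C h g) f = Cmp C h (Cmp C g f)"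
  using cmp_assoc[of f "Src C f" "Trg C f" g "Trg C g" h "Trg C h"] by (auto simp: Hom_def)

text \<open>Composites are kept bracketed to the right, where a square \<open>h g = k l\<close>
  rarely finds its left side as a subterm. Attached with \<open>THEN\<close>, this rule and the
  variants \<open>cmp_reassoc1\<close> (one arrow on the right) and \<open>cmp_reassoc3\<close>
  (three arrows on the left) let an equation act in front of a tail \<open>f\<close>.\<close>

lemma cmp_reassoc:
  assumes "Cmp C h g = Cmp C k l"
    and "f \<in> Arr C" "g \<in> Arr C" "h \<in> Arr C" "k \<in> Arr C" "l \<in> Arr C"
    and "Trg C f = Src C g" "Trg C g = Src C h" "Trg C l = Src C k" "Src C l = Src C g"
  shows "Cmp C h (Cmp C g f) = Cmp C k (Cmp C l f)"
  using assms cmp_assoc_arr by metis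

lemma inverse_arrows_unique:
  assumes "inverse_arrows C f g" "inverse_arrows C f h" shows "g = h"
proof -
  have "Cmp C (Cmp C g f) h = Cmp C g (Cmp C f h)"
    by (rule cmp_assoc_arr) (use assms in \<open>auto simp: inverse_arrows_def Hom_def\<close>)
  then show ?thesis using assms by (simp add: inverse_arrows_def Hom_def)
qed

text \<open>Uniqueness of inverses evaluates the \<open>THE\<close> in \<open>inv_arrow\<close>, so
  an inverse can be computed by exhibiting one.\<close>

lemma inv_arrowI: "inverse_arrows C f g \<Longrightarrow> inv_arrow C f = g"
  unfolding inv_arrow_def using inverse_arrows_unique by blast

lemma iso_arrowI: "inverse_arrows C f g \<Longrightarrow> iso_arrow C f"
  by (auto simp: iso_arrow_def)

lemma iso_arrowD:
  assumes "iso_arrow C f"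
  shows "inverse_arrows C f (inv_arrow C f)"
  using assms inv_arrowI unfolding iso_arrow_def by blast

lemma inverse_arrows_sym: "inverse_arrows C f g \<Longrightarrow> inverse_arrows C g f"
  by (auto simp: inverse_arrows_def Hom_def)

lemma cmp_reassoc1:
  assumes "Cmp C h g = k"
    and "f \<in> Arr C" "g \<in> Arr C" "h \<in> Arr C" "Trg C f = Src C g" "Trg C g = Src C h"
  shows "Cmp C h (Cmp C g f) = Cmp C k f"
  using assms cmp_assoc_arr by metis

lemma cmp_reassoc3:
  assumes "Cmp C k (Cmp C h g) = Cmp C m l"
    and "f \<in> Arr C" "g \<in> Arr C" "h \<in> Arr C" "k \<in> Arr C" "m \<in> Arr C" "l \<in> Arr C"
    and "Trg C f = Src C g" "Trg C g = Src C h" "Trg C h = Src C k" "Trg C l = Src C m"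
    "Src C l = Src C g"
  shows "Cmp C k (Cmp C h (Cmp C g f)) = Cmp C m (Cmp C l f)"
proof -
  have "Cmp C k (Cmp C h (Cmp C g f)) = Cmp C (Cmp C k (Cmp C h g)) f"
    using assms(2-) by (simp add: cmp_assoc_arr)
  then show ?thesis using assms by (simp add: cmp_assoc_arr)
qed

lemma iso_arr: "iso_arrow C f \<Longrightarrow> f \<in> Arr C"
  by (auto simp: iso_arrow_def inverse_arrows_def)

lemma inv_cell [simp]:
  assumes "iso_arrow C f"
  shows "inv_arrow C f \<in> Arr C"
    "Src C (inv_arrow C f) = Trg C f" "Trg C (inv_arrow C f) = Src C f"
    "Cmp C (inv_arrow C f) f = Idt C (Src C f)" "Cmp C f (inv_arrow C f) = Idt C (Trg C f)"
  using iso_arrowD[OF assms] by (auto simp: inverse_arrows_def Hom_def)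

lemma iso_inv [simp]: "iso_arrow C f \<Longrightarrow> iso_arrow C (inv_arrow C f)"
  and inv_inv [simp]: "iso_arrow C f \<Longrightarrow> inv_arrow C (inv_arrow C f) = f"
proof -
  assume "iso_arrow C f"
  then have "inverse_arrows C (inv_arrow C f) f"
    using iso_arrowD inverse_arrows_sym by blast
  then show "iso_arrow C (inv_arrow C f)" "inv_arrow C (inv_arrow C f) = f"
    by (rule iso_arrowI, rule inv_arrowI)
qed

lemma inv_cancel [simp]:
  "\<lbrakk>iso_arrow C f; g \<in> Arr C; Trg C g = Src C f\<rbrakk> \<Longrightarrow> Cmp C (inv_arrow C f) (Cmp C f g) = g"
  "\<lbrakk>iso_arrow C f; g \<in> Arr C; Trg C g = Trg C f\<rbrakk> \<Longrightarrow> Cmp C f (Cmp C (inv_arrow C f) g) = g"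
  by (simp_all add: iso_arr flip: cmp_assoc_arr)

lemma iso_cmp:
  assumes "iso_arrow C f" "iso_arrow C g" "Trg C f = Src C g"
  shows "iso_arrow C (Cmp C g f)"
    and "inv_arrow C (Cmp C g f) = Cmp C (inv_arrow C f) (inv_arrow C g)"
proof -
  have "inverse_arrows C (Cmp C g f) (Cmp C (inv_arrow C f) (inv_arrow C g))"
    using assms by (simp add: iso_arr inverse_arrows_def Hom_def cmp_assoc_arr)
  then show "iso_arrow C (Cmp C g f)"
    and "inv_arrow C (Cmp C g f) = Cmp C (inv_arrow C f) (inv_arrow C g)"
    by (rule iso_arrowI, rule inv_arrowI)
qed

lemma iso_cancel_left:
  assumes "Cmp C f g = Cmp C f h" "iso_arrow C f"
    and "g \<in> Arr C" "h \<in> Arr C" "Trg C g = Src C f" "Trg C h = Src C f"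
  shows "g = h"
  using assms inv_cancel(1)[of f] by (metis)

lemma iso_cancel_right:
  assumes "Cmp C g f = Cmp C h f" "iso_arrow C f"
    and "g \<in> Arr C" "h \<in> Arr C" "Src C g = Trg C f" "Src C h = Trg C f"
  shows "g = h"
proof -
  have "Cmp C (Cmp C g f) (inv_arrow C f) = Cmp C (Cmp C h f) (inv_arrow C f)"
    using assms(1) by simp
  then show ?thesis using assms(2-) by (simp add: iso_arr cmp_assoc_arr)
qed

text \<open>Cancelling \<open>f\<close> and \<open>k\<close> turns a commuting square with two
  parallel isomorphisms into the square of their inverses. This gives naturality of inverse
  associators, of the inverse of \<open>gamma\<close> and of pointwise inverses of
  modifications.\<close>

lemma inv_commute:
  assumes "Cmp C g f = Cmp C k h" "iso_arrow C f" "iso_arrow C k"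
    and "g \<in> Arr C" "h \<in> Arr C" "Src C g = Trg C f" "Trg C h = Src C k"
    "Src C h = Src C f" "Trg C g = Trg C k"
  shows "Cmp C (inv_arrow C k) g = Cmp C h (inv_arrow C f)"
proof -
  have "Cmp C (inv_arrow C k) (Cmp C (Cmp C g f) (inv_arrow C f))
      = Cmp C (inv_arrow C k) (Cmp C (Cmp C k h) (inv_arrow C f))"
    using assms(1) by simp
  then show ?thesis using assms(2-) by (simp add: iso_arr cmp_assoc_arr)
qed

end

lemma (in is_functor) ob_ar [simp]:
  assumes "category C" "f \<in> Arr C"
  shows "ar F f \<in> Arr D" "Src D (ar F f) = ob F (Src C f)" "Trg D (ar F f) = ob F (Trg C f)"
  using ar_in[of f "Src C f" "Trg C f"] assms(2) by (auto simp: Hom_def)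

lemma (in is_functor) ar_cmp_arr:
  "\<lbrakk>f \<in> Arr C; g \<in> Arr C; Trg C f = Src C g\<rbrakk> \<Longrightarrow> ar F (Cmp C g f) = Cmp D (ar F g) (ar F f)"
  using ar_cmp[of f "Src C f" "Trg C f" g "Trg C g"] by (auto simp: Hom_def)

lemma is_functorI:
  assumes "\<And>x. x \<in> Obj C \<Longrightarrow> ob F x \<in> Obj D"
    and "\<And>f. f \<in> Arr C \<Longrightarrow> ar F f \<in> Arr D \<and> Src D (ar F f) = ob F (Src C f) \<and>
      Trg D (ar F f) = ob F (Trg C f)"
    and "\<And>x. x \<in> Obj C \<Longrightarrow> ar F (Idt C x) = Idt D (ob F x)"
    and "\<And>f g. \<lbrakk>f \<in> Arr C; g \<in> Arr C; Trg C f = Src C g\<rbrakk> \<Longrightarrow>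
      ar F (Cmp C g f) = Cmp D (ar F g) (ar F f)"
  shows "is_functor C D F"
  by unfold_locales (use assms in \<open>auto simp: Hom_def\<close>)

lemma nat_transI:
  assumes "\<And>x. x \<in> Obj C \<Longrightarrow>
      \<tau> x \<in> Arr D \<and> Src D (\<tau> x) = ob F x \<and> Trg D (\<tau> x) = ob G x"
    and "\<And>f. f \<in> Arr C \<Longrightarrow> Cmp D (\<tau> (Trg C f)) (ar F f) = Cmp D (ar G f) (\<tau> (Src C f))"
  shows "nat_trans C D F G \<tau>"
  by unfold_locales (use assms in \<open>auto simp: Hom_def\<close>)

lemma (in nat_trans) component_arr:
  "x \<in> Obj C \<Longrightarrow> \<tau> x \<in> Arr D" "x \<in> Obj C \<Longrightarrow> Src D (\<tau> x) = ob F x"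
  "x \<in> Obj C \<Longrightarrow> Trg D (\<tau> x) = ob G x"
  using component by (auto simp: Hom_def)

lemma (in nat_trans) natural_arr:
  "f \<in> Arr C \<Longrightarrow> Cmp D (\<tau> (Trg C f)) (ar F f) = Cmp D (ar G f) (\<tau> (Src C f))"
  using natural[of f "Src C f" "Trg C f"] by (auto simp: Hom_def)

lemma categoryI:
  assumes "\<And>f. f \<in> Arr C \<Longrightarrow> Src C f \<in> Obj C \<and> Trg C f \<in> Obj C"
    and "\<And>x. x \<in> Obj C \<Longrightarrow> Idt C x \<in> Arr C \<and> Src C (Idt C x) = x \<and> Trg C (Idt C x) = x"
    and "\<And>f g. \<lbrakk>f \<in> Arr C; g \<in> Arr C; Trg C f = Src C g\<rbrakk> \<Longrightarrow>
      Cmp C g f \<in> Arr C \<and> Src C (Cmp C g f) = Src C f \<and> Trg C (Cmp C g f) = Trg C g"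
    and "\<And>f. f \<in> Arr C \<Longrightarrow> Cmp C (Idt C (Trg C f)) f = f \<and> Cmp C f (Idt C (Src C f)) = f"
    and "\<And>f g h. \<lbrakk>f \<in> Arr C; g \<in> Arr C; h \<in> Arr C; Trg C f = Src C g; Trg C g = Src C h\<rbrakk> \<Longrightarrow>
      Cmp C (Cmp C h g) f = Cmp C h (Cmp C g f)"
  shows "category C"
  by unfold_locales (use assms in \<open>auto simp: Hom_def\<close>)

section \<open>Calculus of cells in a pseudodouble category\<close>

context pseudodouble_category
begin

abbreviation cell where "cell a \<equiv> a \<in> Arr (cat1 D)"
abbreviation hor where "hor r \<equiv> r \<in> Obj (cat1 D)"
abbreviation ver where "ver f \<equiv> f \<in> Arr (cat0 D)"
abbreviation src where "src \<equiv> Src (cat1 D)"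
abbreviation trg where "trg \<equiv> Trg (cat1 D)"
abbreviation dm where "dm \<equiv> ar (hdom D)"
abbreviation cd where "cd \<equiv> ar (hcod D)"
abbreviation od where "od \<equiv> ob (hdom D)"
abbreviation oc where "oc \<equiv> ob (hcod D)"
abbreviation idh where "idh \<equiv> Idt (cat1 D)"
abbreviation one where "one \<equiv> ob (hunit D)"
abbreviation one1 where "one1 \<equiv> ar (hunit D)"
abbreviation inv2 where "inv2 \<equiv> inv_arrow (cat1 D)"
abbreviation iso2 where "iso2 \<equiv> iso_arrow (cat1 D)"
abbreviation vc (infixr "\<cdot>" 60) where "b \<cdot> a \<equiv> Cmp (cat1 D) b a"
abbreviation hc1 (infixr "\<boxtimes>" 75) where "s \<boxtimes> r \<equiv> ob (hcomp D) (s, r)"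
abbreviation hc2 (infixr "\<otimes>" 70) where "b \<otimes> a \<equiv> ar (hcomp D) (b, a)"
abbreviation lu where "lu \<equiv> lunitor D"
abbreviation ru where "ru \<equiv> runitor D"
abbreviation asc where "asc t s r \<equiv> associator D (t, s, r)"

sublocale V: category "cat0 D" by (rule category0)
sublocale H: category "cat1 D" by (rule category1)

section \<open>Boundaries of cells, composites and structure cells\<close>

lemma composable_pairs_simps [simp]:
  "(s, r) \<in> Obj (composable_pairs D) \<longleftrightarrow> hor s \<and> hor r \<and> od s = oc r"
  "(b, a) \<in> Arr (composable_pairs D) \<longleftrightarrow> cell b \<and> cell a \<and> dm b = cd a"
  "Src (composable_pairs D) (b, a) = (src b, src a)"
  "Trg (composable_pairs D) (b, a) = (trg b, trg a)"
  "Idt (composable_pairs D) (s, r) = (idh s, idh r)"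
  "Cmp (composable_pairs D) (b', a') (b, a) = (b' \<cdot> b, a' \<cdot> a)"
  by (auto simp: composable_pairs_def)

lemma composable_triples_simps [simp]:
  "(t, s, r) \<in> Obj (composable_triples D) \<longleftrightarrow>
    hor t \<and> hor s \<and> hor r \<and> od t = oc s \<and> od s = oc r"
  "(c, b, a) \<in> Arr (composable_triples D) \<longleftrightarrow>
    cell c \<and> cell b \<and> cell a \<and> dm c = cd b \<and> dm b = cd a"
  "Src (composable_triples D) (c, b, a) = (src c, src b, src a)"
  "Trg (composable_triples D) (c, b, a) = (trg c, trg b, trg a)"
  "Idt (composable_triples D) (t, s, r) = (idh t, idh s, idh r)"
  "Cmp (composable_triples D) (c', b', a') (c, b, a) = (c' \<cdot> c, b' \<cdot> b, a' \<cdot> a)"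
  by (auto simp: composable_triples_def)

lemma hdom_cell [simp]:
  assumes "cell a"
  shows "ver (dm a)" "Src (cat0 D) (dm a) = od (src a)" "Trg (cat0 D) (dm a) = od (trg a)"
  using is_functor.ob_ar[OF functor_hdom category1 assms] by auto

lemma hcod_cell [simp]:
  assumes "cell a"
  shows "ver (cd a)" "Src (cat0 D) (cd a) = oc (src a)" "Trg (cat0 D) (cd a) = oc (trg a)"
  using is_functor.ob_ar[OF functor_hcod category1 assms] by auto

lemma hor_bound [simp]:
  assumes "hor r"
  shows "od r \<in> Obj (cat0 D)" "oc r \<in> Obj (cat0 D)"
    "dm (idh r) = Idt (cat0 D) (od r)" "cd (idh r) = Idt (cat0 D) (oc r)"
  using is_functor.ob_in[OF functor_hdom assms] is_functor.ob_in[OF functor_hcod assms]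
    is_functor.ar_idt[OF functor_hdom assms] is_functor.ar_idt[OF functor_hcod assms] by auto

lemma bound_cmp [simp]:
  assumes "cell a" "cell b" "trg a = src b"
  shows "dm (b \<cdot> a) = Cmp (cat0 D) (dm b) (dm a)" "cd (b \<cdot> a) = Cmp (cat0 D) (cd b) (cd a)"
  using is_functor.ar_cmp_arr[OF functor_hdom assms] is_functor.ar_cmp_arr[OF functor_hcod assms]
  by auto

lemma hunit_ob [simp]:
  assumes "x \<in> Obj (cat0 D)"
  shows "hor (one x)" "od (one x) = x" "oc (one x) = x"
    "one1 (Idt (cat0 D) x) = idh (one x)"
  using is_functor.ob_in[OF functor_hunit assms] is_functor.ar_idt[OF functor_hunit assms]
    hdom_hunit hcod_hunit assms by (auto simp: fctr_eq_def fcomp_def id_fctr_def)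

lemma hunit_ar [simp]:
  assumes "ver f"
  shows "cell (one1 f)" "src (one1 f) = one (Src (cat0 D) f)"
    "trg (one1 f) = one (Trg (cat0 D) f)" "dm (one1 f) = f" "cd (one1 f) = f"
  using is_functor.ob_ar[OF functor_hunit category0 assms] hdom_hunit hcod_hunit assms
  by (auto simp: fctr_eq_def fcomp_def id_fctr_def)

lemma hunit_cmp:
  "\<lbrakk>ver f; ver g; Trg (cat0 D) f = Src (cat0 D) g\<rbrakk> \<Longrightarrow>
    one1 (Cmp (cat0 D) g f) = one1 g \<cdot> one1 f"
  using is_functor.ar_cmp_arr[OF functor_hunit] by auto

lemma hcomp_ob [simp]:
  assumes "hor s" "hor r" "od s = oc r"
  shows "hor (s \<boxtimes> r)" "od (s \<boxtimes> r) = od r" "oc (s \<boxtimes> r) = oc s"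
  using is_functor.ob_in[OF functor_hcomp, of "(s, r)"] hdom_hcomp hcod_hcomp assms
  by (auto simp: fctr_eq_def fcomp_def fst_fctr_def snd_fctr_def)

lemma hcomp_idh [simp]:
  assumes "hor s" "hor r" "od s = oc r"
  shows "idh s \<otimes> idh r = idh (s \<boxtimes> r)"
  using is_functor.ar_idt[OF functor_hcomp, of "(s, r)"] assms by simp

lemma composable_obs:
  assumes "cell b" "cell a" "dm b = cd a"
  shows "od (src b) = oc (src a)" "od (trg b) = oc (trg a)"
  using assms by (metis hdom_cell(2) hcod_cell(2)) (metis assms hdom_cell(3) hcod_cell(3))

lemma hcomp_ar [simp]:
  assumes "cell b" "cell a" "dm b = cd a"
  shows "cell (b \<otimes> a)" "src (b \<otimes> a) = src b \<boxtimes> src a" "trg (b \<otimes> a) = trg b \<boxtimes> trg a"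
    "dm (b \<otimes> a) = dm a" "cd (b \<otimes> a) = cd b"
proof -
  have "b \<otimes> a \<in> Hom (cat1 D) (src b \<boxtimes> src a) (trg b \<boxtimes> trg a)"
    using is_functor.ar_in[OF functor_hcomp, of "(b, a)" "(src b, src a)" "(trg b, trg a)"] assms
    by (auto simp: Hom_def)
  then show "cell (b \<otimes> a)" "src (b \<otimes> a) = src b \<boxtimes> src a" "trg (b \<otimes> a) = trg b \<boxtimes> trg a"
    by (auto simp: Hom_def)
  show "dm (b \<otimes> a) = dm a" "cd (b \<otimes> a) = cd b"
    using hdom_hcomp hcod_hcomp assms
    by (auto simp: fctr_eq_def fcomp_def fst_fctr_def snd_fctr_def)
qed

lemma interchange:
  assumes "cell b" "cell a" "dm b = cd a" "cell b'" "cell a'" "dm b' = cd a'"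
    "trg b = src b'" "trg a = src a'"
  shows "(b' \<otimes> a') \<cdot> (b \<otimes> a) = (b' \<cdot> b) \<otimes> (a' \<cdot> a)"
  using is_functor.ar_cmp_arr[OF functor_hcomp, of "(b, a)" "(b', a')"] assms by simp

text \<open>\<open>globular\<close> only says that dom and cod are identities of some 0-cells.
  Comparing the source and target of these identities with the boundary of \<open>a\<close> shows
  which ones they are, and that source and target of \<open>a\<close> are parallel.\<close>

lemma globularD:
  assumes "globular D a"
  shows "cell a" "dm a = Idt (cat0 D) (od (src a))" "dm a = Idt (cat0 D) (od (trg a))"
    "cd a = Idt (cat0 D) (oc (src a))" "cd a = Idt (cat0 D) (oc (trg a))"
    "od (trg a) = od (src a)" "oc (trg a) = oc (src a)"
proof -
  show a: "cell a" using assms by (simp add: globular_def)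
  obtain x y where xy: "x \<in> Obj (cat0 D)" "y \<in> Obj (cat0 D)"
    "dm a = Idt (cat0 D) x" "cd a = Idt (cat0 D) y"
    using assms by (auto simp: globular_def)
  have "od (src a) = x" "od (trg a) = x" "oc (src a) = y" "oc (trg a) = y"
    using hdom_cell(2,3)[OF a] hcod_cell(2,3)[OF a] xy by auto
  then show "dm a = Idt (cat0 D) (od (src a))" "dm a = Idt (cat0 D) (od (trg a))"
    "cd a = Idt (cat0 D) (oc (src a))" "cd a = Idt (cat0 D) (oc (trg a))"
    "od (trg a) = od (src a)" "oc (trg a) = oc (src a)"
    using xy by auto
qed

lemma globularI:
  assumes "cell a" "dm a = Idt (cat0 D) x" "cd a = Idt (cat0 D) y"
    "x \<in> Obj (cat0 D)" "y \<in> Obj (cat0 D)"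
  shows "globular D a"
  using assms by (auto simp: globular_def)

lemma iso_bounds:
  assumes "iso2 a"
  shows "inverse_arrows (cat0 D) (dm a) (dm (inv2 a))"
    "inverse_arrows (cat0 D) (cd a) (cd (inv2 a))"
proof -
  note c = H.inv_cell[OF assms] H.iso_arr[OF assms]
  have "Cmp (cat0 D) (dm (inv2 a)) (dm a) = Idt (cat0 D) (od (src a))"
    "Cmp (cat0 D) (dm a) (dm (inv2 a)) = Idt (cat0 D) (od (trg a))"
    using bound_cmp(1)[of a "inv2 a"] bound_cmp(1)[of "inv2 a" a] c hor_bound(3) by auto
  moreover have "Cmp (cat0 D) (cd (inv2 a)) (cd a) = Idt (cat0 D) (oc (src a))"
    "Cmp (cat0 D) (cd a) (cd (inv2 a)) = Idt (cat0 D) (oc (trg a))"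
    using bound_cmp(2)[of a "inv2 a"] bound_cmp(2)[of "inv2 a" a] c hor_bound(4) by auto
  ultimately show "inverse_arrows (cat0 D) (dm a) (dm (inv2 a))"
    "inverse_arrows (cat0 D) (cd a) (cd (inv2 a))"
    using c by (simp_all add: inverse_arrows_def Hom_def)
qed

text \<open>Dom and cod are functors, so they send the inverse cell to an inverse of an identity,
  which is that identity.\<close>

lemma globular_inv:
  assumes "iso2 a" "globular D a"
  shows "dm (inv2 a) = dm a" "cd (inv2 a) = cd a" "globular D (inv2 a)"
proof -
  have *: "inverse_arrows (cat0 D) (Idt (cat0 D) x) (Idt (cat0 D) x)" if "x \<in> Obj (cat0 D)" for x
    using that by (simp add: inverse_arrows_def Hom_def)
  note g = globularD[OF assms(2)]
  show 1: "dm (inv2 a) = dm a" "cd (inv2 a) = cd a"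
    using V.inverse_arrows_unique[OF iso_bounds(1)[OF assms(1)], of "dm a"]
      V.inverse_arrows_unique[OF iso_bounds(2)[OF assms(1)], of "cd a"]
      *[of "od (src a)"] *[of "oc (src a)"] g(1) unfolding g(2,4) by simp_all
  show "globular D (inv2 a)"
    using assms 1 by (simp add: globular_def)
qed

lemma hcomp_inverse:
  assumes "iso2 a" "iso2 b" "dm b = cd a" "dm (inv2 b) = cd (inv2 a)"
  shows "iso2 (b \<otimes> a)" "inv2 (b \<otimes> a) = inv2 b \<otimes> inv2 a"
proof -
  have "inverse_arrows (cat1 D) (b \<otimes> a) (inv2 b \<otimes> inv2 a)"
    using assms composable_obs[of b a] H.iso_arr[OF assms(1)] H.iso_arr[OF assms(2)]
    by (simp add: inverse_arrows_def Hom_def interchange)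
  then show "iso2 (b \<otimes> a)" "inv2 (b \<otimes> a) = inv2 b \<otimes> inv2 a"
    by (rule H.iso_arrowI, rule H.inv_arrowI)
qed

lemma lunitor_cell [simp]:
  assumes "hor r"
  shows "iso2 (lu r)" "cell (lu r)" "src (lu r) = one (oc r) \<boxtimes> r" "trg (lu r) = r"
    "dm (lu r) = Idt (cat0 D) (od r)" "cd (lu r) = Idt (cat0 D) (oc r)"
    "dm (inv2 (lu r)) = Idt (cat0 D) (od r)" "cd (inv2 (lu r)) = Idt (cat0 D) (oc r)"
proof -
  show i: "iso2 (lu r)" using lunitor_iso assms by (simp add: nat_iso_def)
  show c: "cell (lu r)" "src (lu r) = one (oc r) \<boxtimes> r" "trg (lu r) = r"
    using lunitor_iso assms nat_trans.component_arr[of "cat1 D" "cat1 D" _ _ lu r]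
    by (auto simp: nat_iso_def hcomp_fctr_def fcomp_def pair_fctr_def id_fctr_def)
  show d: "dm (lu r) = Idt (cat0 D) (od r)" "cd (lu r) = Idt (cat0 D) (oc r)"
    using globularD(3,5)[OF lunitor_globular[OF assms]] c by auto
  show "dm (inv2 (lu r)) = Idt (cat0 D) (od r)" "cd (inv2 (lu r)) = Idt (cat0 D) (oc r)"
    using globular_inv[OF i lunitor_globular[OF assms]] d by auto
qed

lemma runitor_cell [simp]:
  assumes "hor r"
  shows "iso2 (ru r)" "cell (ru r)" "src (ru r) = r \<boxtimes> one (od r)" "trg (ru r) = r"
    "dm (ru r) = Idt (cat0 D) (od r)" "cd (ru r) = Idt (cat0 D) (oc r)"
    "dm (inv2 (ru r)) = Idt (cat0 D) (od r)" "cd (inv2 (ru r)) = Idt (cat0 D) (oc r)"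
proof -
  show i: "iso2 (ru r)" using runitor_iso assms by (simp add: nat_iso_def)
  show c: "cell (ru r)" "src (ru r) = r \<boxtimes> one (od r)" "trg (ru r) = r"
    using runitor_iso assms nat_trans.component_arr[of "cat1 D" "cat1 D" _ _ ru r]
    by (auto simp: nat_iso_def hcomp_fctr_def fcomp_def pair_fctr_def id_fctr_def)
  show d: "dm (ru r) = Idt (cat0 D) (od r)" "cd (ru r) = Idt (cat0 D) (oc r)"
    using globularD(3,5)[OF runitor_globular[OF assms]] c by auto
  show "dm (inv2 (ru r)) = Idt (cat0 D) (od r)" "cd (inv2 (ru r)) = Idt (cat0 D) (oc r)"
    using globular_inv[OF i runitor_globular[OF assms]] d by auto
qed

lemma associator_cell [simp]:
  assumes "hor t" "hor s" "hor r" "od t = oc s" "od s = oc r"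
  shows "iso2 (asc t s r)" "cell (asc t s r)" "src (asc t s r) = (t \<boxtimes> s) \<boxtimes> r"
    "trg (asc t s r) = t \<boxtimes> s \<boxtimes> r"
    "dm (asc t s r) = Idt (cat0 D) (od r)" "cd (asc t s r) = Idt (cat0 D) (oc t)"
    "dm (inv2 (asc t s r)) = Idt (cat0 D) (od r)" "cd (inv2 (asc t s r)) = Idt (cat0 D) (oc t)"
proof -
  show i: "iso2 (asc t s r)"
    using associator_iso assms by (auto simp: nat_iso_def)
  have o: "(t, s, r) \<in> Obj (composable_triples D)" using assms by simp
  show c: "cell (asc t s r)" "src (asc t s r) = (t \<boxtimes> s) \<boxtimes> r" "trg (asc t s r) = t \<boxtimes> s \<boxtimes> r"
    using associator_iso nat_trans.component_arr[OF _ o] unfolding nat_iso_def by fastforce+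
  show d: "dm (asc t s r) = Idt (cat0 D) (od r)" "cd (asc t s r) = Idt (cat0 D) (oc t)"
    using globularD(3,5)[OF associator_globular[OF o]] c assms by auto
  show "dm (inv2 (asc t s r)) = Idt (cat0 D) (od r)" "cd (inv2 (asc t s r)) = Idt (cat0 D) (oc t)"
    using globular_inv[OF i associator_globular[OF o]] d by auto
qed

section \<open>Naturality of the structure cells\<close>

lemma lunitor_natural:
  assumes "cell a"
  shows "lu (trg a) \<cdot> (one1 (cd a) \<otimes> a) = a \<cdot> lu (src a)"
  using nat_trans.natural_arr[OF _ assms] lunitor_iso
  unfolding nat_iso_def hcomp_fctr_def fcomp_def pair_fctr_def id_fctr_def by fastforce

lemma runitor_natural:
  assumes "cell a"
  shows "ru (trg a) \<cdot> (a \<otimes> one1 (dm a)) = a \<cdot> ru (src a)"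
  using nat_trans.natural_arr[OF _ assms] runitor_iso
  unfolding nat_iso_def hcomp_fctr_def fcomp_def pair_fctr_def id_fctr_def by fastforce

lemma associator_natural:
  assumes "cell c" "cell b" "cell a" "dm c = cd b" "dm b = cd a"
  shows "asc (trg c) (trg b) (trg a) \<cdot> ((c \<otimes> b) \<otimes> a)
    = (c \<otimes> b \<otimes> a) \<cdot> asc (src c) (src b) (src a)"
proof -
  have "(c, b, a) \<in> Arr (composable_triples D)" using assms by simp
  from nat_trans.natural_arr[OF _ this] associator_iso show ?thesis
    unfolding nat_iso_def by fastforce
qed

text \<open>Naturality of the left unitor conjugates \<open>one1 (cd a) \<otimes> a\<close> to
  \<open>a\<close>. A unit factor can thus be added to an equation and removed again, in the
  coherence laws for units and in the uniqueness of lifts along a conjoint.\<close>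

lemma one1_faithful_left:
  assumes "one1 (cd a) \<otimes> a = one1 (cd a) \<otimes> b"
    and "cell a" "cell b" "src a = src b" "trg a = trg b" "cd a = cd b"
  shows "a = b"
  by (rule H.iso_cancel_right[of a "lu (src a)" b])
    (use lunitor_natural[of a] lunitor_natural[of b] assms in auto)

lemma one1_faithful_right:
  assumes "a \<otimes> one1 (dm a) = b \<otimes> one1 (dm a)"
    and "cell a" "cell b" "src a = src b" "trg a = trg b" "dm a = dm b"
  shows "a = b"
  by (rule H.iso_cancel_right[of a "ru (src a)" b])
    (use runitor_natural[of a] runitor_natural[of b] assms in auto)

lemma iso_idh [simp]: "hor r \<Longrightarrow> iso2 (idh r)" "hor r \<Longrightarrow> inv2 (idh r) = idh r"
proof -
  assume "hor r"
  then have "inverse_arrows (cat1 D) (idh r) (idh r)" by (simp add: inverse_arrows_def Hom_def)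
  then show "iso2 (idh r)" "inv2 (idh r) = idh r" by (rule H.iso_arrowI, rule H.inv_arrowI)
qed

section \<open>Coherence laws for units\<close>

lemma triangle':
  assumes "hor s" "hor r" "od s = oc r"
  shows "(idh s \<otimes> lu r) \<cdot> asc s (one (oc r)) r = ru s \<otimes> idh r"
  using triangle[of s r] assms by simp

lemma pentagon':
  assumes "hor u" "hor t" "hor s" "hor r" "od u = oc t" "od t = oc s" "od s = oc r"
  shows "asc u t (s \<boxtimes> r) \<cdot> asc (u \<boxtimes> t) s r
    = (idh u \<otimes> asc t s r) \<cdot> asc u (t \<boxtimes> s) r \<cdot> (asc u t s \<otimes> idh r)"
  using pentagon[of u t s r] assms by simp

text \<open>Kelly's argument; the axioms contain only the triangle with the unit in the middle.
  After tensoring with a unit on the left, the pentagon brings in two such triangles, one at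
  \<open>s \<boxtimes> r\<close> and one at \<open>s\<close>, and naturality of the associator makes
  the two sides agree. The auxiliary unit is removed by \<open>one1_faithful_left\<close>.\<close>

lemma lunitor_hcomp:
  assumes "hor s" "hor r" "od s = oc r"
  shows "lu (s \<boxtimes> r) \<cdot> asc (one (oc s)) s r = lu s \<otimes> idh r"
proof -
  let ?u = "one (oc s)"
  have "(idh ?u \<otimes> (lu (s \<boxtimes> r) \<cdot> asc ?u s r)) \<cdot> asc ?u (?u \<boxtimes> s) r \<cdot> (asc ?u ?u s \<otimes> idh r)
      = (idh ?u \<otimes> lu (s \<boxtimes> r)) \<cdot> asc ?u ?u (s \<boxtimes> r) \<cdot> asc (?u \<boxtimes> ?u) s r"
    using assms by (simp add: pentagon' interchange flip: H.cmp_assoc_arr)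
  also have "\<dots> = (ru ?u \<otimes> idh s \<otimes> idh r) \<cdot> asc (?u \<boxtimes> ?u) s r"
    using triangle'[of ?u "s \<boxtimes> r"] assms by (simp flip: H.cmp_assoc_arr)
  also have "\<dots> = asc ?u s r \<cdot> ((ru ?u \<otimes> idh s) \<otimes> idh r)"
    using assms associator_natural[of "ru ?u" "idh s" "idh r"] by simp
  also have "\<dots> = asc ?u s r \<cdot> ((idh ?u \<otimes> lu s) \<otimes> idh r) \<cdot> (asc ?u ?u s \<otimes> idh r)"
    using assms by (simp add: interchange flip: triangle')
  also have "\<dots> = (idh ?u \<otimes> lu s \<otimes> idh r) \<cdot> asc ?u (?u \<boxtimes> s) r \<cdot> (asc ?u ?u s \<otimes> idh r)"
    by (rule H.cmp_reassoc)
      (use assms associator_natural[of "idh ?u" "lu s" "idh r"] in simp_all)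
  finally have "idh ?u \<otimes> (lu (s \<boxtimes> r) \<cdot> asc ?u s r) = idh ?u \<otimes> lu s \<otimes> idh r"
    by (rule H.iso_cancel_right[where f = "asc ?u (?u \<boxtimes> s) r \<cdot> (asc ?u ?u s \<otimes> idh r)"])
      (use assms in \<open>simp_all add: H.cmp_assoc_arr H.iso_cmp hcomp_inverse\<close>)
  with assms show ?thesis
    by - (rule one1_faithful_left, simp_all)
qed

text \<open>Mirror image of \<open>lunitor_hcomp\<close>, with the auxiliary unit on the
  right.\<close>

lemma runitor_hcomp:
  assumes "hor s" "hor r" "od s = oc r"
  shows "(idh s \<otimes> ru r) \<cdot> asc s r (one (od r)) = ru (s \<boxtimes> r)"
proof -
  let ?w = "one (od r)"
  have "asc s r ?w \<cdot> (((idh s \<otimes> ru r) \<cdot> asc s r ?w) \<otimes> idh ?w)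
      = asc s r ?w \<cdot> ((idh s \<otimes> ru r) \<otimes> idh ?w) \<cdot> (asc s r ?w \<otimes> idh ?w)"
    using assms by (simp add: interchange)
  also have "\<dots> = (idh s \<otimes> ru r \<otimes> idh ?w) \<cdot> asc s (r \<boxtimes> ?w) ?w \<cdot> (asc s r ?w \<otimes> idh ?w)"
    by (rule H.cmp_reassoc)
      (use assms associator_natural[of "idh s" "ru r" "idh ?w"] in simp_all)
  also have "\<dots> = (idh s \<otimes> idh r \<otimes> lu ?w) \<cdot> (idh s \<otimes> asc r ?w ?w) \<cdot> asc s (r \<boxtimes> ?w) ?w
      \<cdot> (asc s r ?w \<otimes> idh ?w)"
    using assms triangle'[of r ?w] by (simp add: interchange flip: H.cmp_assoc_arr)
  also have "\<dots> = (idh s \<otimes> idh r \<otimes> lu ?w) \<cdot> asc s r (?w \<boxtimes> ?w) \<cdot> asc (s \<boxtimes> r) ?w ?w"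
    using assms by (simp add: pentagon')
  also have "\<dots> = asc s r ?w \<cdot> (idh (s \<boxtimes> r) \<otimes> lu ?w) \<cdot> asc (s \<boxtimes> r) ?w ?w"
    by (rule H.cmp_reassoc)
      (use assms associator_natural[of "idh s" "idh r" "lu ?w"] in simp_all)
  also have "\<dots> = asc s r ?w \<cdot> (ru (s \<boxtimes> r) \<otimes> idh ?w)"
    using triangle'[of "s \<boxtimes> r" ?w] assms by simp
  finally have "((idh s \<otimes> ru r) \<cdot> asc s r ?w) \<otimes> idh ?w = ru (s \<boxtimes> r) \<otimes> idh ?w"
    by (rule H.iso_cancel_left[where f = "asc s r ?w"]) (use assms in simp_all)
  with assms show ?thesis
    by - (rule one1_faithful_right, simp_all)
qed

text \<open>Naturality of \<open>lu\<close> along \<open>lu ?u\<close> gives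
  \<open>idh ?u \<otimes> lu ?u = lu (?u \<boxtimes> ?u)\<close>; the middle and the left triangle
  then identify \<open>lu\<close> and \<open>ru\<close> after tensoring with a unit. Hence
  \<open>gamma\<close> is trivial at a unit.\<close>

lemma lunitor_eq_runitor:
  assumes "x \<in> Obj (cat0 D)"
  shows "lu (one x) = ru (one x)"
proof -
  let ?u = "one x"
  have "lu ?u \<cdot> (idh ?u \<otimes> lu ?u) = lu ?u \<cdot> lu (?u \<boxtimes> ?u)"
    using lunitor_natural[of "lu ?u"] assms by simp
  then have "idh ?u \<otimes> lu ?u = lu (?u \<boxtimes> ?u)"
    by (rule H.iso_cancel_left[where f = "lu ?u"]) (use assms in simp_all)
  then have "lu ?u \<otimes> idh ?u = ru ?u \<otimes> idh ?u"
    using triangle'[of ?u ?u] lunitor_hcomp[of ?u ?u] assms by simp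
  with assms show ?thesis
    by - (rule one1_faithful_right, simp_all)
qed

section \<open>Whiskering and rebracketing\<close>

lemma whisker_left_cmp:
  "\<lbrakk>cell a; cell b; trg a = src b; hor s; cd a = Idt (cat0 D) (od s); cd b = Idt (cat0 D) (od s)\<rbrakk> \<Longrightarrow>
    idh s \<otimes> (b \<cdot> a) = (idh s \<otimes> b) \<cdot> (idh s \<otimes> a)"
  by (simp add: interchange)

lemma whisker_right_cmp:
  "\<lbrakk>cell a; cell b; trg a = src b; hor r; dm a = Idt (cat0 D) (oc r); dm b = Idt (cat0 D) (oc r)\<rbrakk> \<Longrightarrow>
    (b \<cdot> a) \<otimes> idh r = (b \<otimes> idh r) \<cdot> (a \<otimes> idh r)"
  by (simp add: interchange)

text \<open>Naturality with two of the three cells identities. The product of two identities is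
  already written as the identity of the composite, the form in which it appears after
  simplification, and the target is named by a premise such as \<open>trg a = t\<close>, so that any
  term denoting it is matched.\<close>

lemma asc_nat1:
  "\<lbrakk>cell a; hor s; hor r; dm a = Idt (cat0 D) (oc s); od s = oc r; trg a = t\<rbrakk> \<Longrightarrow>
    asc t s r \<cdot> ((a \<otimes> idh s) \<otimes> idh r) = (a \<otimes> idh (s \<boxtimes> r)) \<cdot> asc (src a) s r"
  using associator_natural[of a "idh s" "idh r"] by simp

lemma asc_nat2:
  "\<lbrakk>cell a; hor t; hor r; dm a = Idt (cat0 D) (oc r); cd a = Idt (cat0 D) (od t); trg a = s\<rbrakk> \<Longrightarrow>
    asc t s r \<cdot> ((idh t \<otimes> a) \<otimes> idh r) = (idh t \<otimes> a \<otimes> idh r) \<cdot> asc t (src a) r"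
  using associator_natural[of "idh t" a "idh r"] by simp

lemma asc_nat3:
  "\<lbrakk>cell a; hor t; hor s; cd a = Idt (cat0 D) (od s); od t = oc s; trg a = r\<rbrakk> \<Longrightarrow>
    asc t s r \<cdot> (idh (t \<boxtimes> s) \<otimes> a) = (idh t \<otimes> idh s \<otimes> a) \<cdot> asc t s (src a)"
  using associator_natural[of "idh t" "idh s" a] by simp

lemma inv_asc_natural:
  assumes "cell c" "cell b" "cell a" "dm c = cd b" "dm b = cd a"
  shows "inv2 (asc (trg c) (trg b) (trg a)) \<cdot> (c \<otimes> b \<otimes> a)
    = ((c \<otimes> b) \<otimes> a) \<cdot> inv2 (asc (src c) (src b) (src a))"
  by (rule H.inv_commute[OF associator_natural[OF assms, symmetric]])
    (use assms composable_obs[of c b] composable_obs[of b a] in simp_all)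

lemma inv_asc_nat1:
  "\<lbrakk>cell a; hor s; hor r; dm a = Idt (cat0 D) (oc s); od s = oc r; trg a = t\<rbrakk> \<Longrightarrow>
    inv2 (asc t s r) \<cdot> (a \<otimes> idh (s \<boxtimes> r)) = ((a \<otimes> idh s) \<otimes> idh r) \<cdot> inv2 (asc (src a) s r)"
  using inv_asc_natural[of a "idh s" "idh r"] by simp

lemma inv_asc_nat2:
  "\<lbrakk>cell a; hor t; hor r; dm a = Idt (cat0 D) (oc r); cd a = Idt (cat0 D) (od t); trg a = s\<rbrakk> \<Longrightarrow>
    inv2 (asc t s r) \<cdot> (idh t \<otimes> a \<otimes> idh r) = ((idh t \<otimes> a) \<otimes> idh r) \<cdot> inv2 (asc t (src a) r)"
  using inv_asc_natural[of "idh t" a "idh r"] by simp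

lemma inv_asc_nat3:
  "\<lbrakk>cell a; hor t; hor s; cd a = Idt (cat0 D) (od s); od t = oc s; trg a = r\<rbrakk> \<Longrightarrow>
    inv2 (asc t s r) \<cdot> (idh t \<otimes> idh s \<otimes> a) = (idh (t \<boxtimes> s) \<otimes> a) \<cdot> inv2 (asc t s (src a))"
  using inv_asc_natural[of "idh t" "idh s" a] by simp

lemma inv_hcomp_asc [simp]:
  assumes "hor u" "hor t" "hor s" "hor r" "od u = oc t" "od t = oc s" "od s = oc r"
  shows "iso2 (asc u t s \<otimes> idh r)" "inv2 (asc u t s \<otimes> idh r) = inv2 (asc u t s) \<otimes> idh r"
    "iso2 (idh u \<otimes> asc t s r)" "inv2 (idh u \<otimes> asc t s r) = idh u \<otimes> inv2 (asc t s r)"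
  using assms by (simp_all add: hcomp_inverse)

lemma inv_pentagon:
  assumes "hor u" "hor t" "hor s" "hor r" "od u = oc t" "od t = oc s" "od s = oc r"
  shows "(inv2 (asc u t s) \<otimes> idh r) \<cdot> inv2 (asc u (t \<boxtimes> s) r) \<cdot> (idh u \<otimes> inv2 (asc t s r))
    = inv2 (asc (u \<boxtimes> t) s r) \<cdot> inv2 (asc u t (s \<boxtimes> r))"
proof -
  have "inv2 (asc u t (s \<boxtimes> r) \<cdot> asc (u \<boxtimes> t) s r)
      = inv2 ((idh u \<otimes> asc t s r) \<cdot> asc u (t \<boxtimes> s) r \<cdot> (asc u t s \<otimes> idh r))"
    using pentagon'[OF assms] by simp
  then show ?thesis using assms by (simp add: H.iso_cmp H.cmp_assoc_arr)
qed

text \<open>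
  Right whiskering of \<open>a : s \<cdot> r \<rightarrow> s' \<cdot> r'\<close> by \<open>t\<close>, rebracketed to a cell
  \<open>s \<cdot> (r \<cdot> t) \<rightarrow> s' \<cdot> (r' \<cdot> t)\<close>. With all composites bracketed to the right the associators
  disappear from the composition law of a transformation.
\<close>

definition whisker where
  "whisker s r s' r' a t = asc s' r' t \<cdot> (a \<otimes> idh t) \<cdot> inv2 (asc s r t)"

text \<open>Typing judgements in equational form, so that composability is decided by rewriting;
  \<open>x\<close> and \<open>y\<close> are dom and cod.\<close>

abbreviation hr where "hr r x y \<equiv> hor r \<and> od r = x \<and> oc r = y"
abbreviation gl where "gl a r s x y \<equiv>
  cell a \<and> src a = r \<and> trg a = s \<and> dm a = Idt (cat0 D) x \<and> cd a = Idt (cat0 D) y"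

lemma whisker_gl:
  assumes "gl a (s \<boxtimes> r) (s' \<boxtimes> r') y w" "hr r y z" "hr s z w" "hr r' y z'" "hr s' z' w" "hr t x y"
  shows "gl (whisker s r s' r' a t) (s \<boxtimes> r \<boxtimes> t) (s' \<boxtimes> r' \<boxtimes> t) x w"
proof -
  have "x \<in> Obj (cat0 D)" "w \<in> Obj (cat0 D)" using assms hor_bound by blast+
  then show ?thesis using assms by (simp add: whisker_def)
qed

lemma whisker_cancel [simp]:
  assumes "iso2 a" "cell a" "hor u"
  shows "\<lbrakk>cd a = Idt (cat0 D) (od u); cd (inv2 a) = Idt (cat0 D) (od u)\<rbrakk> \<Longrightarrow>
      (idh u \<otimes> inv2 a) \<cdot> (idh u \<otimes> a) = idh (u \<boxtimes> src a)"
    and "\<lbrakk>cd a = Idt (cat0 D) (od u); cd (inv2 a) = Idt (cat0 D) (od u)\<rbrakk> \<Longrightarrow>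
      (idh u \<otimes> a) \<cdot> (idh u \<otimes> inv2 a) = idh (u \<boxtimes> trg a)"
    and "\<lbrakk>dm a = Idt (cat0 D) (oc u); dm (inv2 a) = Idt (cat0 D) (oc u)\<rbrakk> \<Longrightarrow>
      (inv2 a \<otimes> idh u) \<cdot> (a \<otimes> idh u) = idh (src a \<boxtimes> u)"
    and "\<lbrakk>dm a = Idt (cat0 D) (oc u); dm (inv2 a) = Idt (cat0 D) (oc u)\<rbrakk> \<Longrightarrow>
      (a \<otimes> idh u) \<cdot> (inv2 a \<otimes> idh u) = idh (trg a \<boxtimes> u)"
  using assms composable_obs[of "idh u" a] composable_obs[of a "idh u"]
  by (simp_all add: interchange)

lemma whisker_cancel_tail [simp]:
  assumes "iso2 a" "cell a" "hor u" "cell b"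
  shows "\<lbrakk>cd a = Idt (cat0 D) (od u); cd (inv2 a) = Idt (cat0 D) (od u); trg b = u \<boxtimes> src a\<rbrakk> \<Longrightarrow>
      (idh u \<otimes> inv2 a) \<cdot> (idh u \<otimes> a) \<cdot> b = b"
    and "\<lbrakk>cd a = Idt (cat0 D) (od u); cd (inv2 a) = Idt (cat0 D) (od u); trg b = u \<boxtimes> trg a\<rbrakk> \<Longrightarrow>
      (idh u \<otimes> a) \<cdot> (idh u \<otimes> inv2 a) \<cdot> b = b"
    and "\<lbrakk>dm a = Idt (cat0 D) (oc u); dm (inv2 a) = Idt (cat0 D) (oc u); trg b = src a \<boxtimes> u\<rbrakk> \<Longrightarrow>
      (inv2 a \<otimes> idh u) \<cdot> (a \<otimes> idh u) \<cdot> b = b"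
    and "\<lbrakk>dm a = Idt (cat0 D) (oc u); dm (inv2 a) = Idt (cat0 D) (oc u); trg b = trg a \<boxtimes> u\<rbrakk> \<Longrightarrow>
      (a \<otimes> idh u) \<cdot> (inv2 a \<otimes> idh u) \<cdot> b = b"
  using assms whisker_cancel[OF assms(1-3)] by (simp_all flip: H.cmp_assoc_arr)

text \<open>The pentagon solved for different edges. All four versions trade an associator whiskered
  on the right for one whiskered on the left; the first two start from three associators and shorten
  the composite, the last two start from two.\<close>

lemma pentagon_shift1:
  assumes "hor u" "hor t" "hor s" "hor r" "od u = oc t" "od t = oc s" "od s = oc r"
  shows "asc u t (s \<boxtimes> r) \<cdot> asc (u \<boxtimes> t) s r \<cdot> (inv2 (asc u t s) \<otimes> idh r)
    = (idh u \<otimes> asc t s r) \<cdot> asc u (t \<boxtimes> s) r"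
  using assms pentagon'[OF assms, THEN H.cmp_reassoc1, of "inv2 (asc u t s) \<otimes> idh r"]
  by (simp add: H.cmp_assoc_arr)

lemma pentagon_shift2:
  assumes "hor u" "hor t" "hor s" "hor r" "od u = oc t" "od t = oc s" "od s = oc r"
  shows "asc u (t \<boxtimes> s) r \<cdot> (asc u t s \<otimes> idh r) \<cdot> inv2 (asc (u \<boxtimes> t) s r)
    = (idh u \<otimes> inv2 (asc t s r)) \<cdot> asc u t (s \<boxtimes> r)"
proof -
  have "(idh u \<otimes> inv2 (asc t s r)) \<cdot> (asc u t (s \<boxtimes> r) \<cdot> asc (u \<boxtimes> t) s r) \<cdot> inv2 (asc (u \<boxtimes> t) s r)
      = (idh u \<otimes> inv2 (asc t s r)) \<cdot> ((idh u \<otimes> asc t s r) \<cdot> asc u (t \<boxtimes> s) r \<cdot> (asc u t s \<otimes> idh r))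
        \<cdot> inv2 (asc (u \<boxtimes> t) s r)"
    using pentagon'[OF assms] by simp
  then show ?thesis using assms by (simp add: H.cmp_assoc_arr)
qed

lemma pentagon_shift3:
  assumes "hor u" "hor t" "hor s" "hor r" "od u = oc t" "od t = oc s" "od s = oc r"
  shows "(asc u t s \<otimes> idh r) \<cdot> inv2 (asc (u \<boxtimes> t) s r)
    = inv2 (asc u (t \<boxtimes> s) r) \<cdot> (idh u \<otimes> inv2 (asc t s r)) \<cdot> asc u t (s \<boxtimes> r)"
  using assms by (simp flip: pentagon_shift2)

lemma pentagon_shift4:
  assumes "hor u" "hor t" "hor s" "hor r" "od u = oc t" "od t = oc s" "od s = oc r"
  shows "(inv2 (asc u t s) \<otimes> idh r) \<cdot> inv2 (asc u (t \<boxtimes> s) r)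
    = inv2 (asc (u \<boxtimes> t) s r) \<cdot> inv2 (asc u t (s \<boxtimes> r)) \<cdot> (idh u \<otimes> asc t s r)"
  using assms inv_pentagon[OF assms, THEN arg_cong, of "\<lambda>X. X \<cdot> (idh u \<otimes> asc t s r)"]
  by (simp add: H.cmp_assoc_arr)

lemma pentagon_rev_tail:
  assumes "hor u" "hor t" "hor s" "hor r" "od u = oc t" "od t = oc s" "od s = oc r"
    and "cell a" "trg a = ((u \<boxtimes> t) \<boxtimes> s) \<boxtimes> r"
  shows "(idh u \<otimes> asc t s r) \<cdot> asc u (t \<boxtimes> s) r \<cdot> (asc u t s \<otimes> idh r) \<cdot> a
    = asc u t (s \<boxtimes> r) \<cdot> asc (u \<boxtimes> t) s r \<cdot> a"
  using pentagon'[OF assms(1-7), THEN H.cmp_reassoc1, of a] assms by (simp add: H.cmp_assoc_arr)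

lemmas pentagon_shifts = pentagon_shift1 pentagon_shift2
  pentagon_shift1[THEN H.cmp_reassoc3] pentagon_shift2[THEN H.cmp_reassoc3]

text \<open>The squares \<open>inv_asc_nat1\<close> and \<open>inv_asc_nat2\<close> read in the
  other direction: the inverse associator travels to the left, towards the cells applied
  later.\<close>

lemma inv_asc_nat1_rev:
  "\<lbrakk>cell a; hor s; hor r; dm a = Idt (cat0 D) (oc s); od s = oc r; src a = t\<rbrakk> \<Longrightarrow>
    ((a \<otimes> idh s) \<otimes> idh r) \<cdot> inv2 (asc t s r) = inv2 (asc (trg a) s r) \<cdot> (a \<otimes> idh (s \<boxtimes> r))"
  using inv_asc_nat1 by simp

lemma inv_asc_nat2_rev:
  "\<lbrakk>cell a; hor t; hor r; dm a = Idt (cat0 D) (oc r); cd a = Idt (cat0 D) (od t); src a = s\<rbrakk> \<Longrightarrow>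
    ((idh t \<otimes> a) \<otimes> idh r) \<cdot> inv2 (asc t s r) = inv2 (asc t (trg a) r) \<cdot> (idh t \<otimes> a \<otimes> idh r)"
  using inv_asc_nat2 by simp

lemmas inv_asc_rev = inv_asc_nat1_rev inv_asc_nat2_rev
  inv_asc_nat1_rev[THEN H.cmp_reassoc] inv_asc_nat2_rev[THEN H.cmp_reassoc]

lemmas split_simps = whisker_right_cmp whisker_left_cmp H.cmp_assoc_arr

text \<open>The cell whiskered by \<open>t\<close> on the right side is the constraint of a
  composite transformation, in the form of \<open>lax_comp_n\<close>, built from \<open>a\<close>
  and \<open>b\<close>. So two consecutive rebracketed whiskerings amount to whiskering the
  composite constraint once. Both the composition law of a composite and the compatibility of the
  associator rest on this.\<close>

lemma whisker_composite:
  assumes "hr h y2 y3" "hr p y1 y2" "hr q z y3" "hr g y1 z" "hr f y0 y1" "hr u z' z" "hr v y0 z'"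
    "hr t x y0"
    and a: "gl a (h \<boxtimes> p) (q \<boxtimes> g) y1 y3" and b: "gl b (g \<boxtimes> f) (u \<boxtimes> v) y0 z"
  shows "(idh q \<otimes> whisker g f u v b t) \<cdot> whisker h p q g a (f \<boxtimes> t)
    = asc q u (v \<boxtimes> t) \<cdot> asc (q \<boxtimes> u) v t
      \<cdot> ((inv2 (asc q u v) \<cdot> (idh q \<otimes> b) \<cdot> asc q g f \<cdot> (a \<otimes> idh f) \<cdot> inv2 (asc h p f)) \<otimes> idh t)
      \<cdot> inv2 (asc h (p \<boxtimes> f) t) \<cdot> (idh h \<otimes> inv2 (asc p f t))"
proof -
  have [simp]: "x \<in> Obj (cat0 D)" "z \<in> Obj (cat0 D)" "z' \<in> Obj (cat0 D)" "y0 \<in> Obj (cat0 D)"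
    "y1 \<in> Obj (cat0 D)" "y2 \<in> Obj (cat0 D)" "y3 \<in> Obj (cat0 D)"
    using assms(1-8) hor_bound by blast+
  show ?thesis
    using assms
    by (simp add: whisker_def split_simps inv_pentagon pentagon_shifts asc_nat2[THEN H.cmp_reassoc]
      inv_asc_rev)
qed

text \<open>Interchange: \<open>a\<close> and \<open>b\<close> act on different factors, and the
  associators move past \<open>b\<close> by naturality.\<close>

lemma whisker_natural:
  assumes "gl a (s \<boxtimes> r) (s' \<boxtimes> r') y w" "hr r y z" "hr s z w" "hr r' y z'" "hr s' z' w"
    and "gl b t t' x y" "hr t x y" "hr t' x y"
  shows "whisker s r s' r' a t' \<cdot> (idh s \<otimes> idh r \<otimes> b)
    = (idh s' \<otimes> idh r' \<otimes> b) \<cdot> whisker s r s' r' a t"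
proof -
  have [simp]: "x \<in> Obj (cat0 D)" "y \<in> Obj (cat0 D)" "w \<in> Obj (cat0 D)" "z \<in> Obj (cat0 D)"
    "z' \<in> Obj (cat0 D)"
    using assms hor_bound by blast+
  have 1: "(a \<otimes> idh t') \<cdot> (idh (s \<boxtimes> r) \<otimes> b) = (idh (s' \<boxtimes> r') \<otimes> b) \<cdot> (a \<otimes> idh t)"
    using assms by (simp add: interchange)
  show ?thesis
    using assms 1[THEN H.cmp_reassoc]
    by (simp add: whisker_def split_simps inv_asc_nat3 asc_nat3[THEN H.cmp_reassoc])
qed

text \<open>Two pentagons absorb the extra associators, and naturality merges the identities of
  \<open>s\<close> and \<open>t\<close> into that of the composite. Whiskering by \<open>s\<close>
  and then by \<open>t\<close> is thus whiskering by \<open>s \<boxtimes> t\<close>.\<close>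

lemma whisker_twice:
  assumes "hr h y2 y3" "hr p y1 y2" "hr q z y3" "hr g y1 z" "hr s y0 y1" "hr t x y0"
    and a: "gl a (h \<boxtimes> p) (q \<boxtimes> g) y1 y3"
  shows "(idh q \<otimes> asc g s t) \<cdot> asc q (g \<boxtimes> s) t \<cdot> (whisker h p q g a s \<otimes> idh t)
      \<cdot> inv2 (asc h (p \<boxtimes> s) t)
    = whisker h p q g a (s \<boxtimes> t) \<cdot> (idh h \<otimes> asc p s t)"
proof -
  have [simp]: "x \<in> Obj (cat0 D)" "z \<in> Obj (cat0 D)" "y0 \<in> Obj (cat0 D)"
    "y1 \<in> Obj (cat0 D)" "y2 \<in> Obj (cat0 D)" "y3 \<in> Obj (cat0 D)"
    using assms hor_bound by blast+
  show ?thesis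
    using assms
    by (simp add: whisker_def split_simps pentagon_rev_tail pentagon_shift4
        asc_nat1[THEN H.cmp_reassoc])
qed

text \<open>The composition law of a composite transformation, for the formula of
  \<open>lax_comp_n\<close>. Substituting the laws of \<open>q\<close> and \<open>p\<close> creates
  a doubly whiskered \<open>q'\<close>, which \<open>whisker_twice\<close> simplifies;
  \<open>whisker_natural\<close> moves \<open>p\<close> past it, and
  \<open>whisker_composite\<close> then joins \<open>p'\<close> and \<open>q'\<close> into the
  composite constraint at the second factor.\<close>

lemma composite_constraint_comp:
  assumes F: "hr Fr f0 f1" "hr Fs f1 f2" "hr Fsr f0 f2" and G: "hr Gr g0 g1" "hr Gs g1 g2" "hr Gsr g0 g2"
    and H: "hr Hr h0 h1" "hr Hs h1 h2" "hr Hsr h0 h2"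
    and ph: "hr \<phi>0 f0 g0" "hr \<phi>1 f1 g1" "hr \<phi>2 f2 g2"
    and ps: "hr \<psi>0 g0 h0" "hr \<psi>1 g1 h1" "hr \<psi>2 g2 h2"
    and m: "gl mF (Fs \<boxtimes> Fr) Fsr f0 f2" "gl mG (Gs \<boxtimes> Gr) Gsr g0 g2" "gl mH (Hs \<boxtimes> Hr) Hsr h0 h2"
    and np: "gl p (Gr \<boxtimes> \<phi>0) (\<phi>1 \<boxtimes> Fr) f0 g1" "gl p' (Gs \<boxtimes> \<phi>1) (\<phi>2 \<boxtimes> Fs) f1 g2"
      "gl p'' (Gsr \<boxtimes> \<phi>0) (\<phi>2 \<boxtimes> Fsr) f0 g2"
    and nq: "gl q (Hr \<boxtimes> \<psi>0) (\<psi>1 \<boxtimes> Gr) g0 h1" "gl q' (Hs \<boxtimes> \<psi>1) (\<psi>2 \<boxtimes> Gs) g1 h2"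
      "gl q'' (Hsr \<boxtimes> \<psi>0) (\<psi>2 \<boxtimes> Gsr) g0 h2"
    and p: "p'' \<cdot> (mG \<otimes> idh \<phi>0) = (idh \<phi>2 \<otimes> mF) \<cdot> asc \<phi>2 Fs Fr \<cdot> (p' \<otimes> idh Fr)
        \<cdot> inv2 (asc Gs \<phi>1 Fr) \<cdot> (idh Gs \<otimes> p) \<cdot> asc Gs Gr \<phi>0"
    and q: "q'' \<cdot> (mH \<otimes> idh \<psi>0) = (idh \<psi>2 \<otimes> mG) \<cdot> asc \<psi>2 Gs Gr \<cdot> (q' \<otimes> idh Gr)
        \<cdot> inv2 (asc Hs \<psi>1 Gr) \<cdot> (idh Hs \<otimes> q) \<cdot> asc Hs Hr \<psi>0"
  shows "(inv2 (asc \<psi>2 \<phi>2 Fsr) \<cdot> (idh \<psi>2 \<otimes> p'') \<cdot> asc \<psi>2 Gsr \<phi>0 \<cdot> (q'' \<otimes> idh \<phi>0)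
      \<cdot> inv2 (asc Hsr \<psi>0 \<phi>0)) \<cdot> (mH \<otimes> idh (\<psi>0 \<boxtimes> \<phi>0))
    = (idh (\<psi>2 \<boxtimes> \<phi>2) \<otimes> mF) \<cdot> asc (\<psi>2 \<boxtimes> \<phi>2) Fs Fr
      \<cdot> ((inv2 (asc \<psi>2 \<phi>2 Fs) \<cdot> (idh \<psi>2 \<otimes> p') \<cdot> asc \<psi>2 Gs \<phi>1 \<cdot> (q' \<otimes> idh \<phi>1)
        \<cdot> inv2 (asc Hs \<psi>1 \<phi>1)) \<otimes> idh Fr)
      \<cdot> inv2 (asc Hs (\<psi>1 \<boxtimes> \<phi>1) Fr)
      \<cdot> (idh Hs \<otimes> (inv2 (asc \<psi>1 \<phi>1 Fr) \<cdot> (idh \<psi>1 \<otimes> p) \<cdot> asc \<psi>1 Gr \<phi>0 \<cdot> (q \<otimes> idh \<phi>0)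
        \<cdot> inv2 (asc Hr \<psi>0 \<phi>0)))
      \<cdot> asc Hs Hr (\<psi>0 \<boxtimes> \<phi>0)" (is "?L = ?R")
proof -
  have [simp]: "f0 \<in> Obj (cat0 D)" "f1 \<in> Obj (cat0 D)" "f2 \<in> Obj (cat0 D)" "g0 \<in> Obj (cat0 D)"
    "g1 \<in> Obj (cat0 D)" "g2 \<in> Obj (cat0 D)" "h0 \<in> Obj (cat0 D)" "h1 \<in> Obj (cat0 D)"
    "h2 \<in> Obj (cat0 D)"
    using F G H hor_bound by blast+
  note [simp] = F G H ph ps m np nq
  let ?P = "whisker Gs \<phi>1 \<phi>2 Fs p' Fr" and ?Q = "whisker Hs \<psi>1 \<psi>2 Gs q'"
  note W = whisker_gl[OF np(2) ph(2) G(2) F(2) ph(3) F(1)]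
    whisker_gl[OF nq(2) ps(2) H(2) G(2) ps(3) G(1)]
    whisker_gl[OF nq(2) ps(2) H(2) G(2) ps(3), of "Gr \<boxtimes> \<phi>0" f0]
    whisker_gl[OF nq(2) ps(2) H(2) G(2) ps(3), of "\<phi>1 \<boxtimes> Fr" f0]
  note [simp] = W[simplified]
  \<comment> \<open>The law of \<open>q\<close> whiskered on the right by \<open>\<phi>0\<close>,
    with part of its associators hidden in \<open>whisker\<close>; \<open>E2\<close> is the law of
    \<open>p\<close> whiskered on the left by \<open>\<psi>2\<close>.\<close>
  have E1: "(q'' \<otimes> idh \<phi>0) \<cdot> ((mH \<otimes> idh \<psi>0) \<otimes> idh \<phi>0) = ((idh \<psi>2 \<otimes> mG) \<otimes> idh \<phi>0)
      \<cdot> (?Q Gr \<otimes> idh \<phi>0) \<cdot> ((idh Hs \<otimes> q) \<otimes> idh \<phi>0) \<cdot> (asc Hs Hr \<psi>0 \<otimes> idh \<phi>0)"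
  proof -
    have "q'' \<cdot> (mH \<otimes> idh \<psi>0) = (idh \<psi>2 \<otimes> mG) \<cdot> ?Q Gr \<cdot> (idh Hs \<otimes> q) \<cdot> asc Hs Hr \<psi>0"
      unfolding q by (simp add: whisker_def H.cmp_assoc_arr)
    then have "(q'' \<cdot> (mH \<otimes> idh \<psi>0)) \<otimes> idh \<phi>0
        = ((idh \<psi>2 \<otimes> mG) \<cdot> ?Q Gr \<cdot> (idh Hs \<otimes> q) \<cdot> asc Hs Hr \<psi>0) \<otimes> idh \<phi>0"
      by simp
    then show ?thesis by (simp add: whisker_right_cmp)
  qed
  have E2: "(idh \<psi>2 \<otimes> p'') \<cdot> (idh \<psi>2 \<otimes> mG \<otimes> idh \<phi>0) = (idh \<psi>2 \<otimes> idh \<phi>2 \<otimes> mF) \<cdot> (idh \<psi>2 \<otimes> ?P)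
      \<cdot> (idh \<psi>2 \<otimes> idh Gs \<otimes> p) \<cdot> (idh \<psi>2 \<otimes> asc Gs Gr \<phi>0)"
  proof -
    have "p'' \<cdot> (mG \<otimes> idh \<phi>0) = (idh \<phi>2 \<otimes> mF) \<cdot> ?P \<cdot> (idh Gs \<otimes> p) \<cdot> asc Gs Gr \<phi>0"
      unfolding p by (simp add: whisker_def H.cmp_assoc_arr)
    then have "idh \<psi>2 \<otimes> (p'' \<cdot> (mG \<otimes> idh \<phi>0))
        = idh \<psi>2 \<otimes> ((idh \<phi>2 \<otimes> mF) \<cdot> ?P \<cdot> (idh Gs \<otimes> p) \<cdot> asc Gs Gr \<phi>0)"
      by simp
    then show ?thesis by (simp add: whisker_left_cmp)
  qed
  have T: "(idh \<psi>2 \<otimes> asc Gs Gr \<phi>0) \<cdot> asc \<psi>2 (Gs \<boxtimes> Gr) \<phi>0 \<cdot> (?Q Gr \<otimes> idh \<phi>0)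
      \<cdot> inv2 (asc Hs (\<psi>1 \<boxtimes> Gr) \<phi>0) \<cdot> X = ?Q (Gr \<boxtimes> \<phi>0) \<cdot> (idh Hs \<otimes> asc \<psi>1 Gr \<phi>0) \<cdot> X"
    if "cell X" "trg X = Hs \<boxtimes> ((\<psi>1 \<boxtimes> Gr) \<boxtimes> \<phi>0)" for X
    using whisker_twice[OF H(2) ps(2) ps(3) G(2) G(1) ph(1) nq(2), THEN arg_cong, of "\<lambda>Y. Y \<cdot> X"] that
    by (simp add: H.cmp_assoc_arr)
  have N: "(idh \<psi>2 \<otimes> idh Gs \<otimes> p) \<cdot> ?Q (Gr \<boxtimes> \<phi>0) = ?Q (\<phi>1 \<boxtimes> Fr) \<cdot> (idh Hs \<otimes> idh \<psi>1 \<otimes> p)"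
    using whisker_natural[OF nq(2) ps(2) H(2) G(2) ps(3) np(1)] by simp
  \<comment> \<open>\<open>M\<close> is the composite constraint at \<open>s\<close>, and
    \<open>Z\<close> is the part of the composite constraint at \<open>r\<close> that is applied
    before \<open>p\<close>. As named cells they are whiskered without being taken apart.\<close>
  define M where "M = inv2 (asc \<psi>2 \<phi>2 Fs) \<cdot> (idh \<psi>2 \<otimes> p') \<cdot> asc \<psi>2 Gs \<phi>1 \<cdot> (q' \<otimes> idh \<phi>1)
        \<cdot> inv2 (asc Hs \<psi>1 \<phi>1)"
  define Z where "Z = asc \<psi>1 Gr \<phi>0 \<cdot> (q \<otimes> idh \<phi>0) \<cdot> inv2 (asc Hr \<psi>0 \<phi>0)"
  have M: "gl M (Hs \<boxtimes> \<psi>1 \<boxtimes> \<phi>1) ((\<psi>2 \<boxtimes> \<phi>2) \<boxtimes> Fs) f1 h2" by (simp add: M_def)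
  have Z: "gl Z (Hr \<boxtimes> \<psi>0 \<boxtimes> \<phi>0) (\<psi>1 \<boxtimes> Gr \<boxtimes> \<phi>0) f0 h1" by (simp add: Z_def)
  have "?L = inv2 (asc \<psi>2 \<phi>2 Fsr) \<cdot> (idh \<psi>2 \<otimes> idh \<phi>2 \<otimes> mF) \<cdot> (idh \<psi>2 \<otimes> ?P) \<cdot> (idh \<psi>2 \<otimes> idh Gs \<otimes> p)
      \<cdot> ?Q (Gr \<boxtimes> \<phi>0) \<cdot> (idh Hs \<otimes> Z) \<cdot> asc Hs Hr (\<psi>0 \<boxtimes> \<phi>0)"
    unfolding Z_def by (simp add: split_simps inv_asc_nat1 E1[THEN H.cmp_reassoc1]
      E2[THEN H.cmp_reassoc1] asc_nat2[THEN H.cmp_reassoc] pentagon_shift3 T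
      inv_asc_nat2_rev[THEN H.cmp_reassoc])
  also have "\<dots> = inv2 (asc \<psi>2 \<phi>2 Fsr) \<cdot> (idh \<psi>2 \<otimes> idh \<phi>2 \<otimes> mF) \<cdot> ((idh \<psi>2 \<otimes> ?P) \<cdot> ?Q (\<phi>1 \<boxtimes> Fr))
      \<cdot> (idh Hs \<otimes> idh \<psi>1 \<otimes> p) \<cdot> (idh Hs \<otimes> Z) \<cdot> asc Hs Hr (\<psi>0 \<boxtimes> \<phi>0)"
    by (simp add: H.cmp_assoc_arr Z N[THEN H.cmp_reassoc])
  also have "\<dots> = inv2 (asc \<psi>2 \<phi>2 Fsr) \<cdot> (idh \<psi>2 \<otimes> idh \<phi>2 \<otimes> mF)
      \<cdot> (asc \<psi>2 \<phi>2 (Fs \<boxtimes> Fr) \<cdot> asc (\<psi>2 \<boxtimes> \<phi>2) Fs Fr \<cdot> (M \<otimes> idh Fr)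
        \<cdot> inv2 (asc Hs (\<psi>1 \<boxtimes> \<phi>1) Fr) \<cdot> (idh Hs \<otimes> inv2 (asc \<psi>1 \<phi>1 Fr)))
      \<cdot> (idh Hs \<otimes> idh \<psi>1 \<otimes> p) \<cdot> (idh Hs \<otimes> Z) \<cdot> asc Hs Hr (\<psi>0 \<boxtimes> \<phi>0)"
    unfolding M_def
      whisker_composite[OF H(2) ps(2) ps(3) G(2) ph(2) ph(3) F(2) F(1) nq(2) np(2)] ..
  also have "\<dots> = (idh (\<psi>2 \<boxtimes> \<phi>2) \<otimes> mF) \<cdot> asc (\<psi>2 \<boxtimes> \<phi>2) Fs Fr \<cdot> (M \<otimes> idh Fr)
      \<cdot> inv2 (asc Hs (\<psi>1 \<boxtimes> \<phi>1) Fr)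
      \<cdot> (idh Hs \<otimes> (inv2 (asc \<psi>1 \<phi>1 Fr) \<cdot> (idh \<psi>1 \<otimes> p) \<cdot> Z))
      \<cdot> asc Hs Hr (\<psi>0 \<boxtimes> \<phi>0)"
    by (simp add: split_simps M Z inv_asc_nat3[THEN H.cmp_reassoc])
  finally show ?thesis unfolding M_def Z_def .
qed

section \<open>The swap \<open>gamma\<close>, and the constraints of units and composites\<close>

lemma gamma_simps [simp]:
  assumes "hor r"
  shows "iso2 (gamma D r)" "inv2 (gamma D r) = inv2 (lu r) \<cdot> ru r" "cell (gamma D r)"
    "src (gamma D r) = one (oc r) \<boxtimes> r" "trg (gamma D r) = r \<boxtimes> one (od r)"
    "dm (gamma D r) = Idt (cat0 D) (od r)" "cd (gamma D r) = Idt (cat0 D) (oc r)"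
  using assms by (simp_all add: gamma_def H.iso_cmp)

lemma triangle_inv:
  assumes "hor s" "hor r" "od s = oc r"
  shows "(idh s \<otimes> lu r) \<cdot> asc s (one (oc r)) r \<cdot> (inv2 (ru s) \<otimes> idh r) = idh (s \<boxtimes> r)"
  using triangle'[OF assms, THEN H.cmp_reassoc1, of "inv2 (ru s) \<otimes> idh r"] assms by simp

lemma triangle_inv':
  assumes "hor s" "hor r" "od s = oc r"
  shows "(ru s \<otimes> idh r) \<cdot> inv2 (asc s (one (oc r)) r) = idh s \<otimes> lu r"
  using assms by (simp add: H.cmp_assoc_arr flip: triangle')

lemma inv_lunitor_hcomp:
  assumes "hor s" "hor r" "od s = oc r"
  shows "(lu s \<otimes> idh r) \<cdot> inv2 (asc (one (oc s)) s r) = lu (s \<boxtimes> r)"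
  using assms by (simp add: H.cmp_assoc_arr flip: lunitor_hcomp)

lemma inv_runitor_hcomp:
  assumes "hor s" "hor r" "od s = oc r"
  shows "inv2 (asc s r (one (od r))) \<cdot> (idh s \<otimes> inv2 (ru r)) = inv2 (ru (s \<boxtimes> r))"
  using assms by (simp add: H.iso_cmp hcomp_inverse flip: runitor_hcomp)

text \<open>The inner cells \<open>lu r\<close> and the inverse of \<open>ru s\<close> cancel by the
  triangle, and the outer unitors become those of \<open>s \<boxtimes> r\<close>. The left side is
  the composite constraint formed from two swaps, which is what the unit law of a composite
  transformation leaves over.\<close>

lemma gamma_hcomp:
  assumes "hor s" "hor r" "od s = oc r"
  shows "inv2 (asc s r (one (od r))) \<cdot> (idh s \<otimes> gamma D r) \<cdot> asc s (one (oc r)) r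
      \<cdot> (gamma D s \<otimes> idh r) \<cdot> inv2 (asc (one (oc s)) s r) = gamma D (s \<boxtimes> r)"
proof -
  have "(idh s \<otimes> lu r) \<cdot> asc s (one (oc r)) r \<cdot> (inv2 (ru s) \<otimes> idh r) \<cdot> X = X"
    if "cell X" "trg X = s \<boxtimes> r" for X
    using triangle_inv[OF assms, THEN arg_cong, of "\<lambda>Y. Y \<cdot> X"] that assms
    by (simp add: H.cmp_assoc_arr)
  then show ?thesis
    using assms by (simp add: gamma_def split_simps inv_lunitor_hcomp
        inv_runitor_hcomp[THEN H.cmp_reassoc1])
qed

text \<open>The inverse of \<open>gamma_hcomp\<close>, which is the composition law of a unit
  transformation before multiplication cells enter.\<close>

lemma inv_gamma_hcomp:
  assumes "hor s" "hor r" "od s = oc r"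
  shows "asc (one (oc s)) s r \<cdot> (inv2 (gamma D s) \<otimes> idh r) \<cdot> inv2 (asc s (one (oc r)) r)
      \<cdot> (idh s \<otimes> inv2 (gamma D r)) \<cdot> asc s r (one (od r)) = inv2 (gamma D (s \<boxtimes> r))"
proof -
  let ?g = "idh s \<otimes> gamma D r" and ?h = "gamma D s \<otimes> idh r"
  have i: "iso2 ?g" "inv2 ?g = idh s \<otimes> inv2 (gamma D r)"
    "iso2 ?h" "inv2 ?h = inv2 (gamma D s) \<otimes> idh r"
    using assms by (simp_all add: hcomp_inverse)
  have "inv2 (inv2 (asc s r (one (od r))) \<cdot> ?g \<cdot> asc s (one (oc r)) r \<cdot> ?h
      \<cdot> inv2 (asc (one (oc s)) s r)) = inv2 (gamma D (s \<boxtimes> r))"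
    unfolding gamma_hcomp[OF assms] ..
  then show ?thesis
    using assms i by (simp add: H.iso_cmp H.cmp_assoc_arr)
qed

text \<open>The unit laws of \<open>q\<close> and \<open>p\<close> carry \<open>eH\<close> to
  \<open>eG\<close> and then to \<open>eF\<close> and leave one swap for each factor;
  \<open>gamma_hcomp\<close> joins the two swaps.\<close>

lemma composite_constraint_unit:
  assumes "x \<in> Obj (cat0 D)" "hr \<phi> f g" "hr \<psi> g h"
    and e: "gl eF (one f) Ff f f" "gl eG (one g) Gg g g" "gl eH (one h) Hh h h"
    and "hr Ff f f" "hr Gg g g" "hr Hh h h"
    and n: "gl p (Gg \<boxtimes> \<phi>) (\<phi> \<boxtimes> Ff) f g" "gl q (Hh \<boxtimes> \<psi>) (\<psi> \<boxtimes> Gg) g h"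
    and p: "p \<cdot> (eG \<otimes> idh \<phi>) = (idh \<phi> \<otimes> eF) \<cdot> gamma D \<phi>"
    and q: "q \<cdot> (eH \<otimes> idh \<psi>) = (idh \<psi> \<otimes> eG) \<cdot> gamma D \<psi>"
  shows "(inv2 (asc \<psi> \<phi> Ff) \<cdot> (idh \<psi> \<otimes> p) \<cdot> asc \<psi> Gg \<phi> \<cdot> (q \<otimes> idh \<phi>) \<cdot> inv2 (asc Hh \<psi> \<phi>))
      \<cdot> (eH \<otimes> idh (\<psi> \<boxtimes> \<phi>))
    = (idh (\<psi> \<boxtimes> \<phi>) \<otimes> eF) \<cdot> gamma D (\<psi> \<boxtimes> \<phi>)"
proof -
  have [simp]: "f \<in> Obj (cat0 D)" "g \<in> Obj (cat0 D)" "h \<in> Obj (cat0 D)"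
    using assms hor_bound by blast+
  note [simp] = assms(2-11)
  have P: "(idh \<psi> \<otimes> p) \<cdot> (idh \<psi> \<otimes> eG \<otimes> idh \<phi>) = (idh \<psi> \<otimes> idh \<phi> \<otimes> eF) \<cdot> (idh \<psi> \<otimes> gamma D \<phi>)"
    by (simp add: p flip: whisker_left_cmp)
  have Q: "(q \<otimes> idh \<phi>) \<cdot> ((eH \<otimes> idh \<psi>) \<otimes> idh \<phi>) = ((idh \<psi> \<otimes> eG) \<otimes> idh \<phi>) \<cdot> (gamma D \<psi> \<otimes> idh \<phi>)"
    by (simp add: q flip: whisker_right_cmp)
  show ?thesis
    unfolding gamma_hcomp[of \<psi> \<phi>, simplified, symmetric]
    by (simp add: H.cmp_assoc_arr inv_asc_nat1 Q[THEN H.cmp_reassoc] P[THEN H.cmp_reassoc]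
      asc_nat2[THEN H.cmp_reassoc] inv_asc_nat3[THEN H.cmp_reassoc])
qed

text \<open>This makes the pointwise associator a modification. On the right side
  \<open>whisker_composite\<close> joins \<open>c\<close> and \<open>q\<close> into the constraint
  \<open>M\<close> of the composite of \<open>\<chi>\<close> and \<open>\<psi>\<close>, then
  \<open>p\<close> passes an associator, and one pentagon restores the bracketing of the left
  side.\<close>

lemma composite_constraint_assoc:
  assumes "hr Fr f0 f1" "hr Gr g0 g1" "hr Hr h0 h1" "hr Kr k0 k1"
    and "hr \<phi>0 f0 g0" "hr \<phi>1 f1 g1" "hr \<psi>0 g0 h0" "hr \<psi>1 g1 h1" "hr \<chi>0 h0 k0" "hr \<chi>1 h1 k1"
    and n: "gl p (Gr \<boxtimes> \<phi>0) (\<phi>1 \<boxtimes> Fr) f0 g1" "gl q (Hr \<boxtimes> \<psi>0) (\<psi>1 \<boxtimes> Gr) g0 h1"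
      "gl c (Kr \<boxtimes> \<chi>0) (\<chi>1 \<boxtimes> Hr) h0 k1"
  shows "(asc \<chi>1 \<psi>1 \<phi>1 \<otimes> idh Fr)
      \<cdot> inv2 (asc (\<chi>1 \<boxtimes> \<psi>1) \<phi>1 Fr) \<cdot> (idh (\<chi>1 \<boxtimes> \<psi>1) \<otimes> p) \<cdot> asc (\<chi>1 \<boxtimes> \<psi>1) Gr \<phi>0
      \<cdot> ((inv2 (asc \<chi>1 \<psi>1 Gr) \<cdot> (idh \<chi>1 \<otimes> q) \<cdot> asc \<chi>1 Hr \<psi>0 \<cdot> (c \<otimes> idh \<psi>0)
        \<cdot> inv2 (asc Kr \<chi>0 \<psi>0)) \<otimes> idh \<phi>0)
      \<cdot> inv2 (asc Kr (\<chi>0 \<boxtimes> \<psi>0) \<phi>0)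
    = (inv2 (asc \<chi>1 (\<psi>1 \<boxtimes> \<phi>1) Fr)
      \<cdot> (idh \<chi>1 \<otimes> (inv2 (asc \<psi>1 \<phi>1 Fr) \<cdot> (idh \<psi>1 \<otimes> p) \<cdot> asc \<psi>1 Gr \<phi>0 \<cdot> (q \<otimes> idh \<phi>0)
        \<cdot> inv2 (asc Hr \<psi>0 \<phi>0)))
      \<cdot> asc \<chi>1 Hr (\<psi>0 \<boxtimes> \<phi>0) \<cdot> (c \<otimes> idh (\<psi>0 \<boxtimes> \<phi>0)) \<cdot> inv2 (asc Kr \<chi>0 (\<psi>0 \<boxtimes> \<phi>0)))
      \<cdot> (idh Kr \<otimes> asc \<chi>0 \<psi>0 \<phi>0)" (is "?L = ?R")
proof -
  have [simp]: "f0 \<in> Obj (cat0 D)" "f1 \<in> Obj (cat0 D)" "g0 \<in> Obj (cat0 D)"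
    "g1 \<in> Obj (cat0 D)" "h0 \<in> Obj (cat0 D)" "h1 \<in> Obj (cat0 D)" "k0 \<in> Obj (cat0 D)"
    "k1 \<in> Obj (cat0 D)"
    using assms hor_bound by blast+
  note [simp] = assms
  define M where "M = inv2 (asc \<chi>1 \<psi>1 Gr) \<cdot> (idh \<chi>1 \<otimes> q) \<cdot> asc \<chi>1 Hr \<psi>0 \<cdot> (c \<otimes> idh \<psi>0)
        \<cdot> inv2 (asc Kr \<chi>0 \<psi>0)"
  have M: "gl M (Kr \<boxtimes> \<chi>0 \<boxtimes> \<psi>0) ((\<chi>1 \<boxtimes> \<psi>1) \<boxtimes> Gr) g0 k1" by (simp add: M_def)
  let ?Q = "whisker Hr \<psi>0 \<psi>1 Gr q \<phi>0" and ?C = "whisker Kr \<chi>0 \<chi>1 Hr c (\<psi>0 \<boxtimes> \<phi>0)"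
  have Q: "gl ?Q (Hr \<boxtimes> \<psi>0 \<boxtimes> \<phi>0) (\<psi>1 \<boxtimes> Gr \<boxtimes> \<phi>0) f0 h1"
    "gl ?C (Kr \<boxtimes> \<chi>0 \<boxtimes> \<psi>0 \<boxtimes> \<phi>0) (\<chi>1 \<boxtimes> Hr \<boxtimes> \<psi>0 \<boxtimes> \<phi>0) f0 k1"
    using whisker_gl[of q Hr \<psi>0 \<psi>1 Gr g0 h1 h0 g1 \<phi>0 f0]
      whisker_gl[of c Kr \<chi>0 \<chi>1 Hr h0 k1 k0 h1 "\<psi>0 \<boxtimes> \<phi>0" f0] by simp_all
  have "?R = inv2 (asc \<chi>1 (\<psi>1 \<boxtimes> \<phi>1) Fr) \<cdot> (idh \<chi>1 \<otimes> (inv2 (asc \<psi>1 \<phi>1 Fr) \<cdot> (idh \<psi>1 \<otimes> p) \<cdot> ?Q))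
      \<cdot> ?C \<cdot> (idh Kr \<otimes> asc \<chi>0 \<psi>0 \<phi>0)"
    by (simp add: whisker_def H.cmp_assoc_arr)
  also have "\<dots> = inv2 (asc \<chi>1 (\<psi>1 \<boxtimes> \<phi>1) Fr) \<cdot> (idh \<chi>1 \<otimes> inv2 (asc \<psi>1 \<phi>1 Fr))
      \<cdot> (idh \<chi>1 \<otimes> idh \<psi>1 \<otimes> p) \<cdot> ((idh \<chi>1 \<otimes> ?Q) \<cdot> ?C) \<cdot> (idh Kr \<otimes> asc \<chi>0 \<psi>0 \<phi>0)"
    using Q by (simp add: split_simps)
  also have "\<dots> = inv2 (asc \<chi>1 (\<psi>1 \<boxtimes> \<phi>1) Fr) \<cdot> (idh \<chi>1 \<otimes> inv2 (asc \<psi>1 \<phi>1 Fr))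
      \<cdot> (idh \<chi>1 \<otimes> idh \<psi>1 \<otimes> p)
      \<cdot> (asc \<chi>1 \<psi>1 (Gr \<boxtimes> \<phi>0) \<cdot> asc (\<chi>1 \<boxtimes> \<psi>1) Gr \<phi>0 \<cdot> (M \<otimes> idh \<phi>0)
        \<cdot> inv2 (asc Kr (\<chi>0 \<boxtimes> \<psi>0) \<phi>0) \<cdot> (idh Kr \<otimes> inv2 (asc \<chi>0 \<psi>0 \<phi>0)))
      \<cdot> (idh Kr \<otimes> asc \<chi>0 \<psi>0 \<phi>0)"
    unfolding M_def whisker_composite[OF assms(4) assms(9,10,3,7,8,2,5) n(3,2)] ..
  also have "\<dots> = inv2 (asc \<chi>1 (\<psi>1 \<boxtimes> \<phi>1) Fr) \<cdot> (idh \<chi>1 \<otimes> inv2 (asc \<psi>1 \<phi>1 Fr))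
      \<cdot> ((idh \<chi>1 \<otimes> idh \<psi>1 \<otimes> p) \<cdot> asc \<chi>1 \<psi>1 (Gr \<boxtimes> \<phi>0)) \<cdot> asc (\<chi>1 \<boxtimes> \<psi>1) Gr \<phi>0
      \<cdot> (M \<otimes> idh \<phi>0) \<cdot> inv2 (asc Kr (\<chi>0 \<boxtimes> \<psi>0) \<phi>0)"
    using M by (simp add: H.cmp_assoc_arr)
  also have "\<dots> = inv2 (asc \<chi>1 (\<psi>1 \<boxtimes> \<phi>1) Fr) \<cdot> (idh \<chi>1 \<otimes> inv2 (asc \<psi>1 \<phi>1 Fr))
      \<cdot> asc \<chi>1 \<psi>1 (\<phi>1 \<boxtimes> Fr) \<cdot> (idh (\<chi>1 \<boxtimes> \<psi>1) \<otimes> p) \<cdot> asc (\<chi>1 \<boxtimes> \<psi>1) Gr \<phi>0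
      \<cdot> (M \<otimes> idh \<phi>0) \<cdot> inv2 (asc Kr (\<chi>0 \<boxtimes> \<psi>0) \<phi>0)"
    using M by (simp add: H.cmp_assoc_arr asc_nat3[THEN H.cmp_reassoc])
  also have "\<dots> = ?L"
    using M pentagon_shift3[of \<chi>1 \<psi>1 \<phi>1 Fr, THEN arg_cong,
        of "\<lambda>X. X \<cdot> (idh (\<chi>1 \<boxtimes> \<psi>1) \<otimes> p) \<cdot> asc (\<chi>1 \<boxtimes> \<psi>1) Gr \<phi>0
      \<cdot> (M \<otimes> idh \<phi>0) \<cdot> inv2 (asc Kr (\<chi>0 \<boxtimes> \<psi>0) \<phi>0)"] unfolding M_def[symmetric]
    by (simp add: H.cmp_assoc_arr)
  finally show ?thesis ..
qed

text \<open>Compatibility of the left unitor with the constraints. The unitor is first moved to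
  \<open>\<phi>1 \<boxtimes> Fr\<close> and slides past \<open>p\<close> by naturality; split up by
  \<open>lunitor_hcomp\<close>, it cancels the inverse of \<open>lu Gr\<close> inside the swap, and
  the triangle turns the remaining \<open>ru Gr\<close> into \<open>lu \<phi>0\<close>.\<close>

lemma composite_constraint_lunitor:
  assumes "hr Fr f0 f1" "hr Gr g0 g1" "hr \<phi>0 f0 g0" "hr \<phi>1 f1 g1"
    and n: "gl p (Gr \<boxtimes> \<phi>0) (\<phi>1 \<boxtimes> Fr) f0 g1"
  shows "(lu \<phi>1 \<otimes> idh Fr) \<cdot> inv2 (asc (one g1) \<phi>1 Fr) \<cdot> (idh (one g1) \<otimes> p) \<cdot> asc (one g1) Gr \<phi>0
      \<cdot> (inv2 (gamma D Gr) \<otimes> idh \<phi>0) \<cdot> inv2 (asc Gr (one g0) \<phi>0)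
    = p \<cdot> (idh Gr \<otimes> lu \<phi>0)"
proof -
  have [simp]: "f0 \<in> Obj (cat0 D)" "f1 \<in> Obj (cat0 D)" "g0 \<in> Obj (cat0 D)" "g1 \<in> Obj (cat0 D)"
    using assms hor_bound by blast+
  have "lu (\<phi>1 \<boxtimes> Fr) \<cdot> (idh (one g1) \<otimes> p) = p \<cdot> lu (Gr \<boxtimes> \<phi>0)"
    using lunitor_natural[of p] assms by simp
  note * = this[THEN H.cmp_reassoc] lunitor_hcomp[of Gr \<phi>0, THEN H.cmp_reassoc1]
  show ?thesis
    using assms * inv_lunitor_hcomp[of \<phi>1 Fr, THEN H.cmp_reassoc1] triangle_inv'[of Gr \<phi>0]
    by (simp add: split_simps)
qed

text \<open>The same cancellation with the triangle used first: it produces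
  \<open>idh \<phi>1 \<otimes> lu Fr\<close>, which cancels inside the swap, and naturality of the
  right unitor carries the remaining unitor past \<open>p\<close>.\<close>

lemma composite_constraint_runitor:
  assumes "hr Fr f0 f1" "hr Gr g0 g1" "hr \<phi>0 f0 g0" "hr \<phi>1 f1 g1"
    and n: "gl p (Gr \<boxtimes> \<phi>0) (\<phi>1 \<boxtimes> Fr) f0 g1"
  shows "(ru \<phi>1 \<otimes> idh Fr) \<cdot> inv2 (asc \<phi>1 (one f1) Fr) \<cdot> (idh \<phi>1 \<otimes> inv2 (gamma D Fr))
      \<cdot> asc \<phi>1 Fr (one f0) \<cdot> (p \<otimes> idh (one f0)) \<cdot> inv2 (asc Gr \<phi>0 (one f0))
    = p \<cdot> (idh Gr \<otimes> ru \<phi>0)"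
proof -
  have [simp]: "f0 \<in> Obj (cat0 D)" "f1 \<in> Obj (cat0 D)" "g0 \<in> Obj (cat0 D)" "g1 \<in> Obj (cat0 D)"
    using assms hor_bound by blast+
  have "ru (\<phi>1 \<boxtimes> Fr) \<cdot> (p \<otimes> idh (one f0)) = p \<cdot> ru (Gr \<boxtimes> \<phi>0)"
    using runitor_natural[of p] assms by simp
  note * = this[THEN H.cmp_reassoc] runitor_hcomp[of \<phi>1 Fr, THEN H.cmp_reassoc1]
  have "ru (Gr \<boxtimes> \<phi>0) \<cdot> inv2 (asc Gr \<phi>0 (one f0)) = idh Gr \<otimes> ru \<phi>0"
    using assms by (simp add: H.cmp_assoc_arr flip: runitor_hcomp)
  then show ?thesis
    using assms * triangle_inv'[of \<phi>1 Fr, THEN H.cmp_reassoc1]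
    by (simp add: split_simps)
qed

lemma gamma_natural:
  assumes "cell a"
  shows "gamma D (trg a) \<cdot> (one1 (cd a) \<otimes> a) = (a \<otimes> one1 (dm a)) \<cdot> gamma D (src a)"
proof -
  have "inv2 (ru (trg a)) \<cdot> a = (a \<otimes> one1 (dm a)) \<cdot> inv2 (ru (src a))"
    by (rule H.inv_commute[OF runitor_natural[OF assms, symmetric]]) (use assms in simp_all)
  from this[THEN H.cmp_reassoc] show ?thesis
    using assms by (simp add: gamma_def H.cmp_assoc_arr lunitor_natural)
qed

lemma inv_gamma_natural:
  assumes "cell a"
  shows "inv2 (gamma D (trg a)) \<cdot> (a \<otimes> one1 (dm a)) = (one1 (cd a) \<otimes> a) \<cdot> inv2 (gamma D (src a))"
  \<comment> \<open>The expansion of the inverse of \<open>gamma\<close> into unitors is switched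
    off, since here the inverse has to be a single cell.\<close>
  by (rule H.inv_commute[OF gamma_natural[OF assms, symmetric]])
    (use assms in \<open>simp_all del: gamma_simps(2)\<close>)

text \<open>Naturality of the inverse swap at \<open>m\<close>, expanded by
  \<open>inv_gamma_hcomp\<close>. At the multiplication cell of a lax functor it is the composition
  law of the unit transformation; \<open>N_comp\<close> uses it again.\<close>

lemma unit_constraint_comp:
  assumes "hr s y z" "hr r x y" "hr sr x z" "gl m (s \<boxtimes> r) sr x z"
  shows "inv2 (gamma D sr) \<cdot> (m \<otimes> idh (one x))
    = (idh (one z) \<otimes> m) \<cdot> asc (one z) s r \<cdot> (inv2 (gamma D s) \<otimes> idh r) \<cdot> inv2 (asc s (one y) r)
      \<cdot> (idh s \<otimes> inv2 (gamma D r)) \<cdot> asc s r (one x)"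
proof -
  have "x \<in> Obj (cat0 D)" "z \<in> Obj (cat0 D)" using assms hor_bound by blast+
  then have "inv2 (gamma D sr) \<cdot> (m \<otimes> idh (one x)) = (idh (one z) \<otimes> m) \<cdot> inv2 (gamma D (s \<boxtimes> r))"
    using inv_gamma_natural[of m] assms by (simp del: gamma_simps(2))
  then show ?thesis using inv_gamma_hcomp[of s r] assms by simp
qed

text \<open>By \<open>lunitor_eq_runitor\<close> the swap at a unit is an identity, so on the right
  side it may stand in place of its inverse.\<close>

lemma unit_constraint_unit:
  assumes "x \<in> Obj (cat0 D)" "hr F1 x x" "gl e (one x) F1 x x"
  shows "inv2 (gamma D F1) \<cdot> (e \<otimes> idh (one x)) = (idh (one x) \<otimes> e) \<cdot> gamma D (one x)"
  using inv_gamma_natural[of e] assms lunitor_eq_runitor[of x]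
  by (simp add: gamma_def)

section \<open>Universal property of the counit of a conjoint\<close>

lemma conjointD:
  assumes "is_conjoint D f r \<eta> \<epsilon>" "ver f" "a = Src (cat0 D) f" "b = Trg (cat0 D) f"
  shows "hr r b a" "cell \<eta>" "src \<eta> = one a" "trg \<eta> = r" "dm \<eta> = f" "cd \<eta> = Idt (cat0 D) a"
    "cell \<epsilon>" "src \<epsilon> = r" "trg \<epsilon> = one b" "dm \<epsilon> = Idt (cat0 D) b" "cd \<epsilon> = f"
    "\<epsilon> \<cdot> \<eta> = one1 f" "\<eta> \<otimes> \<epsilon> = gamma D r"
  using assms by (auto simp: is_conjoint_def horizontal_def cells_def Hom_def gamma_def Let_def)

text \<open>By interchange \<open>gamma D r \<cdot> (one1 (cd k) \<otimes> k)\<close> equals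
  \<open>(\<eta> \<cdot> one1 (cd k)) \<otimes> (\<epsilon> \<cdot> k)\<close>, which depends on
  \<open>k\<close> only through its cod and \<open>\<epsilon> \<cdot> k\<close>. The swap is
  invertible and tensoring with a unit is faithful, so \<open>k\<close> itself is determined by
  these two.\<close>

lemma conjoint_unique:
  assumes c: "is_conjoint D f r \<eta> \<epsilon>" "ver f"
    and k: "cell k" "cell l" "src k = src l" "cd k = cd l" "trg k = r" "trg l = r"
    and eq: "\<epsilon> \<cdot> k = \<epsilon> \<cdot> l"
  shows "k = l"
proof -
  note [simp] = conjointD[OF c refl refl]
  have [simp]: "Trg (cat0 D) (cd k) = Src (cat0 D) f" "Trg (cat0 D) (cd l) = Src (cat0 D) f"
    using k by simp_all
  have K: "gamma D r \<cdot> (one1 (cd k) \<otimes> k) = (\<eta> \<cdot> one1 (cd k)) \<otimes> (\<epsilon> \<cdot> k)"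
    if "cell k" "trg k = r" "Trg (cat0 D) (cd k) = Src (cat0 D) f" for k
    using that c(2) interchange[of "one1 (cd k)" k \<eta> \<epsilon>] by simp
  have "gamma D r \<cdot> (one1 (cd k) \<otimes> k) = gamma D r \<cdot> (one1 (cd l) \<otimes> l)"
    using K[of k] K[of l] k eq by simp
  then have "one1 (cd k) \<otimes> k = one1 (cd k) \<otimes> l"
    by - (rule H.iso_cancel_left[of "gamma D r"], use k c in simp_all)
  then show ?thesis
    by (rule one1_faithful_left) (use k in simp_all)
qed

text \<open>Pasting \<eta> to the left of \<open>k\<close> and deleting units gives a cell into
  \<open>r\<close>. Composition with \<epsilon> undoes this, because
  \<open>\<epsilon> \<cdot> \<eta>\<close> is a unit cell and the two unitors agree at a
  unit.\<close>

lemma conjoint_exists: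
  assumes c: "is_conjoint D f r \<eta> \<epsilon>" "ver f"
    and k: "cell k" "trg k = one (Trg (cat0 D) f)" "cd k = Cmp (cat0 D) f g"
    and g: "ver g" "Trg (cat0 D) g = Src (cat0 D) f" "Src (cat0 D) g = oc (src k)"
  obtains l where "cell l" "src l = src k" "trg l = r" "dm l = dm k" "cd l = g" "\<epsilon> \<cdot> l = k"
proof
  note [simp] = conjointD(1-12)[OF c refl refl] assms(2-)
  have [simp]: "Trg (cat0 D) (dm k) = Trg (cat0 D) f" "Src (cat0 D) (dm k) = od (src k)"
    by simp_all
  \<comment> \<open>\<open>k\<close> ends in the unit over the target of \<open>f\<close>, so
    \<open>(\<eta> \<cdot> one1 g) \<otimes> k\<close> ends in \<open>r\<close> composed with that
    unit. The factorisation of \<open>cd k\<close> through \<open>f\<close> is what makes the two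
    factors horizontally composable.\<close>
  let ?l = "ru r \<cdot> ((\<eta> \<cdot> one1 g) \<otimes> k) \<cdot> inv2 (lu (src k))"
  show "cell ?l" "src ?l = src k" "trg ?l = r" "dm ?l = dm k" "cd ?l = g" by simp_all
  have S: "\<epsilon> \<cdot> \<eta> \<cdot> one1 g = one1 (Cmp (cat0 D) f g)"
    using conjointD(12)[OF c refl refl, THEN H.cmp_reassoc1, of "one1 g"] by (simp add: hunit_cmp)
  have "\<epsilon> \<cdot> ru r = ru (one (Trg (cat0 D) f)) \<cdot> (\<epsilon> \<otimes> idh (one (Trg (cat0 D) f)))"
    using runitor_natural[of \<epsilon>] by simp
  then have "\<epsilon> \<cdot> ?l = ru (one (Trg (cat0 D) f)) \<cdot> (\<epsilon> \<otimes> idh (one (Trg (cat0 D) f)))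
      \<cdot> ((\<eta> \<cdot> one1 g) \<otimes> k) \<cdot> inv2 (lu (src k))"
    by (rule H.cmp_reassoc) simp_all
  also have "\<dots> = ru (one (Trg (cat0 D) f)) \<cdot> (((\<epsilon> \<cdot> \<eta> \<cdot> one1 g) \<otimes> k)) \<cdot> inv2 (lu (src k))"
    by (simp add: interchange flip: H.cmp_assoc_arr)
  also have "\<dots> = k"
    using lunitor_natural[of k, THEN H.cmp_reassoc, of "inv2 (lu (src k))"]
    by (simp add: S lunitor_eq_runitor)
  finally show "\<epsilon> \<cdot> ?l = k" .
qed

text \<open>The argument of \<open>conjoint_unique\<close> with the swap replaced by
  \<open>gamma D r \<otimes> idh w\<close> between two associators. That cell is invertible and, by
  naturality of the associator, equals
  \<open>\<eta> \<otimes> \<epsilon> \<otimes> idh w\<close>.\<close>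

lemma conjoint_whisker_unique:
  assumes c: "is_conjoint D f r \<eta> \<epsilon>" "ver f" and w: "hor w" "oc w = Trg (cat0 D) f"
    and k: "cell k" "cell l" "src k = src l" "cd k = cd l" "trg k = r \<boxtimes> w" "trg l = r \<boxtimes> w"
    and eq: "(\<epsilon> \<otimes> idh w) \<cdot> k = (\<epsilon> \<otimes> idh w) \<cdot> l"
  shows "k = l"
proof -
  note [simp] = conjointD[OF c refl refl] w
  let ?b = "Trg (cat0 D) f" and ?a = "Src (cat0 D) f"
  have [simp]: "Trg (cat0 D) (cd k) = ?a" "Trg (cat0 D) (cd l) = ?a"
    using k by simp_all
  let ?g = "asc r (one ?b) w \<cdot> (gamma D r \<otimes> idh w) \<cdot> inv2 (asc (one ?a) r w)"
  have "asc r (one ?b) w \<cdot> (gamma D r \<otimes> idh w) = (\<eta> \<otimes> \<epsilon> \<otimes> idh w) \<cdot> asc (one ?a) r w"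
    using associator_natural[of \<eta> \<epsilon> "idh w"] c(2) by simp
  then have G: "?g = \<eta> \<otimes> \<epsilon> \<otimes> idh w"
    using c(2) by (simp add: H.cmp_reassoc1 H.cmp_assoc_arr)
  have I: "iso2 ?g" using c(2) by (intro H.iso_cmp hcomp_inverse) simp_all
  have K: "?g \<cdot> (one1 (cd k) \<otimes> k) = (\<eta> \<cdot> one1 (cd k)) \<otimes> ((\<epsilon> \<otimes> idh w) \<cdot> k)"
    if "cell k" "trg k = r \<boxtimes> w" "Trg (cat0 D) (cd k) = ?a" for k
    unfolding G using that c(2) interchange[of "one1 (cd k)" k \<eta> "\<epsilon> \<otimes> idh w"] by simp
  have "?g \<cdot> (one1 (cd k) \<otimes> k) = ?g \<cdot> (one1 (cd l) \<otimes> l)"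
    using K[of k] K[of l] k eq by simp
  then have "one1 (cd k) \<otimes> k = one1 (cd k) \<otimes> l"
    by - (rule H.iso_cancel_left[OF _ I], use k c in simp_all)
  then show ?thesis
    by (rule one1_faithful_left) (use k in simp_all)
qed

text \<open>As in \<open>conjoint_exists\<close>, but \<open>k\<close> ends in a unit composed with
  \<open>w\<close>, so the unit is absorbed into \<open>w\<close> by
  \<open>idh r \<otimes> lu w\<close> and not into \<open>r\<close>.\<close>

lemma conjoint_whisker_exists:
  assumes c: "is_conjoint D f r \<eta> \<epsilon>" "ver f" and w: "hor w" "oc w = Trg (cat0 D) f"
    and k: "cell k" "trg k = one (Trg (cat0 D) f) \<boxtimes> w" "cd k = Cmp (cat0 D) f g"
    and g: "ver g" "Trg (cat0 D) g = Src (cat0 D) f" "Src (cat0 D) g = oc (src k)"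
  obtains l where "cell l" "src l = src k" "trg l = r \<boxtimes> w" "dm l = dm k" "cd l = g"
    "(\<epsilon> \<otimes> idh w) \<cdot> l = k"
proof
  note [simp] = conjointD(1-12)[OF c refl refl] assms(2-)
  have [simp]: "Trg (cat0 D) (dm k) = od w" "Src (cat0 D) (dm k) = od (src k)"
    by simp_all
  let ?b = "Trg (cat0 D) f"
  let ?l = "(idh r \<otimes> lu w) \<cdot> ((\<eta> \<cdot> one1 g) \<otimes> k) \<cdot> inv2 (lu (src k))"
  show "cell ?l" "src ?l = src k" "trg ?l = r \<boxtimes> w" "dm ?l = dm k" "cd ?l = g" by simp_all
  have S: "\<epsilon> \<cdot> \<eta> \<cdot> one1 g = one1 (Cmp (cat0 D) f g)"
    using conjointD(12)[OF c refl refl, THEN H.cmp_reassoc1, of "one1 g"] by (simp add: hunit_cmp)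
  have "(\<epsilon> \<otimes> idh w) \<cdot> (idh r \<otimes> lu w) = (idh (one ?b) \<otimes> lu w) \<cdot> (\<epsilon> \<otimes> idh (one ?b \<boxtimes> w))"
    by (simp add: interchange)
  then have "(\<epsilon> \<otimes> idh w) \<cdot> ?l = (idh (one ?b) \<otimes> lu w) \<cdot> (\<epsilon> \<otimes> idh (one ?b \<boxtimes> w))
      \<cdot> ((\<eta> \<cdot> one1 g) \<otimes> k) \<cdot> inv2 (lu (src k))"
    by (rule H.cmp_reassoc) simp_all
  also have "\<dots> = (idh (one ?b) \<otimes> lu w) \<cdot> (((\<epsilon> \<cdot> \<eta> \<cdot> one1 g) \<otimes> k)) \<cdot> inv2 (lu (src k))"
    by (simp add: interchange flip: H.cmp_assoc_arr)
  also have "\<dots> = k"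
  proof -
    \<comment> \<open>Naturality of the left unitor along a left unitor: after one more deletion,
      deleting the inner and deleting the outer unit agree, and the further deletion is
      invertible.\<close>
    have "lu w \<cdot> (idh (one ?b) \<otimes> lu w) = lu w \<cdot> lu (one ?b \<boxtimes> w)"
      using lunitor_natural[of "lu w"] by simp
    then have "idh (one ?b) \<otimes> lu w = lu (one ?b \<boxtimes> w)"
      by (rule H.iso_cancel_left) simp_all
    then show ?thesis
      using lunitor_natural[of k, THEN H.cmp_reassoc, of "inv2 (lu (src k))"] by (simp add: S)
  qed
  finally show "(\<epsilon> \<otimes> idh w) \<cdot> ?l = k" .
qed

end

section \<open>Lax functors, transformations and modifications\<close>

locale pseudodouble_pair = D: pseudodouble_category D + E: pseudodouble_category E
  for D :: "('o, 'v, 'h, 'c) pdcat" and E :: "('p, 'w, 'k, 'd) pdcat"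
begin

abbreviation vcE (infixr "\<cdot>\<^sub>E" 60) where "b \<cdot>\<^sub>E a \<equiv> Cmp (cat1 E) b a"
abbreviation hc1E (infixr "\<boxtimes>\<^sub>E" 75) where "s \<boxtimes>\<^sub>E r \<equiv> ob (hcomp E) (s, r)"
abbreviation hc2E (infixr "\<otimes>\<^sub>E" 70) where "b \<otimes>\<^sub>E a \<equiv> ar (hcomp E) (b, a)"

section \<open>Boundaries of lax functors and vertical transformations\<close>

lemma lax_functor_cell0 [simp]:
  assumes "lax_functor D E F"
  shows "x \<in> Obj (cat0 D) \<Longrightarrow> ob (lf0 F) x \<in> Obj (cat0 E)"
    and "D.ver f \<Longrightarrow> ar (lf0 F) f \<in> Arr (cat0 E)"
    and "D.ver f \<Longrightarrow> Src (cat0 E) (ar (lf0 F) f) = ob (lf0 F) (Src (cat0 D) f)"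
    and "D.ver f \<Longrightarrow> Trg (cat0 E) (ar (lf0 F) f) = ob (lf0 F) (Trg (cat0 D) f)"
    and "x \<in> Obj (cat0 D) \<Longrightarrow> ar (lf0 F) (Idt (cat0 D) x) = Idt (cat0 E) (ob (lf0 F) x)"
  using is_functor.ob_in[OF lax_functor.functor0[OF assms]]
    is_functor.ob_ar[OF lax_functor.functor0[OF assms] D.category0]
    is_functor.ar_idt[OF lax_functor.functor0[OF assms]] by auto

lemma lax_functor_cell1 [simp]:
  assumes "lax_functor D E F"
  shows "D.hor r \<Longrightarrow> ob (lf1 F) r \<in> Obj (cat1 E)"
    and "D.cell a \<Longrightarrow> ar (lf1 F) a \<in> Arr (cat1 E)"
    and "D.cell a \<Longrightarrow> E.src (ar (lf1 F) a) = ob (lf1 F) (D.src a)"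
    and "D.cell a \<Longrightarrow> E.trg (ar (lf1 F) a) = ob (lf1 F) (D.trg a)"
    and "D.hor r \<Longrightarrow> ar (lf1 F) (Idt (cat1 D) r) = Idt (cat1 E) (ob (lf1 F) r)"
    and "D.hor r \<Longrightarrow> E.od (ob (lf1 F) r) = ob (lf0 F) (D.od r)"
    and "D.hor r \<Longrightarrow> E.oc (ob (lf1 F) r) = ob (lf0 F) (D.oc r)"
    and "D.cell a \<Longrightarrow> E.dm (ar (lf1 F) a) = ar (lf0 F) (D.dm a)"
    and "D.cell a \<Longrightarrow> E.cd (ar (lf1 F) a) = ar (lf0 F) (D.cd a)"
  using is_functor.ob_in[OF lax_functor.functor1[OF assms]]
    is_functor.ob_ar[OF lax_functor.functor1[OF assms] D.category1]
    is_functor.ar_idt[OF lax_functor.functor1[OF assms]]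
    lax_functor.compat_hdom[OF assms] lax_functor.compat_hcod[OF assms]
  by (auto simp: fctr_eq_def fcomp_def)

lemma lax_functor_e [simp]:
  assumes "lax_functor D E F" "x \<in> Obj (cat0 D)"
  shows "lf_e F x \<in> Arr (cat1 E)"
    and "E.src (lf_e F x) = E.one (ob (lf0 F) x)"
    and "E.trg (lf_e F x) = ob (lf1 F) (D.one x)"
    and "E.dm (lf_e F x) = Idt (cat0 E) (ob (lf0 F) x)"
    and "E.cd (lf_e F x) = Idt (cat0 E) (ob (lf0 F) x)"
proof -
  show *: "lf_e F x \<in> Arr (cat1 E)" "E.src (lf_e F x) = E.one (ob (lf0 F) x)"
    "E.trg (lf_e F x) = ob (lf1 F) (D.one x)"
    using nat_trans.component_arr[OF lax_functor.e_natural[OF assms(1)] assms(2)]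
    by (simp_all add: fcomp_def)
  show "E.dm (lf_e F x) = Idt (cat0 E) (ob (lf0 F) x)"
    "E.cd (lf_e F x) = Idt (cat0 E) (ob (lf0 F) x)"
    using E.globularD(2,4)[OF lax_functor.e_globular[OF assms]] * assms by simp_all
qed

lemma lax_functor_m [simp]:
  assumes "lax_functor D E F" "D.hor s" "D.hor r" "D.od s = D.oc r"
  shows "lf_m F (s, r) \<in> Arr (cat1 E)"
    and "E.src (lf_m F (s, r)) = ob (lf1 F) s \<boxtimes>\<^sub>E ob (lf1 F) r"
    and "E.trg (lf_m F (s, r)) = ob (lf1 F) (s \<odot>\<^bsub>D\<^esub> r)"
    and "E.dm (lf_m F (s, r)) = Idt (cat0 E) (ob (lf0 F) (D.od r))"
    and "E.cd (lf_m F (s, r)) = Idt (cat0 E) (ob (lf0 F) (D.oc s))"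
proof -
  have sr: "(s, r) \<in> Obj (composable_pairs D)" using assms by simp
  show *: "lf_m F (s, r) \<in> Arr (cat1 E)"
    "E.src (lf_m F (s, r)) = ob (lf1 F) s \<boxtimes>\<^sub>E ob (lf1 F) r"
    "E.trg (lf_m F (s, r)) = ob (lf1 F) (s \<odot>\<^bsub>D\<^esub> r)"
    using nat_trans.component_arr[OF lax_functor.m_natural[OF assms(1)] sr]
    by (simp_all add: fcomp_def hcomp_fctr_def pair_fctr_def fst_fctr_def snd_fctr_def)
  show "E.dm (lf_m F (s, r)) = Idt (cat0 E) (ob (lf0 F) (D.od r))"
    "E.cd (lf_m F (s, r)) = Idt (cat0 E) (ob (lf0 F) (D.oc s))"
    using E.globularD(2,4)[OF lax_functor.m_globular[OF assms(1) sr]] * assms by simp_all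
qed

lemma vertical_transformation_cell [simp]:
  assumes "vertical_transformation D E \<phi>"
  shows "lax_functor D E (vt_src \<phi>)" "lax_functor D E (vt_trg \<phi>)"
    and "x \<in> Obj (cat0 D) \<Longrightarrow> vt0 \<phi> x \<in> Arr (cat0 E)"
    and "x \<in> Obj (cat0 D) \<Longrightarrow> Src (cat0 E) (vt0 \<phi> x) = ob (lf0 (vt_src \<phi>)) x"
    and "x \<in> Obj (cat0 D) \<Longrightarrow> Trg (cat0 E) (vt0 \<phi> x) = ob (lf0 (vt_trg \<phi>)) x"
    and "D.hor r \<Longrightarrow> vt1 \<phi> r \<in> Arr (cat1 E)"
    and "D.hor r \<Longrightarrow> E.src (vt1 \<phi> r) = ob (lf1 (vt_src \<phi>)) r"
    and "D.hor r \<Longrightarrow> E.trg (vt1 \<phi> r) = ob (lf1 (vt_trg \<phi>)) r"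
    and "D.hor r \<Longrightarrow> E.dm (vt1 \<phi> r) = vt0 \<phi> (D.od r)"
    and "D.hor r \<Longrightarrow> E.cd (vt1 \<phi> r) = vt0 \<phi> (D.oc r)"
  using nat_trans.component_arr[OF vertical_transformation.natural0[OF assms]]
    nat_trans.component_arr[OF vertical_transformation.natural1[OF assms]]
    vertical_transformation.lax_src[OF assms] vertical_transformation.lax_trg[OF assms]
    vertical_transformation.compat_hdom[OF assms] vertical_transformation.compat_hcod[OF assms]
  by simp_all

text \<open>Extensionality of the component functions turns agreement on the carriers into equality
  of records.\<close>

lemma vertical_transformation_eqI:
  assumes "vertical_transformation D E \<phi>" "vertical_transformation D E \<psi>"
    and "vt_src \<phi> = vt_src \<psi>" "vt_trg \<phi> = vt_trg \<psi>"
    and "\<And>x. x \<in> Obj (cat0 D) \<Longrightarrow> vt0 \<phi> x = vt0 \<psi> x"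
    and "\<And>r. r \<in> Obj (cat1 D) \<Longrightarrow> vt1 \<phi> r = vt1 \<psi> r"
  shows "\<phi> = \<psi>"
proof (rule vtrans.equality)
  show "vt0 \<phi> = vt0 \<psi>" "vt1 \<phi> = vt1 \<psi>"
    using assms vertical_transformation.ext extensionalityI by metis+
qed (use assms in auto)

lemma lax_cat0_simps [simp]:
  "F \<in> Obj (lax_cat0 D E) \<longleftrightarrow> lax_functor D E F"
  "\<phi> \<in> Arr (lax_cat0 D E) \<longleftrightarrow> vertical_transformation D E \<phi>"
  "Src (lax_cat0 D E) = vt_src" "Trg (lax_cat0 D E) = vt_trg"
  "vt_src (Idt (lax_cat0 D E) F) = F" "vt_trg (Idt (lax_cat0 D E) F) = F"
  "vt_src (Cmp (lax_cat0 D E) \<psi> \<phi>) = vt_src \<phi>" "vt_trg (Cmp (lax_cat0 D E) \<psi> \<phi>) = vt_trg \<psi>"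
  "x \<in> Obj (cat0 D) \<Longrightarrow> vt0 (Idt (lax_cat0 D E) F) x = Idt (cat0 E) (ob (lf0 F) x)"
  "D.hor r \<Longrightarrow> vt1 (Idt (lax_cat0 D E) F) r = E.idh (ob (lf1 F) r)"
  "x \<in> Obj (cat0 D) \<Longrightarrow> vt0 (Cmp (lax_cat0 D E) \<psi> \<phi>) x = Cmp (cat0 E) (vt0 \<psi> x) (vt0 \<phi> x)"
  "D.hor r \<Longrightarrow> vt1 (Cmp (lax_cat0 D E) \<psi> \<phi>) r = vt1 \<psi> r \<cdot>\<^sub>E vt1 \<phi> r"
  "vt0 (Idt (lax_cat0 D E) F) \<in> extensional (Obj (cat0 D))"
  "vt1 (Idt (lax_cat0 D E) F) \<in> extensional (Obj (cat1 D))"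
  "vt0 (Cmp (lax_cat0 D E) \<psi> \<phi>) \<in> extensional (Obj (cat0 D))"
  "vt1 (Cmp (lax_cat0 D E) \<psi> \<phi>) \<in> extensional (Obj (cat1 D))"
  by (simp_all add: lax_cat0_def)

lemma vertical_transformation_idt [simp]:
  assumes "lax_functor D E F"
  shows "vertical_transformation D E (Idt (lax_cat0 D E) F)"
proof (rule vertical_transformation.intro)
  show "nat_trans (cat0 D) (cat0 E) (lf0 (vt_src (Idt (lax_cat0 D E) F)))
      (lf0 (vt_trg (Idt (lax_cat0 D E) F))) (vt0 (Idt (lax_cat0 D E) F))"
    by (rule nat_transI) (use assms in simp_all)
  show "nat_trans (cat1 D) (cat1 E) (lf1 (vt_src (Idt (lax_cat0 D E) F)))
      (lf1 (vt_trg (Idt (lax_cat0 D E) F))) (vt1 (Idt (lax_cat0 D E) F))"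
    by (rule nat_transI) (use assms in simp_all)
qed (use assms in auto)

lemma vertical_transformation_cmp [simp]:
  assumes p: "vertical_transformation D E \<phi>" and q: "vertical_transformation D E \<psi>"
    and pq: "vt_trg \<phi> = vt_src \<psi>"
  shows "vertical_transformation D E (Cmp (lax_cat0 D E) \<psi> \<phi>)"
proof (rule vertical_transformation.intro)
  let ?c = "Cmp (lax_cat0 D E) \<psi> \<phi>"
  note nats = nat_trans.natural_arr[OF vertical_transformation.natural0[OF p]]
    nat_trans.natural_arr[OF vertical_transformation.natural0[OF q]]
    nat_trans.natural_arr[OF vertical_transformation.natural1[OF p]]
    nat_trans.natural_arr[OF vertical_transformation.natural1[OF q]]
  show "nat_trans (cat0 D) (cat0 E) (lf0 (vt_src ?c)) (lf0 (vt_trg ?c)) (vt0 ?c)"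
    by (rule nat_transI)
      (use assms in \<open>simp_all add: E.V.cmp_assoc_arr nats nats(2)[THEN E.V.cmp_reassoc]\<close>)
  show "nat_trans (cat1 D) (cat1 E) (lf1 (vt_src ?c)) (lf1 (vt_trg ?c)) (vt1 ?c)"
    by (rule nat_transI)
      (use assms in \<open>simp_all add: E.H.cmp_assoc_arr nats nats(4)[THEN E.H.cmp_reassoc]\<close>)
  show "vt1 ?c (D.one x) \<cdot>\<^sub>E lf_e (vt_src ?c) x
      = lf_e (vt_trg ?c) x \<cdot>\<^sub>E E.one1 (vt0 ?c x)" if "x \<in> Obj (cat0 D)" for x
    using assms that vertical_transformation.unit[OF p that]
      vertical_transformation.unit[OF q that, THEN E.H.cmp_reassoc]
    by (simp add: E.H.cmp_assoc_arr E.hunit_cmp)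
  show "vt1 ?c (s \<odot>\<^bsub>D\<^esub> r) \<cdot>\<^sub>E lf_m (vt_src ?c) (s, r)
      = lf_m (vt_trg ?c) (s, r) \<cdot>\<^sub>E (vt1 ?c s \<otimes>\<^sub>E vt1 ?c r)"
    if sr: "(s, r) \<in> Obj (composable_pairs D)" for s r
    using assms sr vertical_transformation.comp[OF p sr]
      vertical_transformation.comp[OF q sr, THEN E.H.cmp_reassoc]
    by (simp add: E.H.cmp_assoc_arr E.interchange)
qed (use assms in auto)

lemma category_lax_cat0: "category (lax_cat0 D E)"
  by (rule categoryI)
    (auto intro!: vertical_transformation_eqI simp: E.V.cmp_assoc_arr E.H.cmp_assoc_arr)

sublocale L: category "lax_cat0 D E" by (rule category_lax_cat0)

end

text \<open>The structure cells of \<open>trans_pdcat\<close> all have this shape, so one set of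
  rules reads off their boundaries and components.\<close>

definition mk_mod where
  "mk_mod D \<zeta> \<xi> \<phi> \<psi> c = \<lparr>md_src = \<zeta>, md_trg = \<xi>, md_dom = \<phi>, md_cod = \<psi>,
    md_c = restrict c (Obj (cat0 D))\<rparr>"

lemma mk_mod_simps [simp]:
  "md_src (mk_mod D \<zeta> \<xi> \<phi> \<psi> c) = \<zeta>" "md_trg (mk_mod D \<zeta> \<xi> \<phi> \<psi> c) = \<xi>"
  "md_dom (mk_mod D \<zeta> \<xi> \<phi> \<psi> c) = \<phi>" "md_cod (mk_mod D \<zeta> \<xi> \<phi> \<psi> c) = \<psi>"
  "x \<in> Obj (cat0 D) \<Longrightarrow> md_c (mk_mod D \<zeta> \<xi> \<phi> \<psi> c) x = c x"
  "md_c (mk_mod D \<zeta> \<xi> \<phi> \<psi> c) \<in> extensional (Obj (cat0 D))"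
  by (simp_all add: mk_mod_def)

context pseudodouble_pair
begin

text \<open>The cells of \<open>trans_pdcat\<close> rewritten with \<open>mk_mod\<close>. Those that
  involve units or composites take the constraints \<open>nu\<close> and \<open>nc\<close> as
  parameters, since these differ between the lax and the oplax case.\<close>

abbreviation mod_idt where
  "mod_idt \<phi> \<equiv> mk_mod D \<phi> \<phi> (Idt (lax_cat0 D E) (ht_dom \<phi>)) (Idt (lax_cat0 D E)
      (ht_cod \<phi>)) (\<lambda>x. E.idh (ob (ht_fun \<phi>) x))"

abbreviation mod_cmp where
  "mod_cmp \<Delta> \<Gamma> \<equiv> mk_mod D (md_src \<Gamma>) (md_trg \<Delta>) (Cmp (lax_cat0 D E) (md_dom \<Delta>)
      (md_dom \<Gamma>)) (Cmp (lax_cat0 D E) (md_cod \<Delta>) (md_cod \<Gamma>))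
      (\<lambda>x. md_c \<Delta> x \<cdot>\<^sub>E md_c \<Gamma> x)"

abbreviation mod_unit where
  "mod_unit nu \<tau> \<equiv> mk_mod D (trans_unit D E nu (vt_src \<tau>)) (trans_unit D E nu
      (vt_trg \<tau>)) \<tau> \<tau> (\<lambda>x. E.one1 (vt0 \<tau> x))"

abbreviation mod_hcomp where
  "mod_hcomp nc \<Delta> \<Gamma> \<equiv> mk_mod D (trans_comp D E nc (md_src \<Delta>) (md_src \<Gamma>)) (trans_comp D E nc
      (md_trg \<Delta>) (md_trg \<Gamma>)) (md_dom \<Gamma>) (md_cod \<Delta>)
      (\<lambda>x. md_c \<Delta> x \<otimes>\<^sub>E md_c \<Gamma> x)"

abbreviation mod_lunitor where
  "mod_lunitor nu nc \<phi> \<equiv> mk_mod D (trans_comp D E nc (trans_unit D E nu (ht_cod \<phi>)) \<phi>) \<phi> (Idt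
      (lax_cat0 D E) (ht_dom \<phi>)) (Idt (lax_cat0 D E) (ht_cod \<phi>))
      (\<lambda>x. lunitor E (ob (ht_fun \<phi>) x))"

abbreviation mod_runitor where
  "mod_runitor nu nc \<phi> \<equiv> mk_mod D (trans_comp D E nc \<phi> (trans_unit D E nu (ht_dom \<phi>))) \<phi> (Idt
      (lax_cat0 D E) (ht_dom \<phi>)) (Idt (lax_cat0 D E) (ht_cod \<phi>))
      (\<lambda>x. runitor E (ob (ht_fun \<phi>) x))"

abbreviation mod_associator where
  "mod_associator nc \<chi> \<psi> \<phi> \<equiv> mk_mod D (trans_comp D E nc (trans_comp D E nc \<chi> \<psi>) \<phi>)
      (trans_comp D E nc \<chi> (trans_comp D E nc \<psi> \<phi>)) (Idt (lax_cat0 D E)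
      (ht_dom \<phi>)) (Idt (lax_cat0 D E) (ht_cod \<chi>)) (\<lambda>x. associator E (ob
      (ht_fun \<chi>) x, ob (ht_fun \<psi>) x, ob (ht_fun \<phi>) x))"

abbreviation mod_inv where
  "mod_inv \<Gamma> \<equiv> mk_mod D (md_trg \<Gamma>) (md_src \<Gamma>) (md_dom \<Gamma>) (md_cod \<Gamma>)
      (\<lambda>x. E.inv2 (md_c \<Gamma> x))"

section \<open>Boundaries of horizontal transformations and modifications\<close>

lemma horizontal_transformation_cell [simp]:
  assumes "horizontal_transformation D E \<zeta>"
  shows "lax_functor D E (ht_dom \<zeta>)" "lax_functor D E (ht_cod \<zeta>)"
    and "x \<in> Obj (cat0 D) \<Longrightarrow> ob (ht_fun \<zeta>) x \<in> Obj (cat1 E)"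
    and "x \<in> Obj (cat0 D) \<Longrightarrow> E.od (ob (ht_fun \<zeta>) x) = ob (lf0 (ht_dom \<zeta>)) x"
    and "x \<in> Obj (cat0 D) \<Longrightarrow> E.oc (ob (ht_fun \<zeta>) x) = ob (lf0 (ht_cod \<zeta>)) x"
    and "D.ver f \<Longrightarrow> ar (ht_fun \<zeta>) f \<in> Arr (cat1 E)"
    and "D.ver f \<Longrightarrow> E.src (ar (ht_fun \<zeta>) f) = ob (ht_fun \<zeta>) (Src (cat0 D) f)"
    and "D.ver f \<Longrightarrow> E.trg (ar (ht_fun \<zeta>) f) = ob (ht_fun \<zeta>) (Trg (cat0 D) f)"
    and "D.ver f \<Longrightarrow> E.dm (ar (ht_fun \<zeta>) f) = ar (lf0 (ht_dom \<zeta>)) f"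
    and "D.ver f \<Longrightarrow> E.cd (ar (ht_fun \<zeta>) f) = ar (lf0 (ht_cod \<zeta>)) f"
    and "x \<in> Obj (cat0 D) \<Longrightarrow> ar (ht_fun \<zeta>) (Idt (cat0 D) x) = Idt (cat1 E) (ob (ht_fun \<zeta>) x)"
  using horizontal_transformation.lax_dom[OF assms] horizontal_transformation.lax_cod[OF assms]
    is_functor.ob_in[OF horizontal_transformation.functor_fun[OF assms]]
    is_functor.ob_ar[OF horizontal_transformation.functor_fun[OF assms] D.category0]
    is_functor.ar_idt[OF horizontal_transformation.functor_fun[OF assms]]
    horizontal_transformation.hdom_fun[OF assms] horizontal_transformation.hcod_fun[OF assms]
  by (auto simp: fctr_eq_def fcomp_def)

lemma horizontal_transformation_cmp:
  "\<lbrakk>horizontal_transformation D E \<zeta>; D.ver f; D.ver g;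
      Trg (cat0 D) f = Src (cat0 D) g\<rbrakk> \<Longrightarrow>
    ar (ht_fun \<zeta>) (Cmp (cat0 D) g f) = ar (ht_fun \<zeta>) g \<cdot>\<^sub>E ar (ht_fun \<zeta>) f"
  by (rule is_functor.ar_cmp_arr[OF horizontal_transformation.functor_fun])

lemma modification_cell [simp]:
  assumes "modification D E \<Gamma>"
  shows "vertical_transformation D E (md_dom \<Gamma>)" "vertical_transformation D E (md_cod \<Gamma>)"
    and "vt_src (md_dom \<Gamma>) = ht_dom (md_src \<Gamma>)" "vt_trg (md_dom \<Gamma>) = ht_dom (md_trg \<Gamma>)"
    and "vt_src (md_cod \<Gamma>) = ht_cod (md_src \<Gamma>)" "vt_trg (md_cod \<Gamma>) = ht_cod (md_trg \<Gamma>)"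
    and "x \<in> Obj (cat0 D) \<Longrightarrow> md_c \<Gamma> x \<in> Arr (cat1 E)"
    and "x \<in> Obj (cat0 D) \<Longrightarrow> E.src (md_c \<Gamma> x) = ob (ht_fun (md_src \<Gamma>)) x"
    and "x \<in> Obj (cat0 D) \<Longrightarrow> E.trg (md_c \<Gamma> x) = ob (ht_fun (md_trg \<Gamma>)) x"
    and "x \<in> Obj (cat0 D) \<Longrightarrow> E.dm (md_c \<Gamma> x) = vt0 (md_dom \<Gamma>) x"
    and "x \<in> Obj (cat0 D) \<Longrightarrow> E.cd (md_c \<Gamma> x) = vt0 (md_cod \<Gamma>) x"
  using modification.vt_dom[OF assms] modification.vt_cod[OF assms]
    modification.hdom_c[OF assms] modification.hcod_c[OF assms]
    nat_trans.component_arr[OF modification.natural[OF assms]]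
  by (auto simp: Hom_def)

lemma modification_natural:
  "\<lbrakk>modification D E \<Gamma>; D.ver f\<rbrakk> \<Longrightarrow>
    md_c \<Gamma> (Trg (cat0 D) f) \<cdot>\<^sub>E ar (ht_fun (md_src \<Gamma>)) f
      = ar (ht_fun (md_trg \<Gamma>)) f \<cdot>\<^sub>E md_c \<Gamma> (Src (cat0 D) f)"
  by (rule nat_trans.natural_arr[OF modification.natural])

lemma modification_eqI:
  assumes "modification D E \<Gamma>" "modification D E \<Delta>"
    and "md_src \<Gamma> = md_src \<Delta>" "md_trg \<Gamma> = md_trg \<Delta>" "md_dom \<Gamma> = md_dom \<Delta>" "md_cod \<Gamma> = md_cod \<Delta>"
    and "\<And>x. x \<in> Obj (cat0 D) \<Longrightarrow> md_c \<Gamma> x = md_c \<Delta> x"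
  shows "\<Gamma> = \<Delta>"
proof (rule modif.equality)
  show "md_c \<Gamma> = md_c \<Delta>"
    using assms modification.ext extensionalityI by metis
qed (use assms in auto)

lemma modificationI:
  assumes "vertical_transformation D E \<phi>" "vertical_transformation D E \<psi>"
    and "vt_src \<phi> = ht_dom \<zeta>" "vt_trg \<phi> = ht_dom \<xi>" "vt_src \<psi> = ht_cod \<zeta>" "vt_trg \<psi> = ht_cod \<xi>"
    and "\<And>x. x \<in> Obj (cat0 D) \<Longrightarrow> c x \<in> Arr (cat1 E) \<and> E.src (c x) = ob (ht_fun \<zeta>) x \<and>
      E.trg (c x) = ob (ht_fun \<xi>) x \<and> E.dm (c x) = vt0 \<phi> x \<and>
      E.cd (c x) = vt0 \<psi> x"
    and "\<And>f. f \<in> Arr (cat0 D) \<Longrightarrow> c (Trg (cat0 D) f) \<cdot>\<^sub>E ar (ht_fun \<zeta>) f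
      = ar (ht_fun \<xi>) f \<cdot>\<^sub>E c (Src (cat0 D) f)"
  shows "modification D E (mk_mod D \<zeta> \<xi> \<phi> \<psi> c)"
proof (rule modification.intro)
  show "nat_trans (cat0 D) (cat1 E) (ht_fun (md_src (mk_mod D \<zeta> \<xi> \<phi> \<psi> c)))
      (ht_fun (md_trg (mk_mod D \<zeta> \<xi> \<phi> \<psi> c))) (md_c (mk_mod D \<zeta> \<xi> \<phi> \<psi> c))"
    by (rule nat_transI) (use assms in simp_all)
qed (use assms in \<open>auto simp: Hom_def\<close>)

lemma trans_comp_simps [simp]:
  "ht_dom (trans_comp D E nc \<psi> \<phi>) = ht_dom \<phi>" "ht_cod (trans_comp D E nc \<psi> \<phi>) = ht_cod \<psi>"
  "x \<in> Obj (cat0 D) \<Longrightarrow>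
    ob (ht_fun (trans_comp D E nc \<psi> \<phi>)) x = ob (ht_fun \<psi>) x \<boxtimes>\<^sub>E ob (ht_fun \<phi>) x"
  "D.ver f \<Longrightarrow>
    ar (ht_fun (trans_comp D E nc \<psi> \<phi>)) f = ar (ht_fun \<psi>) f \<otimes>\<^sub>E ar (ht_fun \<phi>) f"
  "D.hor r \<Longrightarrow> ht_n (trans_comp D E nc \<psi> \<phi>) r = nc \<psi> \<phi> r"
  by (simp_all add: trans_comp_def fctr_restrict_def hcomp_fctr_def fcomp_def pair_fctr_def)

lemma trans_unit_simps [simp]:
  "ht_dom (trans_unit D E nu F) = F" "ht_cod (trans_unit D E nu F) = F"
  "x \<in> Obj (cat0 D) \<Longrightarrow> ob (ht_fun (trans_unit D E nu F)) x = E.one (ob (lf0 F) x)"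
  "D.ver f \<Longrightarrow> ar (ht_fun (trans_unit D E nu F)) f = E.one1 (ar (lf0 F) f)"
  "D.hor r \<Longrightarrow> ht_n (trans_unit D E nu F) r = nu F r"
  by (simp_all add: trans_unit_def fctr_restrict_def fcomp_def)

lemma horizontal_transformation_unit:
  assumes "lax_functor D E F" "\<And>r. r \<in> Obj (cat1 D) \<Longrightarrow> globular E (nu F r)"
  shows "horizontal_transformation D E (trans_unit D E nu F)"
proof (rule horizontal_transformation.intro)
  show "is_functor (cat0 D) (cat1 E) (ht_fun (trans_unit D E nu F))"
    by (rule is_functorI) (use assms is_functor.ar_cmp_arr[OF lax_functor.functor0[OF assms(1)]]
      in \<open>simp_all add: E.hunit_cmp\<close>)
qed (use assms in \<open>auto simp: trans_unit_def fctr_ext_def fctr_restrict_def fctr_eq_def fcomp_def\<close>)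

lemma horizontal_transformation_comp:
  assumes "horizontal_transformation D E \<phi>" "horizontal_transformation D E \<psi>" "ht_dom \<psi> = ht_cod \<phi>"
    and "\<And>r. r \<in> Obj (cat1 D) \<Longrightarrow> globular E (nc \<psi> \<phi> r)"
  shows "horizontal_transformation D E (trans_comp D E nc \<psi> \<phi>)"
proof (rule horizontal_transformation.intro)
  show "is_functor (cat0 D) (cat1 E) (ht_fun (trans_comp D E nc \<psi> \<phi>))"
    by (rule is_functorI)
      (use assms in \<open>simp_all add: E.interchange horizontal_transformation_cmp\<close>)
  show "fctr_ext (cat0 D) (ht_fun (trans_comp D E nc \<psi> \<phi>))"
    "ht_n (trans_comp D E nc \<psi> \<phi>) \<in> extensional (Obj (cat1 D))"
    by (simp_all add: trans_comp_def fctr_ext_def fctr_restrict_def)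
qed (use assms in \<open>auto simp: fctr_eq_def fcomp_def\<close>)

end

section \<open>Pseudodouble categories of transformations\<close>

text \<open>
  \<open>T\<close> is the set of lax or oplax transformations and \<open>K\<close> the compatibility of a modification with
  their constraints; \<open>nu\<close> and \<open>nc\<close> are the constraints of horizontal units and composites.
\<close>

locale transformation_structure = pseudodouble_pair D E
  for D :: "('o, 'v, 'h, 'c) pdcat" and E :: "('p, 'w, 'k, 'd) pdcat" +
  fixes T :: "('o, 'v, 'h, 'c, 'p, 'w, 'k, 'd) htrans set"
    and K :: "('o, 'v, 'h, 'c, 'p, 'w, 'k, 'd) modif \<Rightarrow> bool"
    and nu :: "('o, 'v, 'h, 'c, 'p, 'w, 'k, 'd) lax_fun \<Rightarrow> 'h \<Rightarrow> 'd"
    and nc :: "('o, 'v, 'h, 'c, 'p, 'w, 'k, 'd) htrans \<Rightarrow>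
      ('o, 'v, 'h, 'c, 'p, 'w, 'k, 'd) htrans \<Rightarrow> 'h \<Rightarrow> 'd"
    and M :: "('o, 'v, 'h, 'c, 'p, 'w, 'k, 'd) modif set"
  defines "M \<equiv> {\<Gamma>. modification D E \<Gamma> \<and> md_src \<Gamma> \<in> T \<and> md_trg \<Gamma> \<in> T \<and> K \<Gamma>}"
  assumes T_ht [simp]: "\<zeta> \<in> T \<Longrightarrow> horizontal_transformation D E \<zeta>"
    and unit_T [simp]: "lax_functor D E F \<Longrightarrow> trans_unit D E nu F \<in> T"
    and comp_T [simp]: "\<lbrakk>\<psi> \<in> T; \<phi> \<in> T; ht_dom \<psi> = ht_cod \<phi>\<rbrakk> \<Longrightarrow> trans_comp D E nc \<psi> \<phi> \<in> T"
    and K_idt: "\<zeta> \<in> T \<Longrightarrow> K (mod_idt \<zeta>)"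
    and K_cmp: "\<lbrakk>\<Gamma> \<in> M; \<Delta> \<in> M; md_trg \<Gamma> = md_src \<Delta>\<rbrakk> \<Longrightarrow> K (mod_cmp \<Delta> \<Gamma>)"
    and K_inv: "\<lbrakk>\<Gamma> \<in> M; md_dom \<Gamma> = Idt (lax_cat0 D E) F; md_cod \<Gamma> = Idt (lax_cat0 D E) G;
        \<And>x. x \<in> Obj (cat0 D) \<Longrightarrow> E.iso2 (md_c \<Gamma> x)\<rbrakk> \<Longrightarrow>
      K (mod_inv \<Gamma>)"
    and K_unit: "vertical_transformation D E \<tau> \<Longrightarrow> K (mod_unit nu \<tau>)"
    and K_hcomp: "\<lbrakk>\<Gamma> \<in> M; \<Delta> \<in> M; md_dom \<Delta> = md_cod \<Gamma>\<rbrakk> \<Longrightarrow>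
      K (mod_hcomp nc \<Delta> \<Gamma>)"
    and K_lunitor: "\<phi> \<in> T \<Longrightarrow> K (mod_lunitor nu nc \<phi>)"
    and K_runitor: "\<phi> \<in> T \<Longrightarrow> K (mod_runitor nu nc \<phi>)"
    and K_associator: "\<lbrakk>\<chi> \<in> T; \<psi> \<in> T; \<phi> \<in> T; ht_dom \<chi> = ht_cod \<psi>; ht_dom \<psi> = ht_cod \<phi>\<rbrakk> \<Longrightarrow>
      K (mod_associator nc \<chi> \<psi> \<phi>)"
begin

abbreviation P where "P \<equiv> trans_pdcat D E T M nu nc"

lemma M_modification [simp]:
  "\<Gamma> \<in> M \<Longrightarrow> modification D E \<Gamma>" "\<Gamma> \<in> M \<Longrightarrow> md_src \<Gamma> \<in> T" "\<Gamma> \<in> M \<Longrightarrow> md_trg \<Gamma> \<in> T"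
  by (simp_all add: M_def)

lemma P_simps [simp]:
  "cat0 P = lax_cat0 D E"
  "Obj (cat1 P) = T"
  "Arr (cat1 P) = M"
  "Src (cat1 P) = md_src"
  "Trg (cat1 P) = md_trg"
  "ob (hdom P) = ht_dom"
  "ob (hcod P) = ht_cod"
  "ar (hdom P) = md_dom"
  "ar (hcod P) = md_cod"
  "ob (hunit P) F = trans_unit D E nu F"
  "ob (hcomp P) (\<psi>, \<phi>) = trans_comp D E nc \<psi> \<phi>"
  by (simp_all add: trans_pdcat_def trans_cat1_def mk_mod_def Let_def)

text \<open>These unfoldings are not simplification rules: the cells of \<open>P\<close> stay
  folded, \<open>P_closed\<close> places them in \<open>M\<close>, and \<open>P_cells_simps\<close>
  evaluates their boundaries and components.\<close>

lemma P_cells: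
  "Idt (cat1 P) \<zeta> = mod_idt \<zeta>"
  "Cmp (cat1 P) \<Delta> \<Gamma> = mod_cmp \<Delta> \<Gamma>"
  "ar (hunit P) \<tau> = mod_unit nu \<tau>"
  "ar (hcomp P) (\<Delta>, \<Gamma>) = mod_hcomp nc \<Delta> \<Gamma>"
  "lunitor P \<phi> = mod_lunitor nu nc \<phi>"
  "runitor P \<phi> = mod_runitor nu nc \<phi>"
  "associator P (\<chi>, \<psi>, \<phi>) = mod_associator nc \<chi> \<psi> \<phi>"
  by (simp_all add: trans_pdcat_def trans_cat1_def mk_mod_def Let_def)

lemma P_cells_simps [simp]:
  "md_src (Idt (cat1 P) \<zeta>) = \<zeta>"
  "md_trg (Idt (cat1 P) \<zeta>) = \<zeta>"
  "md_dom (Idt (cat1 P) \<zeta>) = Idt (lax_cat0 D E) (ht_dom \<zeta>)"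
  "md_cod (Idt (cat1 P) \<zeta>) = Idt (lax_cat0 D E) (ht_cod \<zeta>)"
  "x \<in> Obj (cat0 D) \<Longrightarrow> md_c (Idt (cat1 P) \<zeta>) x = E.idh (ob (ht_fun \<zeta>) x)"
  "md_src (Cmp (cat1 P) \<Delta> \<Gamma>) = md_src \<Gamma>"
  "md_trg (Cmp (cat1 P) \<Delta> \<Gamma>) = md_trg \<Delta>"
  "md_dom (Cmp (cat1 P) \<Delta> \<Gamma>) = Cmp (lax_cat0 D E) (md_dom \<Delta>) (md_dom \<Gamma>)"
  "md_cod (Cmp (cat1 P) \<Delta> \<Gamma>) = Cmp (lax_cat0 D E) (md_cod \<Delta>) (md_cod \<Gamma>)"
  "x \<in> Obj (cat0 D) \<Longrightarrow> md_c (Cmp (cat1 P) \<Delta> \<Gamma>) x = md_c \<Delta> x \<cdot>\<^sub>E md_c \<Gamma> x"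
  "md_src (ar (hunit P) \<tau>) = trans_unit D E nu (vt_src \<tau>)"
  "md_trg (ar (hunit P) \<tau>) = trans_unit D E nu (vt_trg \<tau>)"
  "md_dom (ar (hunit P) \<tau>) = \<tau>"
  "md_cod (ar (hunit P) \<tau>) = \<tau>"
  "x \<in> Obj (cat0 D) \<Longrightarrow> md_c (ar (hunit P) \<tau>) x = E.one1 (vt0 \<tau> x)"
  "md_src (ar (hcomp P) (\<Delta>, \<Gamma>)) = trans_comp D E nc (md_src \<Delta>) (md_src \<Gamma>)"
  "md_trg (ar (hcomp P) (\<Delta>, \<Gamma>)) = trans_comp D E nc (md_trg \<Delta>) (md_trg \<Gamma>)"
  "md_dom (ar (hcomp P) (\<Delta>, \<Gamma>)) = md_dom \<Gamma>"
  "md_cod (ar (hcomp P) (\<Delta>, \<Gamma>)) = md_cod \<Delta>"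
  "x \<in> Obj (cat0 D) \<Longrightarrow> md_c (ar (hcomp P) (\<Delta>, \<Gamma>)) x = md_c \<Delta> x \<otimes>\<^sub>E md_c \<Gamma> x"
  "md_src (lunitor P \<phi>) = trans_comp D E nc (trans_unit D E nu (ht_cod \<phi>)) \<phi>"
  "md_trg (lunitor P \<phi>) = \<phi>"
  "md_dom (lunitor P \<phi>) = Idt (lax_cat0 D E) (ht_dom \<phi>)"
  "md_cod (lunitor P \<phi>) = Idt (lax_cat0 D E) (ht_cod \<phi>)"
  "x \<in> Obj (cat0 D) \<Longrightarrow> md_c (lunitor P \<phi>) x = lunitor E (ob (ht_fun \<phi>) x)"
  "md_src (runitor P \<phi>) = trans_comp D E nc \<phi> (trans_unit D E nu (ht_dom \<phi>))"
  "md_trg (runitor P \<phi>) = \<phi>"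
  "md_dom (runitor P \<phi>) = Idt (lax_cat0 D E) (ht_dom \<phi>)"
  "md_cod (runitor P \<phi>) = Idt (lax_cat0 D E) (ht_cod \<phi>)"
  "x \<in> Obj (cat0 D) \<Longrightarrow> md_c (runitor P \<phi>) x = runitor E (ob (ht_fun \<phi>) x)"
  "md_src (associator P (\<chi>, \<psi>, \<phi>)) = trans_comp D E nc (trans_comp D E nc \<chi> \<psi>) \<phi>"
  "md_trg (associator P (\<chi>, \<psi>, \<phi>)) = trans_comp D E nc \<chi> (trans_comp D E nc \<psi> \<phi>)"
  "md_dom (associator P (\<chi>, \<psi>, \<phi>)) = Idt (lax_cat0 D E) (ht_dom \<phi>)"
  "md_cod (associator P (\<chi>, \<psi>, \<phi>)) = Idt (lax_cat0 D E) (ht_cod \<chi>)"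
  "x \<in> Obj (cat0 D) \<Longrightarrow> md_c (associator P (\<chi>, \<psi>, \<phi>)) x = associator E (ob (ht_fun \<chi>) x, ob (ht_fun \<psi>) x, ob (ht_fun \<phi>) x)"
  by (simp_all add: P_cells)

lemma M_I:
  assumes "vertical_transformation D E \<phi>" "vertical_transformation D E \<psi>"
    and "vt_src \<phi> = ht_dom \<zeta>" "vt_trg \<phi> = ht_dom \<xi>" "vt_src \<psi> = ht_cod \<zeta>" "vt_trg \<psi> = ht_cod \<xi>"
    and "\<zeta> \<in> T" "\<xi> \<in> T" "K (mk_mod D \<zeta> \<xi> \<phi> \<psi> c)"
    and "\<And>x. x \<in> Obj (cat0 D) \<Longrightarrow> c x \<in> Arr (cat1 E) \<and> E.src (c x) = ob (ht_fun \<zeta>) x \<and>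
      E.trg (c x) = ob (ht_fun \<xi>) x \<and> E.dm (c x) = vt0 \<phi> x \<and>
      E.cd (c x) = vt0 \<psi> x"
    and "\<And>f. f \<in> Arr (cat0 D) \<Longrightarrow> c (Trg (cat0 D) f) \<cdot>\<^sub>E ar (ht_fun \<zeta>) f
      = ar (ht_fun \<xi>) f \<cdot>\<^sub>E c (Src (cat0 D) f)"
  shows "mk_mod D \<zeta> \<xi> \<phi> \<psi> c \<in> M"
  unfolding M_def using assms modificationI[OF assms(1-6,10,11)] by simp

lemma idt_M:
  assumes "\<zeta> \<in> T"
  shows "mod_idt \<zeta> \<in> M"
  by (rule M_I) (use assms K_idt in simp_all)

lemma cmp_M:
  assumes "\<Gamma> \<in> M" "\<Delta> \<in> M" "md_trg \<Gamma> = md_src \<Delta>"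
  shows "mod_cmp \<Delta> \<Gamma> \<in> M"
  by (rule M_I) (use assms modification_natural[of \<Gamma>]
    modification_natural[of \<Delta>, THEN E.H.cmp_reassoc] in
    \<open>simp_all add: K_cmp E.H.cmp_assoc_arr\<close>)

text \<open>With identities as dom and cod, every component is globular, and the inverse of a
  globular cell has the same dom and cod. So the pointwise inverse has the boundary of a
  modification, and naturality is inverted square by square.\<close>

lemma inv_M:
  assumes "\<Gamma> \<in> M" "md_dom \<Gamma> = Idt (lax_cat0 D E) F" "md_cod \<Gamma> = Idt (lax_cat0 D E) G"
    and iso: "\<And>x. x \<in> Obj (cat0 D) \<Longrightarrow> E.iso2 (md_c \<Gamma> x)"
  shows "mod_inv \<Gamma> \<in> M"
proof -
  have FG: "ht_dom (md_src \<Gamma>) = F" "ht_dom (md_trg \<Gamma>) = F" "ht_cod (md_src \<Gamma>) = G"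
    "ht_cod (md_trg \<Gamma>) = G"
    using modification_cell(3-6)[OF M_modification(1)[OF assms(1)]] assms by simp_all
  have [simp]: "E.dm (E.inv2 (md_c \<Gamma> x)) = vt0 (md_dom \<Gamma>) x"
    "E.cd (E.inv2 (md_c \<Gamma> x)) = vt0 (md_cod \<Gamma>) x" if x: "x \<in> Obj (cat0 D)" for x
  proof -
    have "lax_functor D E F" "lax_functor D E G"
      using FG horizontal_transformation_cell(1,2)[OF T_ht[OF M_modification(2)[OF assms(1)]]] by auto
    then have "globular E (md_c \<Gamma> x)"
      using x assms by (intro E.globularI[where x = "ob (lf0 F) x" and y = "ob (lf0 G) x"]) simp_all
    then show "E.dm (E.inv2 (md_c \<Gamma> x)) = vt0 (md_dom \<Gamma>) x"
      "E.cd (E.inv2 (md_c \<Gamma> x)) = vt0 (md_cod \<Gamma>) x"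
      using E.globular_inv[OF iso[OF x]] x assms(1) by simp_all
  qed
  have "E.inv2 (md_c \<Gamma> (Trg (cat0 D) f)) \<cdot>\<^sub>E ar (ht_fun (md_trg \<Gamma>)) f
      = ar (ht_fun (md_src \<Gamma>)) f \<cdot>\<^sub>E E.inv2 (md_c \<Gamma> (Src (cat0 D) f))" if "D.ver f" for f
    by (rule E.H.inv_commute[OF modification_natural[symmetric]]) (use that assms in simp_all)
  moreover have "K (mod_inv \<Gamma>)"
    by (rule K_inv[OF assms])
  ultimately show ?thesis
    by (intro M_I) (use assms(1) iso FG in simp_all)
qed

lemma unit_M:
  assumes "vertical_transformation D E \<phi>"
  shows "mod_unit nu \<phi> \<in> M"
  by (rule M_I) (use assms nat_trans.natural_arr[OF vertical_transformation.natural0[OF assms]]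
    in \<open>simp_all add: K_unit flip: E.hunit_cmp\<close>)

lemma hcomposable:
  assumes "\<Gamma> \<in> M" "\<Delta> \<in> M" "md_dom \<Delta> = md_cod \<Gamma>"
  shows "ht_dom (md_src \<Delta>) = ht_cod (md_src \<Gamma>)" "ht_dom (md_trg \<Delta>) = ht_cod (md_trg \<Gamma>)"
  using modification_cell(3-6)[OF M_modification(1)[OF assms(1)]]
    modification_cell(3-6)[OF M_modification(1)[OF assms(2)]] assms(3) by simp_all

lemma hcomp_M:
  assumes "\<Gamma> \<in> M" "\<Delta> \<in> M" "md_dom \<Delta> = md_cod \<Gamma>"
  shows "mod_hcomp nc \<Delta> \<Gamma> \<in> M"
  by (rule M_I) (use assms hcomposable[OF assms] in
    \<open>simp_all add: K_hcomp E.interchange modification_natural\<close>)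

lemma unitor_M:
  assumes "\<phi> \<in> T"
  shows "mod_lunitor nu nc \<phi> \<in> M"
    and "mod_runitor nu nc \<phi> \<in> M"
proof -
  have "lunitor E (ob (ht_fun \<phi>) (Trg (cat0 D) f)) \<cdot>\<^sub>E (E.one1 (ar (lf0 (ht_cod \<phi>)) f) \<otimes>\<^sub>E ar (ht_fun \<phi>) f)
      = ar (ht_fun \<phi>) f \<cdot>\<^sub>E lunitor E (ob (ht_fun \<phi>) (Src (cat0 D) f))"
    "runitor E (ob (ht_fun \<phi>) (Trg (cat0 D) f)) \<cdot>\<^sub>E (ar (ht_fun \<phi>) f \<otimes>\<^sub>E E.one1 (ar (lf0 (ht_dom \<phi>)) f))
      = ar (ht_fun \<phi>) f \<cdot>\<^sub>E runitor E (ob (ht_fun \<phi>) (Src (cat0 D) f))"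
    if "D.ver f" for f
    using that assms E.lunitor_natural[of "ar (ht_fun \<phi>) f"] E.runitor_natural[of "ar (ht_fun \<phi>) f"]
    by simp_all
  then show "mod_lunitor nu nc \<phi> \<in> M"
    "mod_runitor nu nc \<phi> \<in> M"
    using assms by (auto intro!: M_I simp: K_lunitor K_runitor)
qed

lemma associator_M:
  assumes "\<chi> \<in> T" "\<psi> \<in> T" "\<phi> \<in> T" "ht_dom \<chi> = ht_cod \<psi>" "ht_dom \<psi> = ht_cod \<phi>"
  shows "mod_associator nc \<chi> \<psi> \<phi> \<in> M"
proof -
  have "associator E (ob (ht_fun \<chi>) (Trg (cat0 D) f), ob (ht_fun \<psi>) (Trg (cat0 D) f), ob (ht_fun \<phi>) (Trg (cat0 D) f))
      \<cdot>\<^sub>E ((ar (ht_fun \<chi>) f \<otimes>\<^sub>E ar (ht_fun \<psi>) f) \<otimes>\<^sub>E ar (ht_fun \<phi>) f)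
      = (ar (ht_fun \<chi>) f \<otimes>\<^sub>E ar (ht_fun \<psi>) f \<otimes>\<^sub>E ar (ht_fun \<phi>) f)
      \<cdot>\<^sub>E associator E (ob (ht_fun \<chi>) (Src (cat0 D) f), ob (ht_fun \<psi>) (Src (cat0 D) f), ob (ht_fun \<phi>) (Src (cat0 D) f))"
    if "D.ver f" for f
    using that assms E.associator_natural[of "ar (ht_fun \<chi>) f" "ar (ht_fun \<psi>) f" "ar (ht_fun \<phi>) f"]
    by simp
  then show ?thesis
    using assms by (auto intro!: M_I simp: K_associator)
qed

lemma M_eqI:
  assumes "\<Gamma> \<in> M" "\<Delta> \<in> M"
    and "md_src \<Gamma> = md_src \<Delta>" "md_trg \<Gamma> = md_trg \<Delta>" "md_dom \<Gamma> = md_dom \<Delta>" "md_cod \<Gamma> = md_cod \<Delta>"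
    and "\<And>x. x \<in> Obj (cat0 D) \<Longrightarrow> md_c \<Gamma> x = md_c \<Delta> x"
  shows "\<Gamma> = \<Delta>"
  using assms modification_eqI M_modification(1) by blast

lemmas P_closed [simp] = idt_M[folded P_cells] cmp_M[folded P_cells] unit_M[folded P_cells]
  hcomp_M[folded P_cells] unitor_M[folded P_cells] associator_M[folded P_cells]

lemma category_cat1: "category (cat1 P)"
  by (rule categoryI) (auto intro!: M_eqI simp: E.H.cmp_assoc_arr L.cmp_assoc_arr)

text \<open>The inverse laws hold at each 0-cell, and \<open>inv_M\<close> supplies the membership
  in \<open>M\<close>. The explicit inverse is what later evaluates the inverse unitors in the
  equations of conjoints and companions.\<close>

lemma iso_P:
  assumes "\<Gamma> \<in> M" "md_dom \<Gamma> = Idt (lax_cat0 D E) F" "md_cod \<Gamma> = Idt (lax_cat0 D E) G"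
    and iso: "\<And>x. x \<in> Obj (cat0 D) \<Longrightarrow> E.iso2 (md_c \<Gamma> x)"
  shows "iso_arrow (cat1 P) \<Gamma>"
    and "inv_arrow (cat1 P) \<Gamma>
      = mod_inv \<Gamma>"
proof -
  let ?i = "mod_inv \<Gamma>"
  interpret H: category "cat1 P" by (rule category_cat1)
  have FG: "ht_dom (md_src \<Gamma>) = F" "ht_dom (md_trg \<Gamma>) = F" "ht_cod (md_src \<Gamma>) = G"
    "ht_cod (md_trg \<Gamma>) = G"
    using modification_cell(3-6)[OF M_modification(1)[OF assms(1)]] assms by simp_all
  have l: "lax_functor D E F" "lax_functor D E G"
    using FG horizontal_transformation_cell(1,2)[OF T_ht[OF M_modification(2)[OF assms(1)]]] by auto
  note i = inv_M[OF assms]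
  have T: "md_src \<Gamma> \<in> T" "md_trg \<Gamma> \<in> T" using assms(1) by simp_all
  have "Cmp (cat1 P) ?i \<Gamma> = Idt (cat1 P) (md_src \<Gamma>)"
    by (rule M_eqI) (use assms(1) i in \<open>simp_all add: FG assms(2,3) l iso T\<close>)
  moreover have "Cmp (cat1 P) \<Gamma> ?i = Idt (cat1 P) (md_trg \<Gamma>)"
    by (rule M_eqI) (use assms(1) i in \<open>simp_all add: FG assms(2,3) l iso T\<close>)
  ultimately have "inverse_arrows (cat1 P) \<Gamma> ?i"
    using assms(1) i by (simp add: inverse_arrows_def Hom_def)
  then show "iso_arrow (cat1 P) \<Gamma>" "inv_arrow (cat1 P) \<Gamma> = ?i"
    by (rule H.iso_arrowI, rule H.inv_arrowI)
qed

lemma iso_constraints: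
  shows "\<phi> \<in> T \<Longrightarrow> iso_arrow (cat1 P) (lunitor P \<phi>)"
    and "\<phi> \<in> T \<Longrightarrow> iso_arrow (cat1 P) (runitor P \<phi>)"
    and "\<lbrakk>\<chi> \<in> T; \<psi> \<in> T; \<phi> \<in> T; ht_dom \<chi> = ht_cod \<psi>; ht_dom \<psi> = ht_cod \<phi>\<rbrakk> \<Longrightarrow>
      iso_arrow (cat1 P) (associator P (\<chi>, \<psi>, \<phi>))"
  by (rule iso_P(1)[where F = "ht_dom \<phi>"]; simp)+

lemma modification_unitor_natural:
  assumes "\<Gamma> \<in> M" "x \<in> Obj (cat0 D)"
  shows "lunitor E (ob (ht_fun (md_trg \<Gamma>)) x) \<cdot>\<^sub>E (E.one1 (vt0 (md_cod \<Gamma>) x) \<otimes>\<^sub>E md_c \<Gamma> x)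
      = md_c \<Gamma> x \<cdot>\<^sub>E lunitor E (ob (ht_fun (md_src \<Gamma>)) x)"
    and "runitor E (ob (ht_fun (md_trg \<Gamma>)) x) \<cdot>\<^sub>E (md_c \<Gamma> x \<otimes>\<^sub>E E.one1 (vt0 (md_dom \<Gamma>) x))
      = md_c \<Gamma> x \<cdot>\<^sub>E runitor E (ob (ht_fun (md_src \<Gamma>)) x)"
  using assms E.lunitor_natural[of "md_c \<Gamma> x"] E.runitor_natural[of "md_c \<Gamma> x"] by simp_all

lemma modification_associator_natural:
  assumes "c \<in> M" "b \<in> M" "a \<in> M" "md_dom c = md_cod b" "md_dom b = md_cod a" "x \<in> Obj (cat0 D)"
  shows "associator E (ob (ht_fun (md_trg c)) x, ob (ht_fun (md_trg b)) x, ob (ht_fun (md_trg a)) x)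
      \<cdot>\<^sub>E ((md_c c x \<otimes>\<^sub>E md_c b x) \<otimes>\<^sub>E md_c a x)
    = (md_c c x \<otimes>\<^sub>E md_c b x \<otimes>\<^sub>E md_c a x)
      \<cdot>\<^sub>E associator E (ob (ht_fun (md_src c)) x, ob (ht_fun (md_src b)) x, ob (ht_fun (md_src a)) x)"
  using assms E.associator_natural[of "md_c c x" "md_c b x" "md_c a x"] by simp

lemma associator_P_natural:
  assumes M: "c \<in> M" "b \<in> M" "a \<in> M" and m: "md_dom c = md_cod b" "md_dom b = md_cod a"
  shows "associator P (md_trg c, md_trg b, md_trg a) \<bullet>\<^bsub>P\<^esub> ((c \<star>\<^bsub>P\<^esub> b) \<star>\<^bsub>P\<^esub> a)
      = (c \<star>\<^bsub>P\<^esub> (b \<star>\<^bsub>P\<^esub> a)) \<bullet>\<^bsub>P\<^esub> associator P (md_src c, md_src b, md_src a)"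
proof (rule M_eqI)
  have h: "ht_dom (md_src c) = ht_cod (md_src b)" "ht_dom (md_trg c) = ht_cod (md_trg b)"
    "ht_dom (md_src b) = ht_cod (md_src a)" "ht_dom (md_trg b) = ht_cod (md_trg a)"
    using hcomposable[of b c] hcomposable[of a b] assms by auto
  have 1: "(c \<star>\<^bsub>P\<^esub> b) \<star>\<^bsub>P\<^esub> a \<in> M" "c \<star>\<^bsub>P\<^esub> (b \<star>\<^bsub>P\<^esub> a) \<in> M" using M m by simp_all
  have 2: "associator P (md_trg c, md_trg b, md_trg a) \<in> M" "associator P (md_src c, md_src b, md_src a) \<in> M"
    using M h by simp_all
  show "associator P (md_trg c, md_trg b, md_trg a) \<bullet>\<^bsub>P\<^esub> ((c \<star>\<^bsub>P\<^esub> b) \<star>\<^bsub>P\<^esub> a) \<in> M"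
    "(c \<star>\<^bsub>P\<^esub> (b \<star>\<^bsub>P\<^esub> a)) \<bullet>\<^bsub>P\<^esub> associator P (md_src c, md_src b, md_src a) \<in> M"
    using 1 2 by (rule_tac P_closed(2); simp)+
qed (use modification_associator_natural[OF assms] M in simp_all)

text \<open>The constraints enter through the assumptions on \<open>T\<close> and \<open>K\<close>,
  which place all structure cells in \<open>M\<close>. From there each equation is tested by
  \<open>M_eqI\<close> at a 0-cell, where it is the corresponding law of \<open>E\<close>.\<close>

theorem pseudodouble_category_P: "pseudodouble_category P"
proof (rule pseudodouble_category.intro)
  show "category (cat0 P)" by (simp add: category_lax_cat0)
  show "category (cat1 P)" by (rule category_cat1)
  show "is_functor (cat1 P) (cat0 P) (hdom P)" "is_functor (cat1 P) (cat0 P) (hcod P)"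
    by (rule is_functorI; simp)+
  show "is_functor (cat0 P) (cat1 P) (hunit P)"
    by (rule is_functorI) (auto intro!: M_eqI simp: E.hunit_cmp)
  show "is_functor (composable_pairs P) (cat1 P) (hcomp P)"
  proof (rule is_functorI)
    fix \<Theta> assume "\<Theta> \<in> Arr (composable_pairs P)"
    then obtain \<Delta> \<Gamma> where *: "\<Theta> = (\<Delta>, \<Gamma>)" "\<Gamma> \<in> M" "\<Delta> \<in> M" "md_dom \<Delta> = md_cod \<Gamma>"
      by (auto simp: composable_pairs_def)
    then show "ar (hcomp P) \<Theta> \<in> Arr (cat1 P) \<and>
        Src (cat1 P) (ar (hcomp P) \<Theta>) = ob (hcomp P) (Src (composable_pairs P) \<Theta>) \<and>
        Trg (cat1 P) (ar (hcomp P) \<Theta>) = ob (hcomp P) (Trg (composable_pairs P) \<Theta>)"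
      by (simp add: composable_pairs_def)
    fix \<Theta>' assume "\<Theta>' \<in> Arr (composable_pairs P)" and
      t: "Trg (composable_pairs P) \<Theta> = Src (composable_pairs P) \<Theta>'"
    then obtain \<Delta>' \<Gamma>' where "\<Theta>' = (\<Delta>', \<Gamma>')" "\<Gamma>' \<in> M" "\<Delta>' \<in> M" "md_dom \<Delta>' = md_cod \<Gamma>'"
      by (auto simp: composable_pairs_def)
    with * t show "ar (hcomp P) (Cmp (composable_pairs P) \<Theta>' \<Theta>)
        = Cmp (cat1 P) (ar (hcomp P) \<Theta>') (ar (hcomp P) \<Theta>)"
      by (simp add: composable_pairs_def) (rule M_eqI; simp add: E.interchange)
  qed (auto intro!: M_eqI simp: composable_pairs_def)
  show "fctr_eq (cat0 P) (fcomp (hdom P) (hunit P)) id_fctr"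
    "fctr_eq (cat0 P) (fcomp (hcod P) (hunit P)) id_fctr"
    "fctr_eq (composable_pairs P) (fcomp (hdom P) (hcomp P)) (fcomp (hdom P) snd_fctr)"
    "fctr_eq (composable_pairs P) (fcomp (hcod P) (hcomp P)) (fcomp (hcod P) fst_fctr)"
    by (auto simp: fctr_eq_def fcomp_def id_fctr_def fst_fctr_def snd_fctr_def composable_pairs_def)
  show "nat_iso (cat1 P) (cat1 P) (hcomp_fctr P (fcomp (hunit P) (hcod P)) id_fctr) id_fctr (lunitor P)"
    unfolding nat_iso_def
  proof (intro conjI ballI nat_transI)
    fix \<Gamma> assume "\<Gamma> \<in> Arr (cat1 P)"
    then show "Cmp (cat1 P) (lunitor P (Trg (cat1 P) \<Gamma>))
        (ar (hcomp_fctr P (fcomp (hunit P) (hcod P)) id_fctr) \<Gamma>)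
      = Cmp (cat1 P) (ar id_fctr \<Gamma>) (lunitor P (Src (cat1 P) \<Gamma>))"
      by (auto intro!: M_eqI simp: modification_unitor_natural hcomp_fctr_def fcomp_def pair_fctr_def id_fctr_def)
  qed (auto simp: hcomp_fctr_def fcomp_def pair_fctr_def id_fctr_def iso_constraints)
  show "nat_iso (cat1 P) (cat1 P) (hcomp_fctr P id_fctr (fcomp (hunit P) (hdom P))) id_fctr (runitor P)"
    unfolding nat_iso_def
  proof (intro conjI ballI nat_transI)
    fix \<Gamma> assume "\<Gamma> \<in> Arr (cat1 P)"
    then show "Cmp (cat1 P) (runitor P (Trg (cat1 P) \<Gamma>))
        (ar (hcomp_fctr P id_fctr (fcomp (hunit P) (hdom P))) \<Gamma>)
      = Cmp (cat1 P) (ar id_fctr \<Gamma>) (runitor P (Src (cat1 P) \<Gamma>))"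
      by (auto intro!: M_eqI simp: modification_unitor_natural hcomp_fctr_def fcomp_def pair_fctr_def id_fctr_def)
  qed (auto simp: hcomp_fctr_def fcomp_def pair_fctr_def id_fctr_def iso_constraints)
  show "nat_iso (composable_triples P) (cat1 P)
      \<lparr>ob = (\<lambda>(t, s, r). (t \<odot>\<^bsub>P\<^esub> s) \<odot>\<^bsub>P\<^esub> r), ar = (\<lambda>(c, b, a). (c \<star>\<^bsub>P\<^esub> b) \<star>\<^bsub>P\<^esub> a)\<rparr>
      \<lparr>ob = (\<lambda>(t, s, r). t \<odot>\<^bsub>P\<^esub> (s \<odot>\<^bsub>P\<^esub> r)), ar = (\<lambda>(c, b, a). c \<star>\<^bsub>P\<^esub> (b \<star>\<^bsub>P\<^esub> a))\<rparr>
      (associator P)"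
    unfolding nat_iso_def
  proof (intro conjI ballI nat_transI)
    fix \<Gamma> assume "\<Gamma> \<in> Arr (composable_triples P)"
    then obtain c b a where "\<Gamma> = (c, b, a)" "c \<in> M" "b \<in> M" "a \<in> M" "md_dom c = md_cod b"
      "md_dom b = md_cod a"
      by (auto simp: composable_triples_def)
    then show "Cmp (cat1 P) (associator P (Trg (composable_triples P) \<Gamma>))
        (ar \<lparr>ob = (\<lambda>(t, s, r). (t \<odot>\<^bsub>P\<^esub> s) \<odot>\<^bsub>P\<^esub> r), ar = (\<lambda>(c, b, a). (c \<star>\<^bsub>P\<^esub> b) \<star>\<^bsub>P\<^esub> a)\<rparr> \<Gamma>)
      = Cmp (cat1 P) (ar \<lparr>ob = (\<lambda>(t, s, r). t \<odot>\<^bsub>P\<^esub> (s \<odot>\<^bsub>P\<^esub> r)), ar = (\<lambda>(c, b, a). c \<star>\<^bsub>P\<^esub> (b \<star>\<^bsub>P\<^esub> a))\<rparr> \<Gamma>)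
        (associator P (Src (composable_triples P) \<Gamma>))"
      using associator_P_natural[of c b a] by (simp add: composable_triples_def)
  qed (auto simp: composable_triples_def iso_constraints)
  show "globular P (lunitor P \<phi>)" "globular P (runitor P \<phi>)" if "\<phi> \<in> Obj (cat1 P)" for \<phi>
    using that by (auto simp: globular_def)
  show "globular P (associator P (\<chi>, \<psi>, \<phi>))" if "(\<chi>, \<psi>, \<phi>) \<in> Obj (composable_triples P)" for \<chi> \<psi> \<phi>
    using that by (auto simp: globular_def composable_triples_def)
  show "(vid2 P \<psi> \<star>\<^bsub>P\<^esub> lunitor P \<phi>) \<bullet>\<^bsub>P\<^esub> associator P (\<psi>, ob (hunit P) (ob (hcod P) \<phi>), \<phi>)
      = runitor P \<psi> \<star>\<^bsub>P\<^esub> vid2 P \<phi>" if "(\<psi>, \<phi>) \<in> Obj (composable_pairs P)" for \<psi> \<phi>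
  proof (rule M_eqI)
    have "\<psi> \<in> T" "\<phi> \<in> T" "ht_dom \<psi> = ht_cod \<phi>" using that by (auto simp: composable_pairs_def)
    then show "md_c ((vid2 P \<psi> \<star>\<^bsub>P\<^esub> lunitor P \<phi>)
        \<bullet>\<^bsub>P\<^esub> associator P (\<psi>, ob (hunit P) (ob (hcod P) \<phi>), \<phi>)) x
        = md_c (runitor P \<psi> \<star>\<^bsub>P\<^esub> vid2 P \<phi>) x" if "x \<in> Obj (cat0 D)" for x
      using that E.triangle'[of "ob (ht_fun \<psi>) x" "ob (ht_fun \<phi>) x"] by simp
  qed (use that in \<open>auto simp: composable_pairs_def\<close>)
  show "associator P (\<upsilon>, \<chi>, \<psi> \<odot>\<^bsub>P\<^esub> \<phi>) \<bullet>\<^bsub>P\<^esub> associator P (\<upsilon> \<odot>\<^bsub>P\<^esub> \<chi>, \<psi>, \<phi>)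
      = (vid2 P \<upsilon> \<star>\<^bsub>P\<^esub> associator P (\<chi>, \<psi>, \<phi>)) \<bullet>\<^bsub>P\<^esub> associator P (\<upsilon>, \<chi> \<odot>\<^bsub>P\<^esub> \<psi>, \<phi>)
        \<bullet>\<^bsub>P\<^esub> (associator P (\<upsilon>, \<chi>, \<psi>) \<star>\<^bsub>P\<^esub> vid2 P \<phi>)" (is "?L = ?R")
    if "(\<upsilon>, \<chi>, \<psi>) \<in> Obj (composable_triples P)" "(\<psi>, \<phi>) \<in> Obj (composable_pairs P)" for \<upsilon> \<chi> \<psi> \<phi>
  proof (rule M_eqI)
    have *: "\<upsilon> \<in> T" "\<chi> \<in> T" "\<psi> \<in> T" "\<phi> \<in> T" "ht_dom \<upsilon> = ht_cod \<chi>" "ht_dom \<chi> = ht_cod \<psi>"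
      "ht_dom \<psi> = ht_cod \<phi>"
      using that by (auto simp: composable_pairs_def composable_triples_def)
    show "?L \<in> M" "?R \<in> M" "md_src ?L = md_src ?R" "md_trg ?L = md_trg ?R"
      "md_dom ?L = md_dom ?R" "md_cod ?L = md_cod ?R"
      using * by simp_all
    show "md_c ?L x = md_c ?R x" if "x \<in> Obj (cat0 D)" for x
      using * that E.pentagon'[of "ob (ht_fun \<upsilon>) x" "ob (ht_fun \<chi>) x" "ob (ht_fun \<psi>) x"
        "ob (ht_fun \<phi>) x"] by simp
  qed
qed

end

section \<open>Naturality of composite constraints\<close>

context pseudodouble_category
begin

text \<open>One statement for two purposes. If \<open>a\<close>, \<open>c\<close>, \<open>e\<close>
  are the images of a 2-cell under three lax functors, it is naturality of the composite constraint;
  if they are components of vertical transformations, it is compatibility of a horizontal composite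
  of modifications.\<close>

lemma composite_constraint_natural:
  assumes "hr Fr f0 f1" "hr Gr g0 g1" "hr Hr h0 h1" "hr \<phi>0 f0 g0" "hr \<phi>1 f1 g1" "hr \<psi>0 g0 h0" "hr \<psi>1 g1 h1"
    and "hr Fr' f0' f1'" "hr Gr' g0' g1'" "hr Hr' h0' h1'" "hr \<phi>0' f0' g0'" "hr \<phi>1' f1' g1'"
      "hr \<psi>0' g0' h0'" "hr \<psi>1' g1' h1'"
    and n: "gl p (Gr \<boxtimes> \<phi>0) (\<phi>1 \<boxtimes> Fr) f0 g1" "gl q (Hr \<boxtimes> \<psi>0) (\<psi>1 \<boxtimes> Gr) g0 h1"
    and n': "gl p' (Gr' \<boxtimes> \<phi>0') (\<phi>1' \<boxtimes> Fr') f0' g1'" "gl q' (Hr' \<boxtimes> \<psi>0') (\<psi>1' \<boxtimes> Gr') g0' h1'"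
    and a: "cell a" "src a = Fr" "trg a = Fr'" and c: "cell c" "src c = Gr" "trg c = Gr'"
    and e: "cell e" "src e = Hr" "trg e = Hr'"
    and b0: "cell b0" "src b0 = \<phi>0" "trg b0 = \<phi>0'" and b1: "cell b1" "src b1 = \<phi>1" "trg b1 = \<phi>1'"
    and d0: "cell d0" "src d0 = \<psi>0" "trg d0 = \<psi>0'" and d1: "cell d1" "src d1 = \<psi>1" "trg d1 = \<psi>1'"
    and m: "dm b0 = dm a" "cd b0 = dm c" "dm b1 = cd a" "cd b1 = cd c" "dm d0 = dm c" "cd d0 = dm e"
      "dm d1 = cd c" "cd d1 = cd e"
    and p: "p' \<cdot> (c \<otimes> b0) = (b1 \<otimes> a) \<cdot> p"
    and q: "q' \<cdot> (e \<otimes> d0) = (d1 \<otimes> c) \<cdot> q"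
  shows "(inv2 (asc \<psi>1' \<phi>1' Fr') \<cdot> (idh \<psi>1' \<otimes> p') \<cdot> asc \<psi>1' Gr' \<phi>0' \<cdot> (q' \<otimes> idh \<phi>0')
      \<cdot> inv2 (asc Hr' \<psi>0' \<phi>0')) \<cdot> (e \<otimes> d0 \<otimes> b0)
    = ((d1 \<otimes> b1) \<otimes> a) \<cdot> inv2 (asc \<psi>1 \<phi>1 Fr) \<cdot> (idh \<psi>1 \<otimes> p) \<cdot> asc \<psi>1 Gr \<phi>0 \<cdot> (q \<otimes> idh \<phi>0)
      \<cdot> inv2 (asc Hr \<psi>0 \<phi>0)"
proof -
  have [simp]: "f0 \<in> Obj (cat0 D)" "g0 \<in> Obj (cat0 D)" "h0 \<in> Obj (cat0 D)" "f1 \<in> Obj (cat0 D)"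
    "g1 \<in> Obj (cat0 D)" "h1 \<in> Obj (cat0 D)"
    "f0' \<in> Obj (cat0 D)" "g0' \<in> Obj (cat0 D)" "h0' \<in> Obj (cat0 D)" "f1' \<in> Obj (cat0 D)"
    "g1' \<in> Obj (cat0 D)" "h1' \<in> Obj (cat0 D)"
    using assms(1-14) hor_bound by blast+
  note [simp] = assms(1-14) n n' a c e b0 b1 d0 d1 m
  have bb [simp]: "Src (cat0 D) (cd c) = g1" "Trg (cat0 D) (cd c) = g1'" "Src (cat0 D) (dm a) = f0"
    "Trg (cat0 D) (dm a) = f0'" "Src (cat0 D) (cd e) = h1" "Trg (cat0 D) (cd e) = h1'"
    by simp_all
  \<comment> \<open>Five squares, one for each factor of the composite constraint, beginning with
    the factor that is applied first.\<close>
  have 1: "inv2 (asc Hr' \<psi>0' \<phi>0') \<cdot> (e \<otimes> d0 \<otimes> b0) = ((e \<otimes> d0) \<otimes> b0) \<cdot> inv2 (asc Hr \<psi>0 \<phi>0)"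
    using inv_asc_natural[of e d0 b0] by simp
  have 2: "(q' \<otimes> idh \<phi>0') \<cdot> ((e \<otimes> d0) \<otimes> b0) = ((d1 \<otimes> c) \<otimes> b0) \<cdot> (q \<otimes> idh \<phi>0)"
    by (simp add: interchange q)
  have 3: "asc \<psi>1' Gr' \<phi>0' \<cdot> ((d1 \<otimes> c) \<otimes> b0) = (d1 \<otimes> c \<otimes> b0) \<cdot> asc \<psi>1 Gr \<phi>0"
    using associator_natural[of d1 c b0] by simp
  have 4: "(idh \<psi>1' \<otimes> p') \<cdot> (d1 \<otimes> c \<otimes> b0) = (d1 \<otimes> b1 \<otimes> a) \<cdot> (idh \<psi>1 \<otimes> p)"
    by (simp add: interchange p)
  have 5: "inv2 (asc \<psi>1' \<phi>1' Fr') \<cdot> (d1 \<otimes> b1 \<otimes> a) = ((d1 \<otimes> b1) \<otimes> a) \<cdot> inv2 (asc \<psi>1 \<phi>1 Fr)"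
    using inv_asc_natural[of d1 b1 a] by simp
  show ?thesis
    by (simp add: H.cmp_assoc_arr 1 2[THEN H.cmp_reassoc] 3[THEN H.cmp_reassoc]
        4[THEN H.cmp_reassoc] 5[THEN H.cmp_reassoc])
qed

end

text \<open>The constraint axiom of \<open>lax_modification\<close> on its own, so that it can serve
  as the parameter \<open>K\<close> of \<open>transformation_structure\<close>.\<close>

definition lax_compat where
  "lax_compat D E \<Gamma> \<longleftrightarrow> (\<forall>r\<in>Obj (cat1 D).
    (md_c \<Gamma> (ob (hcod D) r) \<star>\<^bsub>E\<^esub> vt1 (md_dom \<Gamma>) r) \<bullet>\<^bsub>E\<^esub> ht_n (md_src \<Gamma>) r
      = ht_n (md_trg \<Gamma>) r \<bullet>\<^bsub>E\<^esub> (vt1 (md_cod \<Gamma>) r \<star>\<^bsub>E\<^esub> md_c \<Gamma> (ob (hdom D) r)))"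

section \<open>Lax transformations form a pseudodouble category\<close>

context pseudodouble_pair
begin

lemma lax_transformation_ht [simp]:
  "lax_transformation D E \<phi> \<Longrightarrow> horizontal_transformation D E \<phi>"
  by (simp add: lax_transformation_def)

lemma lax_transformation_n [simp]:
  assumes "lax_transformation D E \<phi>" "D.hor r"
  shows "ht_n \<phi> r \<in> Arr (cat1 E)"
    and "E.src (ht_n \<phi> r) = ob (lf1 (ht_cod \<phi>)) r \<boxtimes>\<^sub>E ob (ht_fun \<phi>) (D.od r)"
    and "E.trg (ht_n \<phi> r) = ob (ht_fun \<phi>) (D.oc r) \<boxtimes>\<^sub>E ob (lf1 (ht_dom \<phi>)) r"
    and "E.dm (ht_n \<phi> r) = Idt (cat0 E) (ob (lf0 (ht_dom \<phi>)) (D.od r))"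
    and "E.cd (ht_n \<phi> r) = Idt (cat0 E) (ob (lf0 (ht_cod \<phi>)) (D.oc r))"
proof -
  show *: "ht_n \<phi> r \<in> Arr (cat1 E)"
    "E.src (ht_n \<phi> r) = ob (lf1 (ht_cod \<phi>)) r \<boxtimes>\<^sub>E ob (ht_fun \<phi>) (D.od r)"
    "E.trg (ht_n \<phi> r) = ob (ht_fun \<phi>) (D.oc r) \<boxtimes>\<^sub>E ob (lf1 (ht_dom \<phi>)) r"
    using nat_trans.component_arr[OF lax_transformation.n_natural[OF assms(1)] assms(2)]
    by (simp_all add: hcomp_fctr_def fcomp_def pair_fctr_def)
  show "E.dm (ht_n \<phi> r) = Idt (cat0 E) (ob (lf0 (ht_dom \<phi>)) (D.od r))"
    "E.cd (ht_n \<phi> r) = Idt (cat0 E) (ob (lf0 (ht_cod \<phi>)) (D.oc r))"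
    using E.globularD(2,4)[OF horizontal_transformation.n_globular[OF lax_transformation_ht[OF assms(1)] assms(2)]]
      * assms by simp_all
qed

lemma lax_transformation_natural:
  assumes "lax_transformation D E \<phi>" "D.cell a"
  shows "ht_n \<phi> (D.trg a) \<cdot>\<^sub>E (ar (lf1 (ht_cod \<phi>)) a \<otimes>\<^sub>E ar (ht_fun \<phi>) (D.dm a))
    = (ar (ht_fun \<phi>) (D.cd a) \<otimes>\<^sub>E ar (lf1 (ht_dom \<phi>)) a) \<cdot>\<^sub>E ht_n \<phi> (D.src a)"
  using nat_trans.natural_arr[OF lax_transformation.n_natural[OF assms(1)] assms(2)]
  by (simp add: hcomp_fctr_def fcomp_def pair_fctr_def)

lemma lax_transformationI:
  assumes "horizontal_transformation D E \<phi>"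
    and "\<And>r. r \<in> Obj (cat1 D) \<Longrightarrow> ht_n \<phi> r \<in> Arr (cat1 E) \<and>
      E.src (ht_n \<phi> r) = ob (lf1 (ht_cod \<phi>)) r \<boxtimes>\<^sub>E ob (ht_fun \<phi>) (D.od r) \<and>
      E.trg (ht_n \<phi> r) = ob (ht_fun \<phi>) (D.oc r) \<boxtimes>\<^sub>E ob (lf1 (ht_dom \<phi>)) r"
    and "\<And>a. a \<in> Arr (cat1 D) \<Longrightarrow>
      ht_n \<phi> (D.trg a) \<cdot>\<^sub>E (ar (lf1 (ht_cod \<phi>)) a \<otimes>\<^sub>E ar (ht_fun \<phi>) (D.dm a))
      = (ar (ht_fun \<phi>) (D.cd a) \<otimes>\<^sub>E ar (lf1 (ht_dom \<phi>)) a) \<cdot>\<^sub>E ht_n \<phi> (D.src a)"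
    and "\<And>x. x \<in> Obj (cat0 D) \<Longrightarrow>
      ht_n \<phi> (D.one x) \<cdot>\<^sub>E (lf_e (ht_cod \<phi>) x \<otimes>\<^sub>E E.idh (ob (ht_fun \<phi>) x))
      = (E.idh (ob (ht_fun \<phi>) x) \<otimes>\<^sub>E lf_e (ht_dom \<phi>) x) \<cdot>\<^sub>E gamma E (ob (ht_fun \<phi>) x)"
    and "\<And>s r \<phi>x \<phi>y \<phi>z Fr Fs Gr Gs. \<lbrakk>s \<in> Obj (cat1 D); D.hor r; D.od s = D.oc r;
        \<phi>x = ob (ht_fun \<phi>) (D.od r); \<phi>y = ob (ht_fun \<phi>) (D.oc r);
        \<phi>z = ob (ht_fun \<phi>) (D.oc s);
        Fr = ob (lf1 (ht_dom \<phi>)) r; Fs = ob (lf1 (ht_dom \<phi>)) s;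
        Gr = ob (lf1 (ht_cod \<phi>)) r; Gs = ob (lf1 (ht_cod \<phi>)) s\<rbrakk> \<Longrightarrow>
      ht_n \<phi> (s \<odot>\<^bsub>D\<^esub> r) \<cdot>\<^sub>E (lf_m (ht_cod \<phi>) (s, r) \<otimes>\<^sub>E E.idh \<phi>x)
      = (E.idh \<phi>z \<otimes>\<^sub>E lf_m (ht_dom \<phi>) (s, r)) \<cdot>\<^sub>E associator E (\<phi>z, Fs, Fr)
        \<cdot>\<^sub>E (ht_n \<phi> s \<otimes>\<^sub>E E.idh Fr) \<cdot>\<^sub>E E.inv2 (associator E (Gs, \<phi>y, Fr))
        \<cdot>\<^sub>E (E.idh Gs \<otimes>\<^sub>E ht_n \<phi> r) \<cdot>\<^sub>E associator E (Gs, Gr, \<phi>x)"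
  shows "lax_transformation D E \<phi>"
proof (intro lax_transformation.intro lax_transformation_axioms.intro)
  show "nat_trans (cat1 D) (cat1 E)
      (hcomp_fctr E (lf1 (ht_cod \<phi>)) (fcomp (ht_fun \<phi>) (hdom D)))
      (hcomp_fctr E (fcomp (ht_fun \<phi>) (hcod D)) (lf1 (ht_dom \<phi>))) (ht_n \<phi>)"
    by (rule nat_transI) (use assms(2,3) in \<open>simp_all add: hcomp_fctr_def fcomp_def pair_fctr_def\<close>)
qed (use assms(1,4,5) in simp_all)

text \<open>The three laws are naturality of the inverse swap at images of 2-cells,
  \<open>unit_constraint_unit\<close> at \<open>lf_e\<close>, and
  \<open>unit_constraint_comp\<close> at \<open>lf_m\<close>.\<close>

lemma lax_unit_transformation:
  assumes F: "lax_functor D E F"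
  shows "lax_transformation D E (trans_unit D E (lax_unit_n E) F)"
proof (rule lax_transformationI)
  let ?u = "trans_unit D E (lax_unit_n E) F"
  have g: "globular E (E.inv2 (gamma E (ob (lf1 F) r)))" if "D.hor r" for r
    using that F by (intro E.globularI[where x = "ob (lf0 F) (D.od r)"
      and y = "ob (lf0 F) (D.oc r)"]) simp_all
  then show "horizontal_transformation D E ?u"
    using F by (intro horizontal_transformation_unit) (simp_all add: lax_unit_n_def)
  show "ht_n ?u (D.trg a)
      \<cdot>\<^sub>E (ar (lf1 (ht_cod ?u)) a
        \<otimes>\<^sub>E ar (ht_fun ?u) (D.dm a))
      = (ar (ht_fun ?u) (D.cd a)
        \<otimes>\<^sub>E ar (lf1 (ht_dom ?u)) a)
      \<cdot>\<^sub>E ht_n ?u (D.src a)" if "D.cell a" for a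
    using that F E.inv_gamma_natural[of "ar (lf1 F) a"] by (simp add: lax_unit_n_def)
  show "ht_n ?u (D.one x)
      \<cdot>\<^sub>E (lf_e (ht_cod ?u) x
        \<otimes>\<^sub>E E.idh (ob (ht_fun ?u) x))
      = (E.idh (ob (ht_fun ?u) x)
        \<otimes>\<^sub>E lf_e (ht_dom ?u) x)
      \<cdot>\<^sub>E gamma E (ob (ht_fun ?u) x)"
    if "x \<in> Obj (cat0 D)" for x
    using that F E.unit_constraint_unit[of "ob (lf0 F) x" "ob (lf1 F) (D.one x)" "lf_e F x"]
    by (simp add: lax_unit_n_def)
  fix s r \<phi>x \<phi>y \<phi>z Fr Fs Gr Gs
  assume "D.hor s" "D.hor r" "D.od s = D.oc r"
    and [simp]: "\<phi>x = ob (ht_fun ?u) (D.od r)"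
      "\<phi>y = ob (ht_fun ?u) (D.oc r)"
      "\<phi>z = ob (ht_fun ?u) (D.oc s)"
      "Fr = ob (lf1 (ht_dom ?u)) r"
      "Fs = ob (lf1 (ht_dom ?u)) s"
      "Gr = ob (lf1 (ht_cod ?u)) r"
      "Gs = ob (lf1 (ht_cod ?u)) s"
  then show "ht_n ?u (s \<odot>\<^bsub>D\<^esub> r)
        \<cdot>\<^sub>E (lf_m (ht_cod ?u) (s, r) \<otimes>\<^sub>E E.idh \<phi>x)
      = (E.idh \<phi>z \<otimes>\<^sub>E lf_m (ht_dom ?u) (s, r))
        \<cdot>\<^sub>E associator E (\<phi>z, Fs, Fr)
        \<cdot>\<^sub>E (ht_n ?u s \<otimes>\<^sub>E E.idh Fr)
        \<cdot>\<^sub>E E.inv2 (associator E (Gs, \<phi>y, Fr))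
        \<cdot>\<^sub>E (E.idh Gs \<otimes>\<^sub>E ht_n ?u r)
        \<cdot>\<^sub>E associator E (Gs, Gr, \<phi>x)"
    using F E.unit_constraint_comp[of "ob (lf1 F) s" "ob (lf0 F) (D.od s)"
        "ob (lf0 F) (D.oc s)" "ob (lf1 F) r" "ob (lf0 F) (D.od r)"
        "ob (lf1 F) (s \<odot>\<^bsub>D\<^esub> r)" "lf_m F (s, r)"]
    by (simp add: lax_unit_n_def)
qed (use F in \<open>simp_all add: lax_unit_n_def\<close>)

lemma lax_comp_n_cell:
  assumes "lax_transformation D E \<phi>" "lax_transformation D E \<psi>" "ht_dom \<psi> = ht_cod \<phi>"
    and "D.hor r"
  shows "lax_comp_n D E \<psi> \<phi> r \<in> Arr (cat1 E)"
    and "E.src (lax_comp_n D E \<psi> \<phi> r)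
      = ob (lf1 (ht_cod \<psi>)) r \<boxtimes>\<^sub>E ob (ht_fun \<psi>) (D.od r) \<boxtimes>\<^sub>E ob (ht_fun \<phi>) (D.od r)"
    and "E.trg (lax_comp_n D E \<psi> \<phi> r)
      = (ob (ht_fun \<psi>) (D.oc r) \<boxtimes>\<^sub>E ob (ht_fun \<phi>) (D.oc r)) \<boxtimes>\<^sub>E ob (lf1 (ht_dom \<phi>)) r"
    and "E.dm (lax_comp_n D E \<psi> \<phi> r) = Idt (cat0 E) (ob (lf0 (ht_dom \<phi>)) (D.od r))"
    and "E.cd (lax_comp_n D E \<psi> \<phi> r) = Idt (cat0 E) (ob (lf0 (ht_cod \<psi>)) (D.oc r))"
  using assms by (simp_all add: lax_comp_n_def Let_def)

lemma lax_comp_transformation: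
  assumes p: "lax_transformation D E \<phi>" and q: "lax_transformation D E \<psi>"
    and pq: "ht_dom \<psi> = ht_cod \<phi>"
  shows "lax_transformation D E (trans_comp D E (lax_comp_n D E) \<psi> \<phi>)"
proof (rule lax_transformationI)
  let ?c = "trans_comp D E (lax_comp_n D E) \<psi> \<phi>"
  note n = lax_comp_n_cell[OF p q pq]
  note [simp] = p q pq
  have "globular E (lax_comp_n D E \<psi> \<phi> r)" if "D.hor r" for r
    using that by (intro E.globularI[where x = "ob (lf0 (ht_dom \<phi>)) (D.od r)"
      and y = "ob (lf0 (ht_cod \<psi>)) (D.oc r)"]) (simp_all add: n)
  then show "horizontal_transformation D E ?c"
    by (intro horizontal_transformation_comp) simp_all
  show "ht_n ?c (D.trg a) \<cdot>\<^sub>E (ar (lf1 (ht_cod ?c)) a \<otimes>\<^sub>E ar (ht_fun ?c) (D.dm a))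
      = (ar (ht_fun ?c) (D.cd a) \<otimes>\<^sub>E ar (lf1 (ht_dom ?c)) a) \<cdot>\<^sub>E ht_n ?c (D.src a)"
    if a: "D.cell a" for a
    \<comment> \<open>The 0-cells that bound the squares occur only in the premises of the
      instantiated lemma and not in its conclusion, so they have to be named.\<close>
    using a lax_transformation_natural[OF p a] lax_transformation_natural[OF q a]
      E.composite_constraint_natural[
        where ?f0.0 = "ob (lf0 (ht_dom \<phi>)) (D.od (D.src a))"
          and ?f1.0 = "ob (lf0 (ht_dom \<phi>)) (D.oc (D.src a))"
          and ?g0.0 = "ob (lf0 (ht_cod \<phi>)) (D.od (D.src a))"
          and ?g1.0 = "ob (lf0 (ht_cod \<phi>)) (D.oc (D.src a))"
          and ?h0.0 = "ob (lf0 (ht_cod \<psi>)) (D.od (D.src a))"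
          and ?h1.0 = "ob (lf0 (ht_cod \<psi>)) (D.oc (D.src a))"
          and Fr = "ob (lf1 (ht_dom \<phi>)) (D.src a)"
          and Gr = "ob (lf1 (ht_cod \<phi>)) (D.src a)"
          and Hr = "ob (lf1 (ht_cod \<psi>)) (D.src a)"
          and ?\<phi>0.0 = "ob (ht_fun \<phi>) (D.od (D.src a))"
          and ?\<phi>1.0 = "ob (ht_fun \<phi>) (D.oc (D.src a))"
          and ?\<psi>0.0 = "ob (ht_fun \<psi>) (D.od (D.src a))"
          and ?\<psi>1.0 = "ob (ht_fun \<psi>) (D.oc (D.src a))"
          and f0' = "ob (lf0 (ht_dom \<phi>)) (D.od (D.trg a))"
          and f1' = "ob (lf0 (ht_dom \<phi>)) (D.oc (D.trg a))"
          and g0' = "ob (lf0 (ht_cod \<phi>)) (D.od (D.trg a))"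
          and g1' = "ob (lf0 (ht_cod \<phi>)) (D.oc (D.trg a))"
          and h0' = "ob (lf0 (ht_cod \<psi>)) (D.od (D.trg a))"
          and h1' = "ob (lf0 (ht_cod \<psi>)) (D.oc (D.trg a))"
          and Fr' = "ob (lf1 (ht_dom \<phi>)) (D.trg a)"
          and Gr' = "ob (lf1 (ht_cod \<phi>)) (D.trg a)"
          and Hr' = "ob (lf1 (ht_cod \<psi>)) (D.trg a)"
          and \<phi>0' = "ob (ht_fun \<phi>) (D.od (D.trg a))"
          and \<phi>1' = "ob (ht_fun \<phi>) (D.oc (D.trg a))"
          and \<psi>0' = "ob (ht_fun \<psi>) (D.od (D.trg a))"
          and \<psi>1' = "ob (ht_fun \<psi>) (D.oc (D.trg a))"
          and p = "ht_n \<phi> (D.src a)" and q = "ht_n \<psi> (D.src a)"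
          and p' = "ht_n \<phi> (D.trg a)" and q' = "ht_n \<psi> (D.trg a)"
          and a = "ar (lf1 (ht_dom \<phi>)) a" and c = "ar (lf1 (ht_cod \<phi>)) a"
          and e = "ar (lf1 (ht_cod \<psi>)) a" and ?b0.0 = "ar (ht_fun \<phi>) (D.dm a)"
          and ?b1.0 = "ar (ht_fun \<phi>) (D.cd a)"
          and ?d0.0 = "ar (ht_fun \<psi>) (D.dm a)"
          and ?d1.0 = "ar (ht_fun \<psi>) (D.cd a)"]
    by (simp add: lax_comp_n_def Let_def)
  show "ht_n ?c (D.one x) \<cdot>\<^sub>E (lf_e (ht_cod ?c) x \<otimes>\<^sub>E E.idh (ob (ht_fun ?c) x))
      = (E.idh (ob (ht_fun ?c) x) \<otimes>\<^sub>E lf_e (ht_dom ?c) x) \<cdot>\<^sub>E gamma E (ob (ht_fun ?c) x)"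
    if x: "x \<in> Obj (cat0 D)" for x
    using x lax_transformation.n_unit[OF p x] lax_transformation.n_unit[OF q x]
      E.composite_constraint_unit[
        where f = "ob (lf0 (ht_dom \<phi>)) x" and g = "ob (lf0 (ht_cod \<phi>)) x"
          and h = "ob (lf0 (ht_cod \<psi>)) x" and x = "ob (lf0 (ht_dom \<phi>)) x"
          and \<phi> = "ob (ht_fun \<phi>) x" and \<psi> = "ob (ht_fun \<psi>) x"
          and eF = "lf_e (ht_dom \<phi>) x" and eG = "lf_e (ht_cod \<phi>) x"
          and eH = "lf_e (ht_cod \<psi>) x" and Ff = "ob (lf1 (ht_dom \<phi>)) (D.one x)"
          and Gg = "ob (lf1 (ht_cod \<phi>)) (D.one x)"
          and Hh = "ob (lf1 (ht_cod \<psi>)) (D.one x)"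
          and p = "ht_n \<phi> (D.one x)" and q = "ht_n \<psi> (D.one x)"]
    by (simp add: lax_comp_n_def Let_def)
  fix s r \<phi>x \<phi>y \<phi>z Fr Fs Gr Gs
  assume sr: "D.hor s" "D.hor r" "D.od s = D.oc r"
    and [simp]: "\<phi>x = ob (ht_fun ?c) (D.od r)" "\<phi>y = ob (ht_fun ?c) (D.oc r)"
      "\<phi>z = ob (ht_fun ?c) (D.oc s)" "Fr = ob (lf1 (ht_dom ?c)) r"
      "Fs = ob (lf1 (ht_dom ?c)) s" "Gr = ob (lf1 (ht_cod ?c)) r" "Gs = ob (lf1 (ht_cod ?c)) s"
  have sr': "(s, r) \<in> Obj (composable_pairs D)" using sr by simp
  show "ht_n ?c (s \<odot>\<^bsub>D\<^esub> r) \<cdot>\<^sub>E (lf_m (ht_cod ?c) (s, r) \<otimes>\<^sub>E E.idh \<phi>x)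
      = (E.idh \<phi>z \<otimes>\<^sub>E lf_m (ht_dom ?c) (s, r)) \<cdot>\<^sub>E associator E (\<phi>z, Fs, Fr)
        \<cdot>\<^sub>E (ht_n ?c s \<otimes>\<^sub>E E.idh Fr) \<cdot>\<^sub>E E.inv2 (associator E (Gs, \<phi>y, Fr))
        \<cdot>\<^sub>E (E.idh Gs \<otimes>\<^sub>E ht_n ?c r) \<cdot>\<^sub>E associator E (Gs, Gr, \<phi>x)"
    using sr lax_transformation.n_comp[OF p sr' refl refl refl refl refl refl refl]
      lax_transformation.n_comp[OF q sr' refl refl refl refl refl refl refl]
      E.composite_constraint_comp[
        where ?f0.0 = "ob (lf0 (ht_dom \<phi>)) (D.od r)"
          and ?f1.0 = "ob (lf0 (ht_dom \<phi>)) (D.oc r)"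
          and ?f2.0 = "ob (lf0 (ht_dom \<phi>)) (D.oc s)"
          and ?g0.0 = "ob (lf0 (ht_cod \<phi>)) (D.od r)"
          and ?g1.0 = "ob (lf0 (ht_cod \<phi>)) (D.oc r)"
          and ?g2.0 = "ob (lf0 (ht_cod \<phi>)) (D.oc s)"
          and ?h0.0 = "ob (lf0 (ht_cod \<psi>)) (D.od r)"
          and ?h1.0 = "ob (lf0 (ht_cod \<psi>)) (D.oc r)"
          and ?h2.0 = "ob (lf0 (ht_cod \<psi>)) (D.oc s)"
          and Fr = "ob (lf1 (ht_dom \<phi>)) r" and Fs = "ob (lf1 (ht_dom \<phi>)) s"
          and Fsr = "ob (lf1 (ht_dom \<phi>)) (s \<odot>\<^bsub>D\<^esub> r)"
          and mF = "lf_m (ht_dom \<phi>) (s, r)" and Gr = "ob (lf1 (ht_cod \<phi>)) r"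
          and Gs = "ob (lf1 (ht_cod \<phi>)) s"
          and Gsr = "ob (lf1 (ht_cod \<phi>)) (s \<odot>\<^bsub>D\<^esub> r)"
          and mG = "lf_m (ht_cod \<phi>) (s, r)" and Hr = "ob (lf1 (ht_cod \<psi>)) r"
          and Hs = "ob (lf1 (ht_cod \<psi>)) s"
          and Hsr = "ob (lf1 (ht_cod \<psi>)) (s \<odot>\<^bsub>D\<^esub> r)"
          and mH = "lf_m (ht_cod \<psi>) (s, r)"
          and ?\<phi>0.0 = "ob (ht_fun \<phi>) (D.od r)"
          and ?\<phi>1.0 = "ob (ht_fun \<phi>) (D.oc r)"
          and ?\<phi>2.0 = "ob (ht_fun \<phi>) (D.oc s)"
          and ?\<psi>0.0 = "ob (ht_fun \<psi>) (D.od r)"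
          and ?\<psi>1.0 = "ob (ht_fun \<psi>) (D.oc r)"
          and ?\<psi>2.0 = "ob (ht_fun \<psi>) (D.oc s)" and p = "ht_n \<phi> r"
          and p' = "ht_n \<phi> s" and p'' = "ht_n \<phi> (s \<odot>\<^bsub>D\<^esub> r)"
          and q = "ht_n \<psi> r" and q' = "ht_n \<psi> s"
          and q'' = "ht_n \<psi> (s \<odot>\<^bsub>D\<^esub> r)"]
    by (simp add: lax_comp_n_def Let_def)
qed (use assms lax_comp_n_cell[OF assms] in simp_all)

lemma lax_modification_iff:
  "lax_modification D E \<Gamma> \<longleftrightarrow> modification D E \<Gamma> \<and> md_src \<Gamma> \<in> {\<phi>. lax_transformation D E \<phi>} \<and>
    md_trg \<Gamma> \<in> {\<phi>. lax_transformation D E \<phi>} \<and> lax_compat D E \<Gamma>"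
  by (auto simp: lax_modification_def lax_modification_axioms_def lax_compat_def)

lemma lax_compat_mk_mod:
  "lax_compat D E (mk_mod D \<zeta> \<xi> \<phi> \<psi> c) \<longleftrightarrow> (\<forall>r\<in>Obj (cat1 D).
    (c (D.oc r) \<otimes>\<^sub>E vt1 \<phi> r) \<cdot>\<^sub>E ht_n \<zeta> r = ht_n \<xi> r \<cdot>\<^sub>E (vt1 \<psi> r \<otimes>\<^sub>E c (D.od r)))"
  by (auto simp: lax_compat_def)

lemma lax_compatD:
  "\<lbrakk>lax_compat D E \<Gamma>; D.hor r\<rbrakk> \<Longrightarrow>
    (md_c \<Gamma> (D.oc r) \<otimes>\<^sub>E vt1 (md_dom \<Gamma>) r) \<cdot>\<^sub>E ht_n (md_src \<Gamma>) r
      = ht_n (md_trg \<Gamma>) r \<cdot>\<^sub>E (vt1 (md_cod \<Gamma>) r \<otimes>\<^sub>E md_c \<Gamma> (D.od r))"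
  by (simp add: lax_compat_def)

lemma lax_compat_cmp:
  assumes G: "modification D E \<Gamma>" "lax_transformation D E (md_src \<Gamma>)" "lax_transformation D E (md_trg \<Gamma>)"
      "lax_compat D E \<Gamma>"
    and D: "modification D E \<Delta>" "lax_transformation D E (md_src \<Delta>)" "lax_transformation D E (md_trg \<Delta>)"
      "lax_compat D E \<Delta>"
    and t: "md_trg \<Gamma> = md_src \<Delta>"
  shows "lax_compat D E (mod_cmp \<Delta> \<Gamma>)"
  unfolding lax_compat_mk_mod
proof
  fix r assume r: "D.hor r"
  let ?x = "D.od r" and ?y = "D.oc r"
  note e = lax_compatD[OF G(4) r] lax_compatD[OF D(4) r, THEN E.H.cmp_reassoc]
  have 1: "(md_c \<Delta> ?y \<cdot>\<^sub>E md_c \<Gamma> ?y) \<otimes>\<^sub>E (vt1 (md_dom \<Delta>) r \<cdot>\<^sub>E vt1 (md_dom \<Gamma>) r)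
      = (md_c \<Delta> ?y \<otimes>\<^sub>E vt1 (md_dom \<Delta>) r) \<cdot>\<^sub>E (md_c \<Gamma> ?y \<otimes>\<^sub>E vt1 (md_dom \<Gamma>) r)"
    using r G D t by (simp add: E.interchange)
  have 2: "(vt1 (md_cod \<Delta>) r \<cdot>\<^sub>E vt1 (md_cod \<Gamma>) r) \<otimes>\<^sub>E (md_c \<Delta> ?x \<cdot>\<^sub>E md_c \<Gamma> ?x)
      = (vt1 (md_cod \<Delta>) r \<otimes>\<^sub>E md_c \<Delta> ?x) \<cdot>\<^sub>E (vt1 (md_cod \<Gamma>) r \<otimes>\<^sub>E md_c \<Gamma> ?x)"
    using r G D t by (simp add: E.interchange)
  show "((md_c \<Delta> ?y \<cdot>\<^sub>E md_c \<Gamma> ?y) \<otimes>\<^sub>E vt1 (Cmp (lax_cat0 D E) (md_dom \<Delta>) (md_dom \<Gamma>)) r)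
      \<cdot>\<^sub>E ht_n (md_src \<Gamma>) r
    = ht_n (md_trg \<Delta>) r \<cdot>\<^sub>E (vt1 (Cmp (lax_cat0 D E) (md_cod \<Delta>) (md_cod \<Gamma>)) r
      \<otimes>\<^sub>E (md_c \<Delta> ?x \<cdot>\<^sub>E md_c \<Gamma> ?x))"
    using r G D t e by (simp add: 1 2 E.H.cmp_assoc_arr)
qed

text \<open>With identities as dom and cod, the components \<open>vt1\<close> are identities and the
  whiskered components of the modification are invertible. Inverting them in the compatibility
  square gives the claim.\<close>

lemma lax_compat_inv:
  assumes G: "modification D E \<Gamma>" "lax_transformation D E (md_src \<Gamma>)" "lax_transformation D E (md_trg \<Gamma>)"
      "lax_compat D E \<Gamma>"
    and d: "md_dom \<Gamma> = Idt (lax_cat0 D E) F" "md_cod \<Gamma> = Idt (lax_cat0 D E) H"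
    and iso: "\<And>x. x \<in> Obj (cat0 D) \<Longrightarrow> E.iso2 (md_c \<Gamma> x)"
  shows "lax_compat D E
    (mod_inv \<Gamma>)"
  unfolding lax_compat_mk_mod
proof
  fix r assume r: "D.hor r"
  let ?x = "D.od r" and ?y = "D.oc r"
  have F: "ht_dom (md_src \<Gamma>) = F" "ht_dom (md_trg \<Gamma>) = F" "ht_cod (md_src \<Gamma>) = H"
    "ht_cod (md_trg \<Gamma>) = H"
    using modification_cell(3-6)[OF G(1)] d by simp_all
  have l: "lax_functor D E F" "lax_functor D E H"
    using horizontal_transformation_cell(1,2)[OF lax_transformation_ht[OF G(2)]] F by auto
  have g: "globular E (md_c \<Gamma> x)" if "x \<in> Obj (cat0 D)" for x
    using that G l d by (intro E.globularI[where x = "ob (lf0 F) x" and y = "ob (lf0 H) x"]) simp_all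
  have i: "E.dm (E.inv2 (md_c \<Gamma> x)) = Idt (cat0 E) (ob (lf0 F) x)"
    "E.cd (E.inv2 (md_c \<Gamma> x)) = Idt (cat0 E) (ob (lf0 H) x)" if "x \<in> Obj (cat0 D)" for x
    using E.globular_inv[OF iso[OF that] g[OF that]] that G d by simp_all
  have w: "E.iso2 (md_c \<Gamma> ?y \<otimes>\<^sub>E E.idh (ob (lf1 F) r))"
    "E.inv2 (md_c \<Gamma> ?y \<otimes>\<^sub>E E.idh (ob (lf1 F) r)) = E.inv2 (md_c \<Gamma> ?y) \<otimes>\<^sub>E E.idh (ob (lf1 F) r)"
    "E.iso2 (E.idh (ob (lf1 H) r) \<otimes>\<^sub>E md_c \<Gamma> ?x)"
    "E.inv2 (E.idh (ob (lf1 H) r) \<otimes>\<^sub>E md_c \<Gamma> ?x) = E.idh (ob (lf1 H) r) \<otimes>\<^sub>E E.inv2 (md_c \<Gamma> ?x)"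
    using r l G d i iso by (simp_all add: E.hcomp_inverse)
  have "E.inv2 (md_c \<Gamma> ?y \<otimes>\<^sub>E E.idh (ob (lf1 F) r)) \<cdot>\<^sub>E ht_n (md_trg \<Gamma>) r
      = ht_n (md_src \<Gamma>) r \<cdot>\<^sub>E E.inv2 (E.idh (ob (lf1 H) r) \<otimes>\<^sub>E md_c \<Gamma> ?x)"
    by (rule E.H.inv_commute)
      (use lax_compatD[OF G(4) r, symmetric] r G F l w(1,3) in \<open>simp_all add: d\<close>)
  then show "(E.inv2 (md_c \<Gamma> ?y) \<otimes>\<^sub>E vt1 (md_dom \<Gamma>) r) \<cdot>\<^sub>E ht_n (md_trg \<Gamma>) r
      = ht_n (md_src \<Gamma>) r \<cdot>\<^sub>E (vt1 (md_cod \<Gamma>) r \<otimes>\<^sub>E E.inv2 (md_c \<Gamma> ?x))"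
    using r by (simp add: d w)
qed

text \<open>This is naturality of the inverse swap at the component
  \<open>vt1 \<tau> r\<close>.\<close>

lemma lax_compat_unit:
  assumes "vertical_transformation D E \<tau>"
  shows "lax_compat D E (mod_unit (lax_unit_n E) \<tau>)"
  unfolding lax_compat_mk_mod
proof
  fix r assume "D.hor r"
  then show "(E.one1 (vt0 \<tau> (D.oc r)) \<otimes>\<^sub>E vt1 \<tau> r)
      \<cdot>\<^sub>E ht_n (trans_unit D E (lax_unit_n E) (vt_src \<tau>)) r
    = ht_n (trans_unit D E (lax_unit_n E) (vt_trg \<tau>)) r
      \<cdot>\<^sub>E (vt1 \<tau> r \<otimes>\<^sub>E E.one1 (vt0 \<tau> (D.od r)))"
    using assms E.inv_gamma_natural[of "vt1 \<tau> r"] by (simp add: lax_unit_n_def)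
qed

lemma lax_compat_hcomp:
  assumes G: "modification D E \<Gamma>" "lax_transformation D E (md_src \<Gamma>)" "lax_transformation D E (md_trg \<Gamma>)"
      "lax_compat D E \<Gamma>"
    and D: "modification D E \<Delta>" "lax_transformation D E (md_src \<Delta>)" "lax_transformation D E (md_trg \<Delta>)"
      "lax_compat D E \<Delta>"
    and t: "md_dom \<Delta> = md_cod \<Gamma>"
  shows "lax_compat D E (mod_hcomp (lax_comp_n D E) \<Delta> \<Gamma>)"
  unfolding lax_compat_mk_mod
proof
  fix r assume r: "D.hor r"
  have h: "ht_dom (md_src \<Delta>) = ht_cod (md_src \<Gamma>)" "ht_dom (md_trg \<Delta>) = ht_cod (md_trg \<Gamma>)"
    using modification_cell(3-6)[OF G(1)] modification_cell(3-6)[OF D(1)] t by simp_all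
  show "((md_c \<Delta> (D.oc r) \<otimes>\<^sub>E md_c \<Gamma> (D.oc r)) \<otimes>\<^sub>E vt1 (md_dom \<Gamma>) r)
      \<cdot>\<^sub>E ht_n (trans_comp D E (lax_comp_n D E) (md_src \<Delta>) (md_src \<Gamma>)) r
    = ht_n (trans_comp D E (lax_comp_n D E) (md_trg \<Delta>) (md_trg \<Gamma>)) r
      \<cdot>\<^sub>E (vt1 (md_cod \<Delta>) r \<otimes>\<^sub>E md_c \<Delta> (D.od r) \<otimes>\<^sub>E md_c \<Gamma> (D.od r))"
    using r G(1-3) D(1-3) t h lax_compatD[OF G(4) r] lax_compatD[OF D(4) r]
      E.composite_constraint_natural[
        where ?f0.0 = "ob (lf0 (ht_dom (md_src \<Gamma>))) (D.od r)"
          and ?f1.0 = "ob (lf0 (ht_dom (md_src \<Gamma>))) (D.oc r)"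
          and ?g0.0 = "ob (lf0 (ht_cod (md_src \<Gamma>))) (D.od r)"
          and ?g1.0 = "ob (lf0 (ht_cod (md_src \<Gamma>))) (D.oc r)"
          and ?h0.0 = "ob (lf0 (ht_cod (md_src \<Delta>))) (D.od r)"
          and ?h1.0 = "ob (lf0 (ht_cod (md_src \<Delta>))) (D.oc r)"
          and Fr = "ob (lf1 (ht_dom (md_src \<Gamma>))) r"
          and Gr = "ob (lf1 (ht_cod (md_src \<Gamma>))) r"
          and Hr = "ob (lf1 (ht_cod (md_src \<Delta>))) r"
          and ?\<phi>0.0 = "ob (ht_fun (md_src \<Gamma>)) (D.od r)"
          and ?\<phi>1.0 = "ob (ht_fun (md_src \<Gamma>)) (D.oc r)"
          and ?\<psi>0.0 = "ob (ht_fun (md_src \<Delta>)) (D.od r)"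
          and ?\<psi>1.0 = "ob (ht_fun (md_src \<Delta>)) (D.oc r)"
          and p = "ht_n (md_src \<Gamma>) r" and q = "ht_n (md_src \<Delta>) r"
          and f0' = "ob (lf0 (ht_dom (md_trg \<Gamma>))) (D.od r)"
          and f1' = "ob (lf0 (ht_dom (md_trg \<Gamma>))) (D.oc r)"
          and g0' = "ob (lf0 (ht_cod (md_trg \<Gamma>))) (D.od r)"
          and g1' = "ob (lf0 (ht_cod (md_trg \<Gamma>))) (D.oc r)"
          and h0' = "ob (lf0 (ht_cod (md_trg \<Delta>))) (D.od r)"
          and h1' = "ob (lf0 (ht_cod (md_trg \<Delta>))) (D.oc r)"
          and Fr' = "ob (lf1 (ht_dom (md_trg \<Gamma>))) r"
          and Gr' = "ob (lf1 (ht_cod (md_trg \<Gamma>))) r"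
          and Hr' = "ob (lf1 (ht_cod (md_trg \<Delta>))) r"
          and \<phi>0' = "ob (ht_fun (md_trg \<Gamma>)) (D.od r)"
          and \<phi>1' = "ob (ht_fun (md_trg \<Gamma>)) (D.oc r)"
          and \<psi>0' = "ob (ht_fun (md_trg \<Delta>)) (D.od r)"
          and \<psi>1' = "ob (ht_fun (md_trg \<Delta>)) (D.oc r)"
          and p' = "ht_n (md_trg \<Gamma>) r" and q' = "ht_n (md_trg \<Delta>) r"
          and a = "vt1 (md_dom \<Gamma>) r" and c = "vt1 (md_cod \<Gamma>) r"
          and e = "vt1 (md_cod \<Delta>) r" and ?b0.0 = "md_c \<Gamma> (D.od r)"
          and ?b1.0 = "md_c \<Gamma> (D.oc r)" and ?d0.0 = "md_c \<Delta> (D.od r)"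
          and ?d1.0 = "md_c \<Delta> (D.oc r)"]
    by (simp add: lax_comp_n_def Let_def)
qed

lemma lax_compat_unitors:
  assumes "lax_transformation D E \<phi>"
  shows "lax_compat D E (mod_lunitor (lax_unit_n E) (lax_comp_n D E) \<phi>)"
    and "lax_compat D E (mod_runitor (lax_unit_n E) (lax_comp_n D E) \<phi>)"
  unfolding lax_compat_mk_mod
proof (safe)
  fix r assume r: "D.hor r"
  note * = E.composite_constraint_lunitor[of "ob (lf1 (ht_dom \<phi>)) r"
     "ob (lf0 (ht_dom \<phi>)) (D.od r)" "ob (lf0 (ht_dom \<phi>)) (D.oc r)"
     "ob (lf1 (ht_cod \<phi>)) r"
     "ob (lf0 (ht_cod \<phi>)) (D.od r)" "ob (lf0 (ht_cod \<phi>)) (D.oc r)"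
     "ob (ht_fun \<phi>) (D.od r)" "ob (ht_fun \<phi>) (D.oc r)" "ht_n \<phi> r"]
   E.composite_constraint_runitor[of "ob (lf1 (ht_dom \<phi>)) r"
     "ob (lf0 (ht_dom \<phi>)) (D.od r)" "ob (lf0 (ht_dom \<phi>)) (D.oc r)"
     "ob (lf1 (ht_cod \<phi>)) r"
     "ob (lf0 (ht_cod \<phi>)) (D.od r)" "ob (lf0 (ht_cod \<phi>)) (D.oc r)"
     "ob (ht_fun \<phi>) (D.od r)" "ob (ht_fun \<phi>) (D.oc r)" "ht_n \<phi> r"]
  show "(lunitor E (ob (ht_fun \<phi>) (D.oc r)) \<otimes>\<^sub>E vt1 (Idt (lax_cat0 D E) (ht_dom \<phi>)) r)
      \<cdot>\<^sub>E ht_n (trans_comp D E (lax_comp_n D E) (trans_unit D E (lax_unit_n E) (ht_cod \<phi>)) \<phi>) r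
    = ht_n \<phi> r \<cdot>\<^sub>E (vt1 (Idt (lax_cat0 D E) (ht_cod \<phi>)) r \<otimes>\<^sub>E lunitor E (ob (ht_fun \<phi>) (D.od r)))"
    using assms r *(1) by (simp add: lax_comp_n_def lax_unit_n_def Let_def)
  show "(runitor E (ob (ht_fun \<phi>) (D.oc r)) \<otimes>\<^sub>E vt1 (Idt (lax_cat0 D E) (ht_dom \<phi>)) r)
      \<cdot>\<^sub>E ht_n (trans_comp D E (lax_comp_n D E) \<phi> (trans_unit D E (lax_unit_n E) (ht_dom \<phi>))) r
    = ht_n \<phi> r \<cdot>\<^sub>E (vt1 (Idt (lax_cat0 D E) (ht_cod \<phi>)) r \<otimes>\<^sub>E runitor E (ob (ht_fun \<phi>) (D.od r)))"
    using assms r *(2) by (simp add: lax_comp_n_def lax_unit_n_def Let_def)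
qed

lemma lax_compat_associator:
  assumes "lax_transformation D E \<chi>" "lax_transformation D E \<psi>" "lax_transformation D E \<phi>"
    and "ht_dom \<chi> = ht_cod \<psi>" "ht_dom \<psi> = ht_cod \<phi>"
  shows "lax_compat D E (mod_associator (lax_comp_n D E) \<chi> \<psi> \<phi>)"
  unfolding lax_compat_mk_mod
proof
  fix r assume r: "D.hor r"
  let ?x = "D.od r" and ?y = "D.oc r"
  show "(associator E (ob (ht_fun \<chi>) ?y, ob (ht_fun \<psi>) ?y, ob (ht_fun \<phi>) ?y)
        \<otimes>\<^sub>E vt1 (Idt (lax_cat0 D E) (ht_dom \<phi>)) r)
      \<cdot>\<^sub>E ht_n (trans_comp D E (lax_comp_n D E) (trans_comp D E (lax_comp_n D E) \<chi> \<psi>) \<phi>) r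
    = ht_n (trans_comp D E (lax_comp_n D E) \<chi> (trans_comp D E (lax_comp_n D E) \<psi> \<phi>)) r
      \<cdot>\<^sub>E (vt1 (Idt (lax_cat0 D E) (ht_cod \<chi>)) r
        \<otimes>\<^sub>E associator E (ob (ht_fun \<chi>) ?x, ob (ht_fun \<psi>) ?x, ob (ht_fun \<phi>) ?x))"
    using assms r E.composite_constraint_assoc[
        where ?f0.0 = "ob (lf0 (ht_dom \<phi>)) ?x" and ?f1.0 = "ob (lf0 (ht_dom \<phi>)) ?y"
          and ?g0.0 = "ob (lf0 (ht_cod \<phi>)) ?x" and ?g1.0 = "ob (lf0 (ht_cod \<phi>)) ?y"
          and ?h0.0 = "ob (lf0 (ht_cod \<psi>)) ?x" and ?h1.0 = "ob (lf0 (ht_cod \<psi>)) ?y"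
          and ?k0.0 = "ob (lf0 (ht_cod \<chi>)) ?x" and ?k1.0 = "ob (lf0 (ht_cod \<chi>)) ?y"
          and Fr = "ob (lf1 (ht_dom \<phi>)) r" and Gr = "ob (lf1 (ht_cod \<phi>)) r"
          and Hr = "ob (lf1 (ht_cod \<psi>)) r" and Kr = "ob (lf1 (ht_cod \<chi>)) r"
          and ?\<phi>0.0 = "ob (ht_fun \<phi>) ?x" and ?\<phi>1.0 = "ob (ht_fun \<phi>) ?y"
          and ?\<psi>0.0 = "ob (ht_fun \<psi>) ?x" and ?\<psi>1.0 = "ob (ht_fun \<psi>) ?y"
          and ?\<chi>0.0 = "ob (ht_fun \<chi>) ?x" and ?\<chi>1.0 = "ob (ht_fun \<chi>) ?y"
          and p = "ht_n \<phi> r" and q = "ht_n \<psi> r" and c = "ht_n \<chi> r"]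
    by (simp add: lax_comp_n_def Let_def)
qed

lemma transformation_structure_lax:
  "transformation_structure D E {\<phi>. lax_transformation D E \<phi>} (lax_compat D E) (lax_unit_n E)
    (lax_comp_n D E)"
proof (intro transformation_structure.intro transformation_structure_axioms.intro)
  show "pseudodouble_pair D E" by (rule pseudodouble_pair_axioms)
  fix \<zeta> assume "\<zeta> \<in> {\<phi>. lax_transformation D E \<phi>}"
  then show "lax_compat D E (mod_idt \<zeta>)"
    by (simp add: lax_compat_mk_mod)
next
  fix \<Gamma> F G
  assume "\<Gamma> \<in> {\<Gamma>. modification D E \<Gamma> \<and> md_src \<Gamma> \<in> {\<phi>. lax_transformation D E \<phi>} \<and>
      md_trg \<Gamma> \<in> {\<phi>. lax_transformation D E \<phi>} \<and> lax_compat D E \<Gamma>}"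
    "md_dom \<Gamma> = Idt (lax_cat0 D E) F" "md_cod \<Gamma> = Idt (lax_cat0 D E) G"
    "\<And>x. x \<in> Obj (cat0 D) \<Longrightarrow> E.iso2 (md_c \<Gamma> x)"
  then show "lax_compat D E
      (mod_inv \<Gamma>)"
    by (intro lax_compat_inv) auto
qed (auto intro: lax_unit_transformation lax_comp_transformation lax_compat_cmp
    lax_compat_unit lax_compat_hcomp lax_compat_unitors lax_compat_associator)

lemma Lax_lax_eq:
  "Lax_lax D E = trans_pdcat D E {\<phi>. lax_transformation D E \<phi>}
    {\<Gamma>. modification D E \<Gamma> \<and> md_src \<Gamma> \<in> {\<phi>. lax_transformation D E \<phi>} \<and>
      md_trg \<Gamma> \<in> {\<phi>. lax_transformation D E \<phi>} \<and> lax_compat D E \<Gamma>}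
    (lax_unit_n E) (lax_comp_n D E)"
  unfolding Lax_lax_def lax_modification_iff ..

lemma pseudodouble_category_Lax_lax: "pseudodouble_category (Lax_lax D E)"
  unfolding Lax_lax_eq
  by (rule transformation_structure.pseudodouble_category_P[OF transformation_structure_lax])

end

section \<open>Conjoints and companions in terms of components\<close>

context transformation_structure
begin

lemma inv_unitors:
  assumes "\<zeta> \<in> T"
  shows "vinv2 P (runitor P \<zeta>) = mk_mod D \<zeta> (trans_comp D E nc \<zeta> (trans_unit D E nu (ht_dom \<zeta>)))
      (Idt (lax_cat0 D E) (ht_dom \<zeta>)) (Idt (lax_cat0 D E) (ht_cod \<zeta>))
      (\<lambda>x. E.inv2 (md_c (runitor P \<zeta>) x))"
    and "vinv2 P (lunitor P \<zeta>) = mk_mod D \<zeta> (trans_comp D E nc (trans_unit D E nu (ht_cod \<zeta>)) \<zeta>)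
      (Idt (lax_cat0 D E) (ht_dom \<zeta>)) (Idt (lax_cat0 D E) (ht_cod \<zeta>))
      (\<lambda>x. E.inv2 (md_c (lunitor P \<zeta>) x))"
  using iso_P(2)[of "runitor P \<zeta>" "ht_dom \<zeta>" "ht_cod \<zeta>"]
    iso_P(2)[of "lunitor P \<zeta>" "ht_dom \<zeta>" "ht_cod \<zeta>"] assms
  by simp_all

text \<open>Both equations of a conjoint are equations between members of \<open>M\<close>, so they
  can be tested at each 0-cell. There the inverse right unitor is evaluated pointwise, and the
  second equation becomes the one with \<open>gamma\<close>.\<close>

lemma is_conjoint_P:
  assumes "vertical_transformation D E \<phi>" "\<zeta> \<in> T" "\<Gamma> \<in> M" "\<Delta> \<in> M"
    and "ht_dom \<zeta> = vt_trg \<phi>" "ht_cod \<zeta> = vt_src \<phi>"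
    and "md_src \<Gamma> = trans_unit D E nu (vt_src \<phi>)" "md_trg \<Gamma> = \<zeta>" "md_dom \<Gamma> = \<phi>"
      "md_cod \<Gamma> = Idt (lax_cat0 D E) (vt_src \<phi>)"
    and "md_src \<Delta> = \<zeta>" "md_trg \<Delta> = trans_unit D E nu (vt_trg \<phi>)"
      "md_dom \<Delta> = Idt (lax_cat0 D E) (vt_trg \<phi>)" "md_cod \<Delta> = \<phi>"
    and "\<And>x. x \<in> Obj (cat0 D) \<Longrightarrow> md_c \<Delta> x \<cdot>\<^sub>E md_c \<Gamma> x = E.one1 (vt0 \<phi> x)"
    and "\<And>x. x \<in> Obj (cat0 D) \<Longrightarrow> md_c \<Gamma> x \<otimes>\<^sub>E md_c \<Delta> x = gamma E (ob (ht_fun \<zeta>) x)"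
  shows "is_conjoint P \<phi> \<zeta> \<Gamma> \<Delta>"
proof -
  interpret P: pseudodouble_category P by (rule pseudodouble_category_P)
  have "\<Delta> \<bullet>\<^bsub>P\<^esub> \<Gamma> = ar (hunit P) \<phi>"
    by (rule M_eqI) (use assms in simp_all)
  moreover have "vinv2 P (runitor P \<zeta>) \<bullet>\<^bsub>P\<^esub> lunitor P \<zeta> \<in> M"
    using P.H.cmp_cell(1)[of "lunitor P \<zeta>" "vinv2 P (runitor P \<zeta>)"]
      P.H.inv_cell[OF iso_constraints(2)[OF assms(2)]] assms(2) by simp
  then have "\<Gamma> \<star>\<^bsub>P\<^esub> \<Delta> = vinv2 P (runitor P \<zeta>) \<bullet>\<^bsub>P\<^esub> lunitor P \<zeta>"
    by (rule M_eqI[rotated]) (use assms in \<open>simp_all add: inv_unitors gamma_def\<close>)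
  ultimately show ?thesis
    using assms by (simp add: is_conjoint_def horizontal_def cells_def Hom_def Let_def)
qed

text \<open>The composite of the right unitor with the inverse left unitor, which a companion
  requires, is pointwise the inverse of \<open>gamma\<close>.\<close>

lemma is_companion_P:
  assumes "vertical_transformation D E \<phi>" "\<zeta> \<in> T" "\<Gamma> \<in> M" "\<Delta> \<in> M"
    and "ht_dom \<zeta> = vt_src \<phi>" "ht_cod \<zeta> = vt_trg \<phi>"
    and "md_src \<Gamma> = trans_unit D E nu (vt_src \<phi>)" "md_trg \<Gamma> = \<zeta>"
      "md_dom \<Gamma> = Idt (lax_cat0 D E) (vt_src \<phi>)" "md_cod \<Gamma> = \<phi>"
    and "md_src \<Delta> = \<zeta>" "md_trg \<Delta> = trans_unit D E nu (vt_trg \<phi>)" "md_dom \<Delta> = \<phi>"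
      "md_cod \<Delta> = Idt (lax_cat0 D E) (vt_trg \<phi>)"
    and "\<And>x. x \<in> Obj (cat0 D) \<Longrightarrow> md_c \<Delta> x \<cdot>\<^sub>E md_c \<Gamma> x = E.one1 (vt0 \<phi> x)"
    and "\<And>x. x \<in> Obj (cat0 D) \<Longrightarrow>
      md_c \<Delta> x \<otimes>\<^sub>E md_c \<Gamma> x = E.inv2 (gamma E (ob (ht_fun \<zeta>) x))"
  shows "is_companion P \<phi> \<zeta> \<Gamma> \<Delta>"
proof -
  interpret P: pseudodouble_category P by (rule pseudodouble_category_P)
  have "\<Delta> \<bullet>\<^bsub>P\<^esub> \<Gamma> = ar (hunit P) \<phi>"
    by (rule M_eqI) (use assms in simp_all)
  moreover have "vinv2 P (lunitor P \<zeta>) \<bullet>\<^bsub>P\<^esub> runitor P \<zeta> \<in> M"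
    using P.H.cmp_cell(1)[of "runitor P \<zeta>" "vinv2 P (lunitor P \<zeta>)"]
      P.H.inv_cell[OF iso_constraints(1)[OF assms(2)]] assms(2) by simp
  then have "\<Delta> \<star>\<^bsub>P\<^esub> \<Gamma> = vinv2 P (lunitor P \<zeta>) \<bullet>\<^bsub>P\<^esub> runitor P \<zeta>"
    by (rule M_eqI[rotated]) (use assms in \<open>simp_all add: inv_unitors\<close>)
  ultimately show ?thesis
    using assms by (simp add: is_companion_def horizontal_def cells_def Hom_def Let_def)
qed

end

section \<open>Conjoints of vertical transformations\<close>

text \<open>
  \<open>A_eps\<close> says that \<open>\<epsilon>\<close> is natural and \<open>N_eps\<close> that it is compatible with the constraints
  \<open>N\<close>; as the cells \<open>\<epsilon> x\<close> are cartesian, these equations determine \<open>A\<close> and \<open>N\<close>.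
\<close>

locale conjoint_choice = pseudodouble_pair D E
  for D :: "('o, 'v, 'h, 'c) pdcat" and E :: "('p, 'w, 'k, 'd) pdcat" +
  fixes \<phi> :: "('o, 'v, 'h, 'c, 'p, 'w, 'k, 'd) vtrans"
    and R :: "'o \<Rightarrow> 'k" and \<eta> \<epsilon> :: "'o \<Rightarrow> 'd" and A :: "'v \<Rightarrow> 'd" and N :: "'h \<Rightarrow> 'd"
    and F G :: "('o, 'v, 'h, 'c, 'p, 'w, 'k, 'd) lax_fun"
  assumes vt [simp]: "vertical_transformation D E \<phi>"
    and vt_src [simp]: "vt_src \<phi> = F" and vt_trg [simp]: "vt_trg \<phi> = G"
    and conjoint: "x \<in> Obj (cat0 D) \<Longrightarrow> is_conjoint E (vt0 \<phi> x) (R x) (\<eta> x) (\<epsilon> x)"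
    and A: "D.ver f \<Longrightarrow> A f \<in> Arr (cat1 E) \<and> E.src (A f) = R (Src (cat0 D) f) \<and>
      E.trg (A f) = R (Trg (cat0 D) f) \<and> E.dm (A f) = ar (lf0 G) f \<and>
      E.cd (A f) = ar (lf0 F) f"
    and A_eps: "D.ver f \<Longrightarrow>
      \<epsilon> (Trg (cat0 D) f) \<cdot>\<^sub>E A f = E.one1 (ar (lf0 G) f) \<cdot>\<^sub>E \<epsilon> (Src (cat0 D) f)"
    and N: "D.hor r \<Longrightarrow> N r \<in> Arr (cat1 E) \<and>
      E.src (N r) = ob (lf1 F) r \<boxtimes>\<^sub>E R (D.od r) \<and>
      E.trg (N r) = R (D.oc r) \<boxtimes>\<^sub>E ob (lf1 G) r \<and>
      E.dm (N r) = Idt (cat0 E) (ob (lf0 G) (D.od r)) \<and>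
      E.cd (N r) = Idt (cat0 E) (ob (lf0 F) (D.oc r))"
    and N_eps: "D.hor r \<Longrightarrow> (\<epsilon> (D.oc r) \<otimes>\<^sub>E E.idh (ob (lf1 G) r)) \<cdot>\<^sub>E N r
      = E.inv2 (gamma E (ob (lf1 G) r)) \<cdot>\<^sub>E (vt1 \<phi> r \<otimes>\<^sub>E \<epsilon> (D.od r))"
begin

lemma lax_FG [simp]: "lax_functor D E F" "lax_functor D E G"
  using vertical_transformation_cell(1,2)[OF vt] by simp_all

lemma conjoint_cell [simp]:
  assumes "x \<in> Obj (cat0 D)"
  shows "R x \<in> Obj (cat1 E)" "E.od (R x) = ob (lf0 G) x" "E.oc (R x) = ob (lf0 F) x"
    "\<eta> x \<in> Arr (cat1 E)" "E.src (\<eta> x) = E.one (ob (lf0 F) x)" "E.trg (\<eta> x) = R x"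
    "E.dm (\<eta> x) = vt0 \<phi> x" "E.cd (\<eta> x) = Idt (cat0 E) (ob (lf0 F) x)"
    "\<epsilon> x \<in> Arr (cat1 E)" "E.src (\<epsilon> x) = R x" "E.trg (\<epsilon> x) = E.one (ob (lf0 G) x)"
    "E.dm (\<epsilon> x) = Idt (cat0 E) (ob (lf0 G) x)" "E.cd (\<epsilon> x) = vt0 \<phi> x"
    "\<epsilon> x \<cdot>\<^sub>E \<eta> x = E.one1 (vt0 \<phi> x)" "\<eta> x \<otimes>\<^sub>E \<epsilon> x = gamma E (R x)"
  using E.conjointD[OF conjoint[OF assms] _ refl refl] assms by simp_all

lemmas A_N_cell [simp] = A[THEN conjunct1] A[THEN conjunct2, THEN conjunct1]
  A[THEN conjunct2, THEN conjunct2, THEN conjunct1]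
  A[THEN conjunct2, THEN conjunct2, THEN conjunct2, THEN conjunct1]
  A[THEN conjunct2, THEN conjunct2, THEN conjunct2, THEN conjunct2]
  N[THEN conjunct1] N[THEN conjunct2, THEN conjunct1]
  N[THEN conjunct2, THEN conjunct2, THEN conjunct1]
  N[THEN conjunct2, THEN conjunct2, THEN conjunct2, THEN conjunct1]
  N[THEN conjunct2, THEN conjunct2, THEN conjunct2, THEN conjunct2]

text \<open>The uniqueness half of the universal property at \<open>x\<close>. Together with its
  whiskered version it is the way in which the equations for \<open>A\<close>, \<open>N\<close> and
  \<eta> are reduced to equations about \<epsilon>.\<close>

lemma eps_cancel:
  assumes "\<epsilon> x \<cdot>\<^sub>E k = \<epsilon> x \<cdot>\<^sub>E l" "x \<in> Obj (cat0 D)"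
    and "k \<in> Arr (cat1 E)" "l \<in> Arr (cat1 E)" "E.src k = E.src l"
      "E.cd k = E.cd l" "E.trg k = R x" "E.trg l = R x"
  shows "k = l"
  using E.conjoint_unique[OF conjoint[OF assms(2)] _ assms(3-8,1)] assms(2) by simp

lemma eps_whisker_cancel:
  assumes "(\<epsilon> x \<otimes>\<^sub>E E.idh w) \<cdot>\<^sub>E k = (\<epsilon> x \<otimes>\<^sub>E E.idh w) \<cdot>\<^sub>E l" "x \<in> Obj (cat0 D)"
    and "w \<in> Obj (cat1 E)" "E.oc w = ob (lf0 G) x"
    and "k \<in> Arr (cat1 E)" "l \<in> Arr (cat1 E)" "E.src k = E.src l"
      "E.cd k = E.cd l" "E.trg k = R x \<boxtimes>\<^sub>E w" "E.trg l = R x \<boxtimes>\<^sub>E w"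
  shows "k = l"
  using E.conjoint_whisker_unique[OF conjoint[OF assms(2)] _ assms(3) _ assms(5-10,1)] assms(2,4)
  by simp

text \<open>A conjoint of \<open>vt0 \<phi> x\<close> runs horizontally from the target of this cell
  back to its source, so the transformation has dom \<open>G\<close> and cod
  \<open>F\<close>.\<close>

definition conj_trans where
  "conj_trans = \<lparr>ht_dom = G, ht_cod = F, ht_fun = fctr_restrict (cat0 D) \<lparr>ob = R, ar = A\<rparr>,
    ht_n = restrict N (Obj (cat1 D))\<rparr>"

lemma conj_trans_simps [simp]:
  "ht_dom conj_trans = G" "ht_cod conj_trans = F"
  "x \<in> Obj (cat0 D) \<Longrightarrow> ob (ht_fun conj_trans) x = R x"
  "D.ver f \<Longrightarrow> ar (ht_fun conj_trans) f = A f"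
  "D.hor r \<Longrightarrow> ht_n conj_trans r = N r"
  by (simp_all add: conj_trans_def fctr_restrict_def)

lemma A_idt: "x \<in> Obj (cat0 D) \<Longrightarrow> A (Idt (cat0 D) x) = E.idh (R x)"
  by (rule eps_cancel[of x]) (use A_eps[of "Idt (cat0 D) x"] in simp_all)

text \<open>Both sides lift the same cell and have the same cod, so functoriality of
  \<open>A\<close> is uniqueness of lifts combined with functoriality of \<open>lf0 F\<close> and
  \<open>lf0 G\<close>.\<close>

lemma A_cmp:
  assumes "D.ver f" "D.ver g" "Trg (cat0 D) f = Src (cat0 D) g"
  shows "A (Cmp (cat0 D) g f) = A g \<cdot>\<^sub>E A f"
proof (rule eps_cancel[of "Trg (cat0 D) g"])
  show "\<epsilon> (Trg (cat0 D) g) \<cdot>\<^sub>E A (Cmp (cat0 D) g f) = \<epsilon> (Trg (cat0 D) g) \<cdot>\<^sub>E A g \<cdot>\<^sub>E A f"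
    using assms A_eps[of f] A_eps[of "Cmp (cat0 D) g f"] A_eps[of g, THEN E.H.cmp_reassoc, of "A f"]
      is_functor.ar_cmp_arr[OF lax_functor.functor0[OF lax_FG(2)], of f g]
    by (simp add: E.hunit_cmp E.H.cmp_assoc_arr)
qed (use assms is_functor.ar_cmp_arr[OF lax_functor.functor0[OF lax_FG(1)], of f g] in simp_all)

lemma horizontal_transformation_conj: "horizontal_transformation D E conj_trans"
proof (rule horizontal_transformation.intro)
  show "is_functor (cat0 D) (cat1 E) (ht_fun conj_trans)"
    by (rule is_functorI) (simp_all add: A_idt A_cmp)
  show "fctr_ext (cat0 D) (ht_fun conj_trans)" "ht_n conj_trans \<in> extensional (Obj (cat1 D))"
    by (simp_all add: conj_trans_def fctr_ext_def fctr_restrict_def)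
  show "globular E (ht_n conj_trans r)" if "D.hor r" for r
    using that by (intro E.globularI[where x = "ob (lf0 G) (D.od r)"
      and y = "ob (lf0 F) (D.oc r)"]) simp_all
qed (auto simp: fctr_eq_def fcomp_def)

text \<open>Composition with the whiskered \<epsilon> replaces each \<open>N\<close> by an inverse
  swap. What remains are three squares: naturality of \<phi> joined with \<open>A_eps\<close>, the
  square \<open>A_eps\<close> whiskered, and naturality of the inverse swap.\<close>

lemma N_natural:
  assumes a: "D.cell a"
  shows "N (D.trg a) \<cdot>\<^sub>E (ar (lf1 F) a \<otimes>\<^sub>E A (D.dm a))
    = (A (D.cd a) \<otimes>\<^sub>E ar (lf1 G) a) \<cdot>\<^sub>E N (D.src a)"
proof (rule eps_whisker_cancel[of "D.oc (D.trg a)" "ob (lf1 G) (D.trg a)"])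
  let ?s = "D.src a" and ?t = "D.trg a"
  let ?e = "\<epsilon> (D.oc ?t) \<otimes>\<^sub>E E.idh (ob (lf1 G) ?t)"
  have 1: "(vt1 \<phi> ?t \<otimes>\<^sub>E \<epsilon> (D.od ?t)) \<cdot>\<^sub>E (ar (lf1 F) a \<otimes>\<^sub>E A (D.dm a))
      = (ar (lf1 G) a \<otimes>\<^sub>E E.one1 (ar (lf0 G) (D.dm a)))
        \<cdot>\<^sub>E (vt1 \<phi> ?s \<otimes>\<^sub>E \<epsilon> (D.od ?s))"
    using a A_eps[of "D.dm a"]
      nat_trans.natural_arr[OF vertical_transformation.natural1[OF vt] a]
    by (simp add: E.interchange)
  have 2: "?e \<cdot>\<^sub>E (A (D.cd a) \<otimes>\<^sub>E ar (lf1 G) a)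
      = (E.one1 (ar (lf0 G) (D.cd a)) \<otimes>\<^sub>E ar (lf1 G) a)
        \<cdot>\<^sub>E (\<epsilon> (D.oc ?s) \<otimes>\<^sub>E E.idh (ob (lf1 G) ?s))"
    using a A_eps[of "D.cd a"] by (simp add: E.interchange)
  have 3: "E.inv2 (gamma E (ob (lf1 G) ?t))
        \<cdot>\<^sub>E (ar (lf1 G) a \<otimes>\<^sub>E E.one1 (ar (lf0 G) (D.dm a)))
      = (E.one1 (ar (lf0 G) (D.cd a)) \<otimes>\<^sub>E ar (lf1 G) a)
        \<cdot>\<^sub>E E.inv2 (gamma E (ob (lf1 G) ?s))"
    using a E.inv_gamma_natural[of "ar (lf1 G) a"] by (simp del: E.gamma_simps(2))
  have "?e \<cdot>\<^sub>E N ?t \<cdot>\<^sub>E (ar (lf1 F) a \<otimes>\<^sub>E A (D.dm a))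
      = E.inv2 (gamma E (ob (lf1 G) ?t)) \<cdot>\<^sub>E (vt1 \<phi> ?t \<otimes>\<^sub>E \<epsilon> (D.od ?t))
        \<cdot>\<^sub>E (ar (lf1 F) a \<otimes>\<^sub>E A (D.dm a))"
    by (rule E.H.cmp_reassoc[OF N_eps]) (use a in simp_all)
  also have "\<dots> = E.inv2 (gamma E (ob (lf1 G) ?t))
      \<cdot>\<^sub>E (ar (lf1 G) a \<otimes>\<^sub>E E.one1 (ar (lf0 G) (D.dm a)))
        \<cdot>\<^sub>E (vt1 \<phi> ?s \<otimes>\<^sub>E \<epsilon> (D.od ?s))"
    unfolding 1 ..
  also have "\<dots> = (E.one1 (ar (lf0 G) (D.cd a)) \<otimes>\<^sub>E ar (lf1 G) a)
        \<cdot>\<^sub>E E.inv2 (gamma E (ob (lf1 G) ?s)) \<cdot>\<^sub>E (vt1 \<phi> ?s \<otimes>\<^sub>E \<epsilon> (D.od ?s))"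
    by (rule E.H.cmp_reassoc[OF 3]) (use a in simp_all)
  also have "\<dots> = (E.one1 (ar (lf0 G) (D.cd a)) \<otimes>\<^sub>E ar (lf1 G) a)
        \<cdot>\<^sub>E (\<epsilon> (D.oc ?s) \<otimes>\<^sub>E E.idh (ob (lf1 G) ?s)) \<cdot>\<^sub>E N ?s"
    using a N_eps[of ?s] by simp
  also have "\<dots> = ?e \<cdot>\<^sub>E (A (D.cd a) \<otimes>\<^sub>E ar (lf1 G) a) \<cdot>\<^sub>E N ?s"
    by (rule E.H.cmp_reassoc[OF 2, symmetric]) (use a in simp_all)
  finally show "?e \<cdot>\<^sub>E N ?t \<cdot>\<^sub>E (ar (lf1 F) a \<otimes>\<^sub>E A (D.dm a))
      = ?e \<cdot>\<^sub>E (A (D.cd a) \<otimes>\<^sub>E ar (lf1 G) a) \<cdot>\<^sub>E N ?s" .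
qed (use a in simp_all)

text \<open>Tested after \<epsilon>, the unit law of \<phi> replaces \<open>lf_e F\<close> by
  \<open>lf_e G\<close>, then \<open>unit_constraint_unit\<close> moves the inverse swap past
  \<open>lf_e G\<close>, and naturality of the swap at \<epsilon> produces
  \<open>gamma E (R x)\<close>.\<close>

lemma N_unit:
  assumes x: "x \<in> Obj (cat0 D)"
  shows "N (D.one x) \<cdot>\<^sub>E (lf_e F x \<otimes>\<^sub>E E.idh (R x))
    = (E.idh (R x) \<otimes>\<^sub>E lf_e G x) \<cdot>\<^sub>E gamma E (R x)"
proof (rule eps_whisker_cancel[of x "ob (lf1 G) (D.one x)"])
  let ?g = "E.one (ob (lf0 G) x)" and ?G = "ob (lf1 G) (D.one x)"
  let ?e = "\<epsilon> x \<otimes>\<^sub>E E.idh ?G"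
  have 1: "(vt1 \<phi> (D.one x) \<otimes>\<^sub>E \<epsilon> x) \<cdot>\<^sub>E (lf_e F x \<otimes>\<^sub>E E.idh (R x))
      = (lf_e G x \<otimes>\<^sub>E E.idh ?g) \<cdot>\<^sub>E (E.one1 (vt0 \<phi> x) \<otimes>\<^sub>E \<epsilon> x)"
    using x vertical_transformation.unit[OF vt x] by (simp add: E.interchange)
  have 2: "?e \<cdot>\<^sub>E (E.idh (R x) \<otimes>\<^sub>E lf_e G x)
      = (E.idh ?g \<otimes>\<^sub>E lf_e G x) \<cdot>\<^sub>E (\<epsilon> x \<otimes>\<^sub>E E.idh ?g)"
    using x by (simp add: E.interchange)
  have 3: "(\<epsilon> x \<otimes>\<^sub>E E.idh ?g) \<cdot>\<^sub>E gamma E (R x)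
      = gamma E ?g \<cdot>\<^sub>E (E.one1 (vt0 \<phi> x) \<otimes>\<^sub>E \<epsilon> x)"
    using x E.gamma_natural[of "\<epsilon> x"] by simp
  have "?e \<cdot>\<^sub>E N (D.one x) \<cdot>\<^sub>E (lf_e F x \<otimes>\<^sub>E E.idh (R x))
      = E.inv2 (gamma E ?G) \<cdot>\<^sub>E (vt1 \<phi> (D.one x) \<otimes>\<^sub>E \<epsilon> x)
        \<cdot>\<^sub>E (lf_e F x \<otimes>\<^sub>E E.idh (R x))"
    by (rule E.H.cmp_reassoc) (use x N_eps[of "D.one x"] in simp_all)
  also have "\<dots> = E.inv2 (gamma E ?G) \<cdot>\<^sub>E (lf_e G x \<otimes>\<^sub>E E.idh ?g)
      \<cdot>\<^sub>E (E.one1 (vt0 \<phi> x) \<otimes>\<^sub>E \<epsilon> x)"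
    unfolding 1 ..
  also have "\<dots> = (E.idh ?g \<otimes>\<^sub>E lf_e G x) \<cdot>\<^sub>E gamma E ?g \<cdot>\<^sub>E (E.one1 (vt0 \<phi> x) \<otimes>\<^sub>E \<epsilon> x)"
    by (rule E.H.cmp_reassoc[OF E.unit_constraint_unit]) (use x in simp_all)
  also have "\<dots> = (E.idh ?g \<otimes>\<^sub>E lf_e G x) \<cdot>\<^sub>E (\<epsilon> x \<otimes>\<^sub>E E.idh ?g) \<cdot>\<^sub>E gamma E (R x)"
    unfolding 3 ..
  also have "\<dots> = ?e \<cdot>\<^sub>E (E.idh (R x) \<otimes>\<^sub>E lf_e G x) \<cdot>\<^sub>E gamma E (R x)"
    by (rule E.H.cmp_reassoc[OF 2, symmetric]) (use x in simp_all)
  finally show "?e \<cdot>\<^sub>E N (D.one x) \<cdot>\<^sub>E (lf_e F x \<otimes>\<^sub>E E.idh (R x))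
      = ?e \<cdot>\<^sub>E (E.idh (R x) \<otimes>\<^sub>E lf_e G x) \<cdot>\<^sub>E gamma E (R x)" .
qed (use x in simp_all)

text \<open>Composed with \<epsilon>, each \<open>N\<close> becomes an inverse swap and a component
  of \<phi>. The components of \<phi> and the last \<epsilon> collect in the cell \<open>?p\<close>
  that is applied first; what is left is the composition law of the unit transformation of
  \<open>G\<close>.\<close>

lemma N_comp:
  assumes s: "D.hor s" and r: "D.hor r" and sr: "D.od s = D.oc r"
    and [simp]: "Fr = ob (lf1 F) r" "Fs = ob (lf1 F) s" "Gr = ob (lf1 G) r" "Gs = ob (lf1 G) s"
      "x = D.od r" "y = D.oc r" "z = D.oc s"
  shows "N (s \<odot>\<^bsub>D\<^esub> r) \<cdot>\<^sub>E (lf_m F (s, r) \<otimes>\<^sub>E E.idh (R x))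
    = (E.idh (R z) \<otimes>\<^sub>E lf_m G (s, r)) \<cdot>\<^sub>E associator E (R z, Gs, Gr)
      \<cdot>\<^sub>E (N s \<otimes>\<^sub>E E.idh Gr) \<cdot>\<^sub>E E.inv2 (associator E (Fs, R y, Gr))
      \<cdot>\<^sub>E (E.idh Fs \<otimes>\<^sub>E N r) \<cdot>\<^sub>E associator E (Fs, Fr, R x)"
    (is "?L = ?R")
proof (rule eps_whisker_cancel[of z "ob (lf1 G) (s \<odot>\<^bsub>D\<^esub> r)"])
  let ?one = "\<lambda>x. E.one (ob (lf0 G) x)"
  let ?e = "\<epsilon> z \<otimes>\<^sub>E E.idh (ob (lf1 G) (s \<odot>\<^bsub>D\<^esub> r))"
  \<comment> \<open>The inverse swaps are named so that each stays a single cell in the squares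
    below and is not expanded into unitors.\<close>
  define gr gs gsr where "gr = E.inv2 (gamma E Gr)" and "gs = E.inv2 (gamma E Gs)"
    and "gsr = E.inv2 (gamma E (ob (lf1 G) (s \<odot>\<^bsub>D\<^esub> r)))"
  note [simp] = s r sr
  have g [simp]: "E.gl gr (Gr \<boxtimes>\<^sub>E ?one x) (?one y \<boxtimes>\<^sub>E Gr) (ob (lf0 G) x) (ob (lf0 G) y)"
    "E.gl gs (Gs \<boxtimes>\<^sub>E ?one y) (?one z \<boxtimes>\<^sub>E Gs) (ob (lf0 G) y) (ob (lf0 G) z)"
    "E.gl gsr (ob (lf1 G) (s \<odot>\<^bsub>D\<^esub> r) \<boxtimes>\<^sub>E ?one x) (?one z \<boxtimes>\<^sub>E ob (lf1 G) (s \<odot>\<^bsub>D\<^esub> r))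
      (ob (lf0 G) x) (ob (lf0 G) z)"
    by (simp_all add: gr_def gs_def gsr_def)
  let ?p = "(vt1 \<phi> s \<otimes>\<^sub>E vt1 \<phi> r) \<otimes>\<^sub>E \<epsilon> x"
  have 1: "?e \<cdot>\<^sub>E N (s \<odot>\<^bsub>D\<^esub> r) = gsr \<cdot>\<^sub>E (vt1 \<phi> (s \<odot>\<^bsub>D\<^esub> r) \<otimes>\<^sub>E \<epsilon> x)"
    "(\<epsilon> z \<otimes>\<^sub>E E.idh Gs) \<cdot>\<^sub>E N s = gs \<cdot>\<^sub>E (vt1 \<phi> s \<otimes>\<^sub>E \<epsilon> y)"
    "(\<epsilon> y \<otimes>\<^sub>E E.idh Gr) \<cdot>\<^sub>E N r = gr \<cdot>\<^sub>E (vt1 \<phi> r \<otimes>\<^sub>E \<epsilon> x)"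
    using N_eps[of "s \<odot>\<^bsub>D\<^esub> r"] N_eps[of s] N_eps[of r]
    by (simp_all add: gr_def gs_def gsr_def del: E.gamma_simps(2))
  have 2: "(vt1 \<phi> (s \<odot>\<^bsub>D\<^esub> r) \<otimes>\<^sub>E \<epsilon> x) \<cdot>\<^sub>E (lf_m F (s, r) \<otimes>\<^sub>E E.idh (R x))
      = (lf_m G (s, r) \<otimes>\<^sub>E E.idh (?one x)) \<cdot>\<^sub>E ?p"
    using vertical_transformation.comp[OF vt, of s r] by (simp add: E.interchange)
  have 3: "gsr \<cdot>\<^sub>E (lf_m G (s, r) \<otimes>\<^sub>E E.idh (?one x))
    = (E.idh (?one z) \<otimes>\<^sub>E lf_m G (s, r)) \<cdot>\<^sub>E associator E (?one z, Gs, Gr) \<cdot>\<^sub>E (gs \<otimes>\<^sub>E E.idh Gr)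
      \<cdot>\<^sub>E E.inv2 (associator E (Gs, ?one y, Gr)) \<cdot>\<^sub>E (E.idh Gs \<otimes>\<^sub>E gr)
      \<cdot>\<^sub>E associator E (Gs, Gr, ?one x)"
    unfolding gr_def gs_def gsr_def
    by (rule E.unit_constraint_comp[where x = "ob (lf0 G) x" and z = "ob (lf0 G) z"]) simp_all
  have 4: "?e \<cdot>\<^sub>E (E.idh (R z) \<otimes>\<^sub>E lf_m G (s, r))
      = (E.idh (?one z) \<otimes>\<^sub>E lf_m G (s, r)) \<cdot>\<^sub>E (\<epsilon> z \<otimes>\<^sub>E E.idh (Gs \<boxtimes>\<^sub>E Gr))"
    by (simp add: E.interchange)
  have 5: "(\<epsilon> z \<otimes>\<^sub>E E.idh (Gs \<boxtimes>\<^sub>E Gr)) \<cdot>\<^sub>E associator E (R z, Gs, Gr)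
      = associator E (?one z, Gs, Gr) \<cdot>\<^sub>E ((\<epsilon> z \<otimes>\<^sub>E E.idh Gs) \<otimes>\<^sub>E E.idh Gr)"
    using E.associator_natural[of "\<epsilon> z" "E.idh Gs" "E.idh Gr"] by simp
  have 6: "((\<epsilon> z \<otimes>\<^sub>E E.idh Gs) \<otimes>\<^sub>E E.idh Gr) \<cdot>\<^sub>E (N s \<otimes>\<^sub>E E.idh Gr)
      = (gs \<otimes>\<^sub>E E.idh Gr) \<cdot>\<^sub>E ((vt1 \<phi> s \<otimes>\<^sub>E \<epsilon> y) \<otimes>\<^sub>E E.idh Gr)"
    using 1(2) by (simp add: E.interchange)
  have 7: "((vt1 \<phi> s \<otimes>\<^sub>E \<epsilon> y) \<otimes>\<^sub>E E.idh Gr) \<cdot>\<^sub>E E.inv2 (associator E (Fs, R y, Gr))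
      = E.inv2 (associator E (Gs, ?one y, Gr)) \<cdot>\<^sub>E (vt1 \<phi> s \<otimes>\<^sub>E \<epsilon> y \<otimes>\<^sub>E E.idh Gr)"
    using E.inv_asc_natural[of "vt1 \<phi> s" "\<epsilon> y" "E.idh Gr"] by simp
  have 8: "(vt1 \<phi> s \<otimes>\<^sub>E \<epsilon> y \<otimes>\<^sub>E E.idh Gr) \<cdot>\<^sub>E (E.idh Fs \<otimes>\<^sub>E N r)
      = (E.idh Gs \<otimes>\<^sub>E gr) \<cdot>\<^sub>E (vt1 \<phi> s \<otimes>\<^sub>E vt1 \<phi> r \<otimes>\<^sub>E \<epsilon> x)"
    using 1(3) by (simp add: E.interchange)
  have 9: "(vt1 \<phi> s \<otimes>\<^sub>E vt1 \<phi> r \<otimes>\<^sub>E \<epsilon> x) \<cdot>\<^sub>E associator E (Fs, Fr, R x)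
      = associator E (Gs, Gr, ?one x) \<cdot>\<^sub>E ?p"
    using E.associator_natural[of "vt1 \<phi> s" "vt1 \<phi> r" "\<epsilon> x"] by simp
  have "?e \<cdot>\<^sub>E ?L = gsr \<cdot>\<^sub>E (lf_m G (s, r) \<otimes>\<^sub>E E.idh (?one x)) \<cdot>\<^sub>E ?p"
    using 1(1)[THEN E.H.cmp_reassoc, of "lf_m F (s, r) \<otimes>\<^sub>E E.idh (R x)"] 2 by simp
  also have "\<dots> = (E.idh (?one z) \<otimes>\<^sub>E lf_m G (s, r)) \<cdot>\<^sub>E associator E (?one z, Gs, Gr)
      \<cdot>\<^sub>E (gs \<otimes>\<^sub>E E.idh Gr) \<cdot>\<^sub>E E.inv2 (associator E (Gs, ?one y, Gr)) \<cdot>\<^sub>E (E.idh Gs \<otimes>\<^sub>E gr)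
      \<cdot>\<^sub>E associator E (Gs, Gr, ?one x) \<cdot>\<^sub>E ?p"
    using 3[THEN E.H.cmp_reassoc1, of ?p] by (simp add: E.H.cmp_assoc_arr)
  \<comment> \<open>Each of the squares 4 to 9 carries \<epsilon> past one factor of the right side,
    from the multiplication cell to the associator that is applied first.\<close>
  also have "\<dots> = ?e \<cdot>\<^sub>E ?R"
    using 4[THEN E.H.cmp_reassoc] 5[THEN E.H.cmp_reassoc] 6[THEN E.H.cmp_reassoc]
      7[THEN E.H.cmp_reassoc] 8[THEN E.H.cmp_reassoc] 9
    by simp
  finally show "?e \<cdot>\<^sub>E ?L = ?e \<cdot>\<^sub>E ?R" .
qed (use s r sr in simp_all)

lemma lax_transformation_conj: "lax_transformation D E conj_trans"
  by (rule lax_transformationI)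
    (auto simp: horizontal_transformation_conj N_natural N_unit N_comp)

definition conj_unit where
  "conj_unit = mk_mod D (trans_unit D E (lax_unit_n E) F) conj_trans \<phi> (Idt (lax_cat0 D E) F) \<eta>"

definition conj_counit where
  "conj_counit = mk_mod D conj_trans (trans_unit D E (lax_unit_n E) G) (Idt (lax_cat0 D E) G) \<phi> \<epsilon>"

text \<open>\<open>A\<close> and \<open>N\<close> were chosen with regard to \<epsilon>; that \<eta>
  is a modification as well follows by testing after \<epsilon>. There \<eta> meets \<epsilon> in
  the unit cell of \<phi>, and the laws become naturality of \<phi> and naturality of the inverse
  swap at \<open>vt1 \<phi> r\<close>.\<close>

lemma conj_unit_modification: "lax_modification D E conj_unit"
  unfolding lax_modification_iff conj_unit_def
proof (intro conjI modificationI)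
  show "\<eta> (Trg (cat0 D) f) \<cdot>\<^sub>E ar (ht_fun (trans_unit D E (lax_unit_n E) F)) f
      = ar (ht_fun conj_trans) f \<cdot>\<^sub>E \<eta> (Src (cat0 D) f)" if f: "D.ver f" for f
  proof (rule eps_cancel[of "Trg (cat0 D) f"])
    have "\<epsilon> (Trg (cat0 D) f) \<cdot>\<^sub>E A f \<cdot>\<^sub>E \<eta> (Src (cat0 D) f)
        = E.one1 (ar (lf0 G) f) \<cdot>\<^sub>E \<epsilon> (Src (cat0 D) f) \<cdot>\<^sub>E \<eta> (Src (cat0 D) f)"
      by (rule E.H.cmp_reassoc[OF A_eps]) (use f in simp_all)
    then show "\<epsilon> (Trg (cat0 D) f) \<cdot>\<^sub>E \<eta> (Trg (cat0 D) f)
          \<cdot>\<^sub>E ar (ht_fun (trans_unit D E (lax_unit_n E) F)) f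
        = \<epsilon> (Trg (cat0 D) f) \<cdot>\<^sub>E ar (ht_fun conj_trans) f \<cdot>\<^sub>E \<eta> (Src (cat0 D) f)"
      using f nat_trans.natural_arr[OF vertical_transformation.natural0[OF vt] f]
        conjoint_cell(14)[of "Trg (cat0 D) f", THEN E.H.cmp_reassoc1, of "E.one1 (ar (lf0 F) f)"]
      by (simp flip: E.hunit_cmp)
  qed (use f in simp_all)
  show "lax_compat D E
    (mk_mod D (trans_unit D E (lax_unit_n E) F) conj_trans \<phi> (Idt (lax_cat0 D E) F) \<eta>)"
    unfolding lax_compat_mk_mod
  proof
    fix r assume r: "D.hor r"
    let ?x = "D.od r" and ?y = "D.oc r" and ?G = "ob (lf1 G) r" and ?F = "ob (lf1 F) r"
    have "(\<eta> ?y \<otimes>\<^sub>E vt1 \<phi> r) \<cdot>\<^sub>E E.inv2 (gamma E ?F) = N r \<cdot>\<^sub>E (E.idh ?F \<otimes>\<^sub>E \<eta> ?x)"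
    proof (rule eps_whisker_cancel[of ?y ?G])
      let ?e = "\<epsilon> ?y \<otimes>\<^sub>E E.idh ?G"
      have 1: "?e \<cdot>\<^sub>E (\<eta> ?y \<otimes>\<^sub>E vt1 \<phi> r) = E.one1 (vt0 \<phi> ?y) \<otimes>\<^sub>E vt1 \<phi> r"
        using r by (simp add: E.interchange)
      have 2: "(vt1 \<phi> r \<otimes>\<^sub>E \<epsilon> ?x) \<cdot>\<^sub>E (E.idh ?F \<otimes>\<^sub>E \<eta> ?x) = vt1 \<phi> r \<otimes>\<^sub>E E.one1 (vt0 \<phi> ?x)"
        using r by (simp add: E.interchange)
      have 3: "E.inv2 (gamma E ?G) \<cdot>\<^sub>E (vt1 \<phi> r \<otimes>\<^sub>E E.one1 (vt0 \<phi> ?x))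
          = (E.one1 (vt0 \<phi> ?y) \<otimes>\<^sub>E vt1 \<phi> r) \<cdot>\<^sub>E E.inv2 (gamma E ?F)"
        using r E.inv_gamma_natural[of "vt1 \<phi> r"] by (simp del: E.gamma_simps(2))
      have "?e \<cdot>\<^sub>E (\<eta> ?y \<otimes>\<^sub>E vt1 \<phi> r) \<cdot>\<^sub>E E.inv2 (gamma E ?F)
          = E.inv2 (gamma E ?G) \<cdot>\<^sub>E (vt1 \<phi> r \<otimes>\<^sub>E \<epsilon> ?x) \<cdot>\<^sub>E (E.idh ?F \<otimes>\<^sub>E \<eta> ?x)"
        unfolding 2 3 by (rule E.H.cmp_reassoc1[OF 1]) (use r in simp_all)
      also have "\<dots> = ?e \<cdot>\<^sub>E N r \<cdot>\<^sub>E (E.idh ?F \<otimes>\<^sub>E \<eta> ?x)"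
        by (rule E.H.cmp_reassoc[OF N_eps, symmetric]) (use r in simp_all)
      finally show "?e \<cdot>\<^sub>E (\<eta> ?y \<otimes>\<^sub>E vt1 \<phi> r) \<cdot>\<^sub>E E.inv2 (gamma E ?F)
          = ?e \<cdot>\<^sub>E N r \<cdot>\<^sub>E (E.idh ?F \<otimes>\<^sub>E \<eta> ?x)" .
    qed (use r in simp_all)
    then show "(\<eta> ?y \<otimes>\<^sub>E vt1 \<phi> r) \<cdot>\<^sub>E ht_n (trans_unit D E (lax_unit_n E) F) r
        = ht_n conj_trans r \<cdot>\<^sub>E (vt1 (Idt (lax_cat0 D E) F) r \<otimes>\<^sub>E \<eta> ?x)"
      using r by (simp add: lax_unit_n_def)
  qed
qed (auto simp: lax_unit_transformation lax_transformation_conj)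

text \<open>The equations \<open>A_eps\<close> and \<open>N_eps\<close> are exactly the two laws
  required.\<close>

lemma conj_counit_modification: "lax_modification D E conj_counit"
  unfolding lax_modification_iff conj_counit_def
proof (intro conjI modificationI)
  show "lax_compat D E
    (mk_mod D conj_trans (trans_unit D E (lax_unit_n E) G) (Idt (lax_cat0 D E) G) \<phi> \<epsilon>)"
    unfolding lax_compat_mk_mod using N_eps by (simp add: lax_unit_n_def)
qed (auto simp: lax_unit_transformation lax_transformation_conj A_eps)

lemma is_conjoint_conj_trans: "is_conjoint (Lax_lax D E) \<phi> conj_trans conj_unit conj_counit"
  unfolding Lax_lax_eq
  by (rule transformation_structure.is_conjoint_P[OF transformation_structure_lax])
    (use lax_transformation_conj conj_unit_modification conj_counit_modification in
      \<open>simp_all add: lax_modification_iff conj_unit_def conj_counit_def\<close>)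

end

lemma (in pseudodouble_pair) conjoint_closed_Lax_lax:
  assumes "conjoint_closed E"
  shows "conjoint_closed (Lax_lax D E)"
  unfolding conjoint_closed_def
proof
  fix \<phi> assume "\<phi> \<in> Arr (cat0 (Lax_lax D E))"
  then have vt [simp]: "vertical_transformation D E \<phi>"
    by (simp add: Lax_lax_def trans_pdcat_def Let_def)
  let ?F = "vt_src \<phi>" and ?G = "vt_trg \<phi>"
  have "\<forall>x\<in>Obj (cat0 D). \<exists>r \<eta> \<epsilon>. is_conjoint E (vt0 \<phi> x) r \<eta> \<epsilon>"
    using assms by (simp add: conjoint_closed_def)
  then obtain R \<eta> \<epsilon> where c: "\<And>x. x \<in> Obj (cat0 D) \<Longrightarrow> is_conjoint E (vt0 \<phi> x) (R x) (\<eta> x) (\<epsilon> x)"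
    by metis
  have v: "vt0 \<phi> x \<in> Arr (cat0 E)" if "x \<in> Obj (cat0 D)" for x using that by simp
  note cs [simp] = E.conjointD(1-11)[OF c v refl refl]
  have "\<exists>l. l \<in> Arr (cat1 E) \<and> E.src l = R (Src (cat0 D) f) \<and>
      E.trg l = R (Trg (cat0 D) f) \<and> E.dm l = ar (lf0 ?G) f \<and> E.cd l = ar (lf0 ?F) f \<and>
      \<epsilon> (Trg (cat0 D) f) \<cdot>\<^sub>E l = E.one1 (ar (lf0 ?G) f) \<cdot>\<^sub>E \<epsilon> (Src (cat0 D) f)"
    if f: "D.ver f" for f
  proof -
    \<comment> \<open>By naturality of \<phi> the cod of \<open>?k\<close> factors through
      \<open>vt0 \<phi>\<close> at the target of \<open>f\<close>, with \<open>ar (lf0 ?F) f\<close>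
      as the other factor; \<open>?k\<close> is therefore lifted over that vertical cell.\<close>
    let ?k = "E.one1 (ar (lf0 ?G) f) \<cdot>\<^sub>E \<epsilon> (Src (cat0 D) f)"
    obtain l where "l \<in> Arr (cat1 E)" "E.src l = E.src ?k" "E.trg l = R (Trg (cat0 D) f)"
      "E.dm l = E.dm ?k" "E.cd l = ar (lf0 ?F) f" "\<epsilon> (Trg (cat0 D) f) \<cdot>\<^sub>E l = ?k"
      by (rule E.conjoint_exists[OF c v, of "Trg (cat0 D) f" ?k "ar (lf0 ?F) f"])
        (use f nat_trans.natural_arr[OF vertical_transformation.natural0[OF vt] f] in auto)
    then show ?thesis using f by (intro exI[of _ l]) simp
  qed
  then obtain A where A: "\<And>f. f \<in> Arr (cat0 D) \<Longrightarrow> A f \<in> Arr (cat1 E) \<and>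
      E.src (A f) = R (Src (cat0 D) f) \<and>
      E.trg (A f) = R (Trg (cat0 D) f) \<and> E.dm (A f) = ar (lf0 ?G) f \<and>
      E.cd (A f) = ar (lf0 ?F) f \<and>
      \<epsilon> (Trg (cat0 D) f) \<cdot>\<^sub>E A f = E.one1 (ar (lf0 ?G) f) \<cdot>\<^sub>E \<epsilon> (Src (cat0 D) f)"
    by metis
  \<comment> \<open>The composite of the whiskered \<epsilon> with \<open>N r\<close> that a
    modification \<epsilon> into the unit on \<open>?G\<close> forces, the constraint of this unit
    being the inverse swap. Its cod is \<open>vt0 \<phi> (D.oc r)\<close>, so the lift can be taken
    over an identity, which makes \<open>N r\<close> globular.\<close>
  let ?k = "\<lambda>r. E.inv2 (gamma E (ob (lf1 ?G) r)) \<cdot>\<^sub>E (vt1 \<phi> r \<otimes>\<^sub>E \<epsilon> (D.od r))"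
  have "\<exists>l. l \<in> Arr (cat1 E) \<and>
      E.src l = ob (lf1 ?F) r \<boxtimes>\<^sub>E R (D.od r) \<and>
      E.trg l = R (D.oc r) \<boxtimes>\<^sub>E ob (lf1 ?G) r \<and>
      E.dm l = Idt (cat0 E) (ob (lf0 ?G) (D.od r)) \<and>
      E.cd l = Idt (cat0 E) (ob (lf0 ?F) (D.oc r)) \<and>
      (\<epsilon> (D.oc r) \<otimes>\<^sub>E E.idh (ob (lf1 ?G) r)) \<cdot>\<^sub>E l = ?k r"
    if r: "D.hor r" for r
  proof -
    obtain l where "l \<in> Arr (cat1 E)" "E.src l = E.src (?k r)"
      "E.trg l = R (D.oc r) \<boxtimes>\<^sub>E ob (lf1 ?G) r" "E.dm l = E.dm (?k r)"
      "E.cd l = Idt (cat0 E) (ob (lf0 ?F) (D.oc r))"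
      "(\<epsilon> (D.oc r) \<otimes>\<^sub>E E.idh (ob (lf1 ?G) r)) \<cdot>\<^sub>E l = ?k r"
      by (rule E.conjoint_whisker_exists[OF c v, of "D.oc r" "ob (lf1 ?G) r" "?k r"
        "Idt (cat0 E) (ob (lf0 ?F) (D.oc r))"]) (use r in simp_all)
    then show ?thesis using r by (intro exI[of _ l]) simp
  qed
  then obtain N where N: "\<And>r. r \<in> Obj (cat1 D) \<Longrightarrow> N r \<in> Arr (cat1 E) \<and>
      E.src (N r) = ob (lf1 ?F) r \<boxtimes>\<^sub>E R (D.od r) \<and>
      E.trg (N r) = R (D.oc r) \<boxtimes>\<^sub>E ob (lf1 ?G) r \<and>
      E.dm (N r) = Idt (cat0 E) (ob (lf0 ?G) (D.od r)) \<and>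
      E.cd (N r) = Idt (cat0 E) (ob (lf0 ?F) (D.oc r)) \<and>
      (\<epsilon> (D.oc r) \<otimes>\<^sub>E E.idh (ob (lf1 ?G) r)) \<cdot>\<^sub>E N r = ?k r"
    by metis
  have "conjoint_choice D E \<phi> R \<eta> \<epsilon> A N ?F ?G"
    by (intro conjoint_choice.intro conjoint_choice_axioms.intro pseudodouble_pair_axioms)
      (use A N c in auto)
  then show "\<exists>\<zeta> \<Gamma> \<Delta>. is_conjoint (Lax_lax D E) \<phi> \<zeta> \<Gamma> \<Delta>"
    using conjoint_choice.is_conjoint_conj_trans by blast
qed

section \<open>Horizontal duality\<close>

text \<open>The associator is inverted because a composite bracketed to the left in the opposite is
  bracketed to the right in \<open>D\<close>. Vertical composition keeps its direction, so a
  constraint cell points the same way while the factors of its source and target change places: an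
  oplax constraint becomes a lax one.\<close>

definition hop :: "('o, 'v, 'h, 'c) pdcat \<Rightarrow> ('o, 'v, 'h, 'c) pdcat" where
  "hop D = \<lparr>cat0 = cat0 D, cat1 = cat1 D, hdom = hcod D, hcod = hdom D, hunit = hunit D,
    hcomp = \<lparr>ob = (\<lambda>(s, r). ob (hcomp D) (r, s)), ar = (\<lambda>(b, a). ar (hcomp D) (a, b))\<rparr>,
    lunitor = runitor D, runitor = lunitor D,
    associator = (\<lambda>(t, s, r). inv_arrow (cat1 D) (associator D (r, s, t)))\<rparr>"

lemma hop_simps [simp]:
  "cat0 (hop D) = cat0 D" "cat1 (hop D) = cat1 D" "hdom (hop D) = hcod D" "hcod (hop D) = hdom D"
  "hunit (hop D) = hunit D" "ob (hcomp (hop D)) (s, r) = ob (hcomp D) (r, s)"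
  "ar (hcomp (hop D)) (b, a) = ar (hcomp D) (a, b)"
  "lunitor (hop D) = runitor D" "runitor (hop D) = lunitor D"
  "associator (hop D) (t, s, r) = inv_arrow (cat1 D) (associator D (r, s, t))"
  by (simp_all add: hop_def)

lemma globular_hop [simp]: "globular (hop D) a \<longleftrightarrow> globular D a"
  by (auto simp: globular_def)

lemma hcomp_fctr_hop [simp]: "hcomp_fctr (hop D) S R = hcomp_fctr D R S"
  by (simp add: hcomp_fctr_def fcomp_def pair_fctr_def)

lemma is_conjoint_hop: "is_conjoint (hop D) f r \<eta> \<epsilon> \<longleftrightarrow> is_companion D f r \<eta> \<epsilon>"
  by (auto simp: is_conjoint_def is_companion_def Let_def horizontal_def cells_def)

lemma conjoint_closed_hop: "conjoint_closed (hop D) \<longleftrightarrow> companion_closed D"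
  by (simp add: conjoint_closed_def companion_closed_def is_conjoint_hop)

section \<open>The opposite as a pseudodouble category\<close>

context pseudodouble_category
begin

lemma composable_hop [simp]:
  "(s, r) \<in> Obj (composable_pairs (hop D)) \<longleftrightarrow> hor s \<and> hor r \<and> od r = oc s"
  "(b, a) \<in> Arr (composable_pairs (hop D)) \<longleftrightarrow> cell b \<and> cell a \<and> dm a = cd b"
  "Src (composable_pairs (hop D)) (b, a) = (src b, src a)"
  "Trg (composable_pairs (hop D)) (b, a) = (trg b, trg a)"
  "Idt (composable_pairs (hop D)) (s, r) = (idh s, idh r)"
  "Cmp (composable_pairs (hop D)) (b', a') (b, a) = (b' \<cdot> b, a' \<cdot> a)"
  "(t, s, r) \<in> Obj (composable_triples (hop D)) \<longleftrightarrow>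
    hor t \<and> hor s \<and> hor r \<and> od s = oc t \<and> od r = oc s"
  "(c, b, a) \<in> Arr (composable_triples (hop D)) \<longleftrightarrow>
    cell c \<and> cell b \<and> cell a \<and> dm b = cd c \<and> dm a = cd b"
  "Src (composable_triples (hop D)) (c, b, a) = (src c, src b, src a)"
  "Trg (composable_triples (hop D)) (c, b, a) = (trg c, trg b, trg a)"
  by (auto simp: composable_pairs_def composable_triples_def)

lemma pseudodouble_category_hop: "pseudodouble_category (hop D)"
proof (rule pseudodouble_category.intro)
  show "is_functor (composable_pairs (hop D)) (cat1 (hop D)) (hcomp (hop D))"
    by (rule is_functorI) (auto simp: interchange)
  show "fctr_eq (composable_pairs (hop D)) (fcomp (hdom (hop D)) (hcomp (hop D)))
      (fcomp (hdom (hop D)) snd_fctr)"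
    "fctr_eq (composable_pairs (hop D)) (fcomp (hcod (hop D)) (hcomp (hop D)))
      (fcomp (hcod (hop D)) fst_fctr)"
    by (auto simp: fctr_eq_def fcomp_def fst_fctr_def snd_fctr_def)
  show "nat_iso (composable_triples (hop D)) (cat1 (hop D))
      \<lparr>ob = (\<lambda>(t, s, r). (t \<odot>\<^bsub>hop D\<^esub> s) \<odot>\<^bsub>hop D\<^esub> r), ar = (\<lambda>(c, b, a). (c \<star>\<^bsub>hop D\<^esub> b) \<star>\<^bsub>hop D\<^esub> a)\<rparr>
      \<lparr>ob = (\<lambda>(t, s, r). t \<odot>\<^bsub>hop D\<^esub> (s \<odot>\<^bsub>hop D\<^esub> r)), ar = (\<lambda>(c, b, a). c \<star>\<^bsub>hop D\<^esub> (b \<star>\<^bsub>hop D\<^esub> a))\<rparr>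
      (associator (hop D))"
    unfolding nat_iso_def
    by (intro conjI nat_transI) (auto simp: inv_asc_natural)
  show "globular (hop D) (associator (hop D) (t, s, r))"
    if "(t, s, r) \<in> Obj (composable_triples (hop D))" for t s r
    using that globular_inv(3)[of "asc r s t"] associator_globular[of r s t] by simp
  show "(vid2 (hop D) s \<star>\<^bsub>hop D\<^esub> lunitor (hop D) r)
      \<bullet>\<^bsub>hop D\<^esub> associator (hop D) (s, ob (hunit (hop D)) (ob (hcod (hop D)) r), r)
      = runitor (hop D) s \<star>\<^bsub>hop D\<^esub> vid2 (hop D) r"
    if "(s, r) \<in> Obj (composable_pairs (hop D))" for s r
    using that triangle_inv'[of r s] by simp
  show "associator (hop D) (u, t, s \<odot>\<^bsub>hop D\<^esub> r) \<bullet>\<^bsub>hop D\<^esub> associator (hop D) (u \<odot>\<^bsub>hop D\<^esub> t, s, r)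
      = (vid2 (hop D) u \<star>\<^bsub>hop D\<^esub> associator (hop D) (t, s, r))
        \<bullet>\<^bsub>hop D\<^esub> associator (hop D) (u, t \<odot>\<^bsub>hop D\<^esub> s, r)
        \<bullet>\<^bsub>hop D\<^esub> (associator (hop D) (u, t, s) \<star>\<^bsub>hop D\<^esub> vid2 (hop D) r)"
    if "(u, t, s) \<in> Obj (composable_triples (hop D))" "(s, r) \<in> Obj (composable_pairs (hop D))"
    for u t s r
    using that inv_pentagon[of r s t u] by simp
qed (use category0 category1 functor_hdom functor_hcod functor_hunit hdom_hunit hcod_hunit
  lunitor_iso runitor_iso lunitor_globular runitor_globular in simp_all)

lemma gamma_hop: "gamma (hop D) r = inv2 (lu r) \<cdot> ru r"
  by (simp add: gamma_def)

end

text \<open>A lax functor takes the same values on cells between the opposites; only the pairs that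
  index its multiplication cells change order.\<close>

definition hop_fun where
  "hop_fun F = F\<lparr>lf_m := (\<lambda>(s, r). lf_m F (r, s))\<rparr>"

definition hop_vt where
  "hop_vt \<phi> = \<phi>\<lparr>vt_src := hop_fun (vt_src \<phi>), vt_trg := hop_fun (vt_trg \<phi>)\<rparr>"

text \<open>The constraints \<open>ht_n\<close> are kept. With the factors of horizontal composites
  exchanged, an oplax constraint from \<open>F\<close> to \<open>G\<close> has the shape of a lax
  constraint from \<open>G\<close> to \<open>F\<close>.\<close>

definition hop_tr where
  "hop_tr \<zeta> = \<zeta>\<lparr>ht_dom := hop_fun (ht_cod \<zeta>), ht_cod := hop_fun (ht_dom \<zeta>)\<rparr>"

definition hop_md where
  "hop_md \<Gamma> = \<Gamma>\<lparr>md_src := hop_tr (md_src \<Gamma>), md_trg := hop_tr (md_trg \<Gamma>),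
    md_dom := hop_vt (md_cod \<Gamma>), md_cod := hop_vt (md_dom \<Gamma>)\<rparr>"

lemma hop_record_simps [simp]:
  "lf0 (hop_fun F) = lf0 F" "lf1 (hop_fun F) = lf1 F" "lf_e (hop_fun F) = lf_e F"
  "lf_m (hop_fun F) (s, r) = lf_m F (r, s)"
  "vt_src (hop_vt \<phi>) = hop_fun (vt_src \<phi>)" "vt_trg (hop_vt \<phi>) = hop_fun (vt_trg \<phi>)"
  "vt0 (hop_vt \<phi>) = vt0 \<phi>" "vt1 (hop_vt \<phi>) = vt1 \<phi>"
  "ht_dom (hop_tr \<zeta>) = hop_fun (ht_cod \<zeta>)" "ht_cod (hop_tr \<zeta>) = hop_fun (ht_dom \<zeta>)"
  "ht_fun (hop_tr \<zeta>) = ht_fun \<zeta>" "ht_n (hop_tr \<zeta>) = ht_n \<zeta>"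
  "md_src (hop_md \<Gamma>) = hop_tr (md_src \<Gamma>)" "md_trg (hop_md \<Gamma>) = hop_tr (md_trg \<Gamma>)"
  "md_dom (hop_md \<Gamma>) = hop_vt (md_cod \<Gamma>)" "md_cod (hop_md \<Gamma>) = hop_vt (md_dom \<Gamma>)"
  "md_c (hop_md \<Gamma>) = md_c \<Gamma>"
  by (simp_all add: hop_fun_def hop_vt_def hop_tr_def hop_md_def)

lemma hop_involution [simp]:
  "hop_fun (hop_fun F) = (F :: ('o, 'v, 'h, 'c, 'p, 'w, 'k, 'd) lax_fun)"
  "hop_vt (hop_vt \<phi>) = (\<phi> :: ('o, 'v, 'h, 'c, 'p, 'w, 'k, 'd) vtrans)"
  "hop_tr (hop_tr \<zeta>) = (\<zeta> :: ('o, 'v, 'h, 'c, 'p, 'w, 'k, 'd) htrans)"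
  "hop_md (hop_md \<Gamma>) = (\<Gamma> :: ('o, 'v, 'h, 'c, 'p, 'w, 'k, 'd) modif)"
proof -
  show F: "hop_fun (hop_fun F) = F" for F :: "('o, 'v, 'h, 'c, 'p, 'w, 'k, 'd) lax_fun"
    by (simp add: hop_fun_def)
  show V: "hop_vt (hop_vt \<phi>) = \<phi>" for \<phi> :: "('o, 'v, 'h, 'c, 'p, 'w, 'k, 'd) vtrans"
    by (rule vtrans.equality) (simp_all add: F)
  show H: "hop_tr (hop_tr \<zeta>) = \<zeta>" for \<zeta> :: "('o, 'v, 'h, 'c, 'p, 'w, 'k, 'd) htrans"
    by (rule htrans.equality) (simp_all add: F)
  show "hop_md (hop_md \<Gamma>) = \<Gamma>"
    by (rule modif.equality) (simp_all add: V H)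
qed

lemma hop_mk_mod [simp]:
  "hop_md (mk_mod D \<zeta> \<xi> \<phi> \<psi> c) = mk_mod (hop D) (hop_tr \<zeta>) (hop_tr \<xi>) (hop_vt \<psi>) (hop_vt \<phi>) c"
  by (simp add: hop_md_def mk_mod_def)

lemma hop_lax_cat0 [simp]:
  "hop_vt (Idt (lax_cat0 D E) F) = Idt (lax_cat0 (hop D) (hop E)) (hop_fun F)"
  "hop_vt (Cmp (lax_cat0 D E) \<psi> \<phi>) = Cmp (lax_cat0 (hop D) (hop E)) (hop_vt \<psi>) (hop_vt \<phi>)"
  by (simp_all add: lax_cat0_def hop_vt_def)

section \<open>Transport of functors, transformations and modifications to the opposites\<close>

context pseudodouble_pair
begin

lemma pseudodouble_pair_hop: "pseudodouble_pair (hop D) (hop E)"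
  by (intro pseudodouble_pair.intro D.pseudodouble_category_hop E.pseudodouble_category_hop)

text \<open>The two unit laws exchange roles. The associativity law contains inverse associators
  over the opposites, and it is the given law with the associators moved across by
  \<open>inv_commute\<close>.\<close>

lemma lax_functor_hop:
  assumes "lax_functor D E F"
  shows "lax_functor (hop D) (hop E) (hop_fun F)"
proof (rule lax_functor.intro)
  interpret F: lax_functor D E F by (rule assms)
  show "lf_m (hop_fun F) \<in> extensional (Obj (composable_pairs (hop D)))"
    using F.ext(4) by (auto simp: extensional_def)
  show "nat_trans (composable_pairs (hop D)) (cat1 (hop E))
      (hcomp_fctr (hop E) (fcomp (lf1 (hop_fun F)) fst_fctr) (fcomp (lf1 (hop_fun F)) snd_fctr))
      (fcomp (lf1 (hop_fun F)) (hcomp (hop D))) (lf_m (hop_fun F))"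
  proof (rule nat_transI)
    fix \<Theta> assume "\<Theta> \<in> Arr (composable_pairs (hop D))"
    then obtain b a where "\<Theta> = (b, a)" "(a, b) \<in> Arr (composable_pairs D)" by (cases \<Theta>) auto
    then show "Cmp (cat1 (hop E)) (lf_m (hop_fun F) (Trg (composable_pairs (hop D)) \<Theta>))
        (ar (hcomp_fctr (hop E) (fcomp (lf1 (hop_fun F)) fst_fctr) (fcomp (lf1 (hop_fun F)) snd_fctr)) \<Theta>)
      = Cmp (cat1 (hop E)) (ar (fcomp (lf1 (hop_fun F)) (hcomp (hop D))) \<Theta>)
        (lf_m (hop_fun F) (Src (composable_pairs (hop D)) \<Theta>))"
      using nat_trans.natural_arr[OF F.m_natural, of "(a, b)"]
      by (simp add: hcomp_fctr_def fcomp_def pair_fctr_def fst_fctr_def snd_fctr_def)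
  qed (auto simp: hcomp_fctr_def fcomp_def pair_fctr_def fst_fctr_def snd_fctr_def assms)
  show "globular (hop E) (lf_m (hop_fun F) (s, r))" if "(s, r) \<in> Obj (composable_pairs (hop D))" for s r
    using that F.m_globular[of r s] by simp
  show "ar (lf1 (hop_fun F)) (associator (hop D) (t, s, r)) \<bullet>\<^bsub>hop E\<^esub> lf_m (hop_fun F) (t \<odot>\<^bsub>hop D\<^esub> s, r)
        \<bullet>\<^bsub>hop E\<^esub> (lf_m (hop_fun F) (t, s) \<star>\<^bsub>hop E\<^esub> vid2 (hop E) (ob (lf1 (hop_fun F)) r))
      = lf_m (hop_fun F) (t, s \<odot>\<^bsub>hop D\<^esub> r)
        \<bullet>\<^bsub>hop E\<^esub> (vid2 (hop E) (ob (lf1 (hop_fun F)) t) \<star>\<^bsub>hop E\<^esub> lf_m (hop_fun F) (s, r))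
        \<bullet>\<^bsub>hop E\<^esub> associator (hop E) (ob (lf1 (hop_fun F)) t, ob (lf1 (hop_fun F)) s, ob (lf1 (hop_fun F)) r)"
    if tsr: "(t, s, r) \<in> Obj (composable_triples (hop D))" for t s r
  proof -
    let ?F = "ob (lf1 F)" and ?a = "associator D (r, s, t)"
    \<comment> \<open>A functor preserves inverses, so the inverse associator required by the
      opposite of \<open>D\<close> is mapped to the inverse of the image.\<close>
    have i: "E.iso2 (ar (lf1 F) ?a)"
      "E.inv2 (ar (lf1 F) ?a) = ar (lf1 F) (D.inv2 ?a)"
    proof -
      have "inverse_arrows (cat1 E) (ar (lf1 F) ?a) (ar (lf1 F) (D.inv2 ?a))"
        using tsr assms is_functor.ar_cmp_arr[OF F.functor1, of ?a "D.inv2 ?a"]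
          is_functor.ar_cmp_arr[OF F.functor1, of "D.inv2 ?a" ?a]
        by (simp add: inverse_arrows_def Hom_def)
      then show "E.iso2 (ar (lf1 F) ?a)"
        "E.inv2 (ar (lf1 F) ?a) = ar (lf1 F) (D.inv2 ?a)"
        by (rule E.H.iso_arrowI, rule E.H.inv_arrowI)
    qed
    have "E.inv2 (ar (lf1 F) ?a) \<cdot>\<^sub>E (lf_m F (r, s \<odot>\<^bsub>D\<^esub> t) \<cdot>\<^sub>E (E.idh (?F r) \<otimes>\<^sub>E lf_m F (s, t)))
      = (lf_m F (r \<odot>\<^bsub>D\<^esub> s, t) \<cdot>\<^sub>E (lf_m F (r, s) \<otimes>\<^sub>E E.idh (?F t)))
        \<cdot>\<^sub>E E.inv2 (associator E (?F r, ?F s, ?F t))"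
      by (rule E.H.inv_commute)
        (use tsr assms F.associativity[of r s t] i in \<open>simp_all add: E.H.cmp_assoc_arr\<close>)
    then show ?thesis using tsr assms i by (simp add: E.H.cmp_assoc_arr)
  qed
qed (use lax_functor.ext[OF assms] lax_functor.functor0[OF assms] lax_functor.functor1[OF assms]
    lax_functor.compat_hdom[OF assms] lax_functor.compat_hcod[OF assms] lax_functor.e_natural[OF assms]
    lax_functor.e_globular[OF assms] lax_functor.left_unit[OF assms] lax_functor.right_unit[OF assms]
    in simp_all)

lemma vertical_transformation_hop:
  assumes "vertical_transformation D E \<phi>"
  shows "vertical_transformation (hop D) (hop E) (hop_vt \<phi>)"
proof (rule vertical_transformation.intro)
  interpret vertical_transformation D E \<phi> by (rule assms)
  show "vt1 (hop_vt \<phi>) (s \<odot>\<^bsub>hop D\<^esub> r) \<bullet>\<^bsub>hop E\<^esub> lf_m (vt_src (hop_vt \<phi>)) (s, r)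
      = lf_m (vt_trg (hop_vt \<phi>)) (s, r) \<bullet>\<^bsub>hop E\<^esub> (vt1 (hop_vt \<phi>) s \<star>\<^bsub>hop E\<^esub> vt1 (hop_vt \<phi>) r)"
    if "(s, r) \<in> Obj (composable_pairs (hop D))" for s r
    using that comp[of r s] by simp
  show "vt0 (hop_vt \<phi>) \<in> extensional (Obj (cat0 (hop D)))" "vt1 (hop_vt \<phi>) \<in> extensional (Obj (cat1 (hop D)))"
    using ext by simp_all
qed (use assms lax_functor_hop vertical_transformation.natural0[OF assms]
  vertical_transformation.natural1[OF assms] vertical_transformation.unit[OF assms] in simp_all)

lemma horizontal_transformation_hop:
  assumes "lax_functor D E (ht_dom \<zeta>)" "lax_functor D E (ht_cod \<zeta>)"
  shows "horizontal_transformation (hop D) (hop E) (hop_tr \<zeta>) \<longleftrightarrow> horizontal_transformation D E \<zeta>"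
  using assms by (auto simp: horizontal_transformation_def lax_functor_hop)

text \<open>Exchanging \<open>s\<close> and \<open>r\<close> in the lax composition law over the
  opposites, where associators and inverse associators change roles, gives the oplax law term by
  term. The equivalence serves both directions: the lax results are applied to reversed
  transformations, and the conjoint found there is brought back.\<close>

lemma oplax_transformation_hop:
  assumes "lax_functor D E (ht_dom \<zeta>)" "lax_functor D E (ht_cod \<zeta>)"
  shows "oplax_transformation D E \<zeta> \<longleftrightarrow> lax_transformation (hop D) (hop E) (hop_tr \<zeta>)"
proof
  assume o: "oplax_transformation D E \<zeta>"
  then interpret oplax_transformation D E \<zeta> .
  have h: "horizontal_transformation D E \<zeta>" by (rule horizontal_transformation_axioms)
  show "lax_transformation (hop D) (hop E) (hop_tr \<zeta>)"
  proof (intro lax_transformation.intro lax_transformation_axioms.intro)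
    show "horizontal_transformation (hop D) (hop E) (hop_tr \<zeta>)"
      using assms h by (simp add: horizontal_transformation_hop)
  next
    fix s r \<phi>x \<phi>y \<phi>z Fr Fs Gr Gs
    assume "(s, r) \<in> Obj (composable_pairs (hop D))"
      "\<phi>x = ob (ht_fun (hop_tr \<zeta>)) (ob (hdom (hop D)) r)"
      "\<phi>y = ob (ht_fun (hop_tr \<zeta>)) (ob (hcod (hop D)) r)"
      "\<phi>z = ob (ht_fun (hop_tr \<zeta>)) (ob (hcod (hop D)) s)"
      "Fr = ob (lf1 (ht_dom (hop_tr \<zeta>))) r" "Fs = ob (lf1 (ht_dom (hop_tr \<zeta>))) s"
      "Gr = ob (lf1 (ht_cod (hop_tr \<zeta>))) r" "Gs = ob (lf1 (ht_cod (hop_tr \<zeta>))) s"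
    then show "ht_n (hop_tr \<zeta>) (s \<odot>\<^bsub>hop D\<^esub> r)
        \<bullet>\<^bsub>hop E\<^esub> (lf_m (ht_cod (hop_tr \<zeta>)) (s, r) \<star>\<^bsub>hop E\<^esub> vid2 (hop E) \<phi>x)
      = (vid2 (hop E) \<phi>z \<star>\<^bsub>hop E\<^esub> lf_m (ht_dom (hop_tr \<zeta>)) (s, r))
        \<bullet>\<^bsub>hop E\<^esub> associator (hop E) (\<phi>z, Fs, Fr) \<bullet>\<^bsub>hop E\<^esub> (ht_n (hop_tr \<zeta>) s \<star>\<^bsub>hop E\<^esub> vid2 (hop E) Fr)
        \<bullet>\<^bsub>hop E\<^esub> vinv2 (hop E) (associator (hop E) (Gs, \<phi>y, Fr))
        \<bullet>\<^bsub>hop E\<^esub> (vid2 (hop E) Gs \<star>\<^bsub>hop E\<^esub> ht_n (hop_tr \<zeta>) r) \<bullet>\<^bsub>hop E\<^esub> associator (hop E) (Gs, Gr, \<phi>x)"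
      using h n_comp[of r s, OF _ refl refl refl refl refl refl refl] by simp
  qed (use h n_natural n_unit in \<open>simp_all add: E.gamma_hop\<close>)
next
  assume "lax_transformation (hop D) (hop E) (hop_tr \<zeta>)"
  then interpret L: lax_transformation "hop D" "hop E" "hop_tr \<zeta>" .
  have h: "horizontal_transformation D E \<zeta>"
    using assms L.horizontal_transformation_axioms by (simp add: horizontal_transformation_hop)
  show "oplax_transformation D E \<zeta>"
  proof (intro oplax_transformation.intro oplax_transformation_axioms.intro)
    fix s r \<phi>x \<phi>y \<phi>z Fr Fs Gr Gs
    assume "(s, r) \<in> Obj (composable_pairs D)"
      "\<phi>x = ob (ht_fun \<zeta>) (D.od r)" "\<phi>y = ob (ht_fun \<zeta>) (D.oc r)"
      "\<phi>z = ob (ht_fun \<zeta>) (D.oc s)"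
      "Fr = ob (lf1 (ht_dom \<zeta>)) r" "Fs = ob (lf1 (ht_dom \<zeta>)) s"
      "Gr = ob (lf1 (ht_cod \<zeta>)) r" "Gs = ob (lf1 (ht_cod \<zeta>)) s"
    then show "ht_n \<zeta> (s \<odot>\<^bsub>D\<^esub> r) \<cdot>\<^sub>E (E.idh \<phi>z \<otimes>\<^sub>E lf_m (ht_dom \<zeta>) (s, r))
      = (lf_m (ht_cod \<zeta>) (s, r) \<otimes>\<^sub>E E.idh \<phi>x) \<cdot>\<^sub>E E.inv2 (associator E (Gs, Gr, \<phi>x))
        \<cdot>\<^sub>E (E.idh Gs \<otimes>\<^sub>E ht_n \<zeta> r) \<cdot>\<^sub>E associator E (Gs, \<phi>y, Fr)
        \<cdot>\<^sub>E (ht_n \<zeta> s \<otimes>\<^sub>E E.idh Fr) \<cdot>\<^sub>E E.inv2 (associator E (\<phi>z, Fs, Fr))"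
      using h L.n_comp[of r s, OF _ refl refl refl refl refl refl refl] by simp
  qed (use h L.n_natural L.n_unit in \<open>simp_all add: E.gamma_hop\<close>)
qed

lemma modification_hop:
  assumes "modification D E \<Gamma>"
  shows "modification (hop D) (hop E) (hop_md \<Gamma>)"
proof (rule modification.intro)
  interpret modification D E \<Gamma> by (rule assms)
  show "nat_trans (cat0 (hop D)) (cat1 (hop E)) (ht_fun (md_src (hop_md \<Gamma>)))
      (ht_fun (md_trg (hop_md \<Gamma>))) (md_c (hop_md \<Gamma>))"
    using natural by simp
qed (use assms modification.ext[OF assms] vertical_transformation_hop in
    \<open>simp_all add: Hom_def pseudodouble_pair.lax_cat0_simps[OF pseudodouble_pair_hop]\<close>)

end

text \<open>The counterpart of \<open>lax_compat\<close>, again in the role of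
  \<open>K\<close>.\<close>

definition oplax_compat where
  "oplax_compat D E \<Gamma> \<longleftrightarrow> (\<forall>r\<in>Obj (cat1 D).
    (vt1 (md_cod \<Gamma>) r \<star>\<^bsub>E\<^esub> md_c \<Gamma> (ob (hdom D) r)) \<bullet>\<^bsub>E\<^esub> ht_n (md_src \<Gamma>) r
      = ht_n (md_trg \<Gamma>) r \<bullet>\<^bsub>E\<^esub> (md_c \<Gamma> (ob (hcod D) r) \<star>\<^bsub>E\<^esub> vt1 (md_dom \<Gamma>) r))"

lemma oplax_compat_hop: "oplax_compat D E \<Gamma> \<longleftrightarrow> lax_compat (hop D) (hop E) (hop_md \<Gamma>)"
  by (simp add: oplax_compat_def lax_compat_def)

context pseudodouble_pair
begin

interpretation hop: pseudodouble_pair "hop D" "hop E"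
  by (rule pseudodouble_pair_hop)

lemma oplax_modification_iff:
  "oplax_modification D E \<Gamma> \<longleftrightarrow> modification D E \<Gamma> \<and> md_src \<Gamma> \<in> {\<phi>. oplax_transformation D E \<phi>} \<and>
    md_trg \<Gamma> \<in> {\<phi>. oplax_transformation D E \<phi>} \<and> oplax_compat D E \<Gamma>"
  by (auto simp: oplax_modification_def oplax_modification_axioms_def oplax_compat_def)

lemma oplax_transformation_ht:
  "oplax_transformation D E \<phi> \<Longrightarrow> horizontal_transformation D E \<phi>"
  by (simp add: oplax_transformation_def)

lemma oplax_transformation_hopD:
  assumes "oplax_transformation D E \<phi>"
  shows "lax_transformation (hop D) (hop E) (hop_tr \<phi>)"
  using assms oplax_transformation_hop oplax_transformation_ht[OF assms] by auto

text \<open>The swap of the opposite is the inverse of the swap of \<open>E\<close>. Its inverse,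
  the lax unit constraint over the opposites, is therefore the oplax unit constraint.\<close>

lemma hop_trans_unit:
  assumes "lax_functor D E F"
  shows "hop_tr (trans_unit D E (oplax_unit_n E) F)
    = trans_unit (hop D) (hop E) (lax_unit_n (hop E)) (hop_fun F)"
  by (rule htrans.equality)
    (use assms in \<open>auto simp: trans_unit_def oplax_unit_n_def lax_unit_n_def E.gamma_hop
      E.H.iso_cmp gamma_def intro!: restrict_ext\<close>)

text \<open>Reversal exchanges the two transformations; the five factors of the oplax composite
  constraint are then, in the same vertical order, those of the lax one over the opposites.\<close>

lemma hop_trans_comp:
  assumes "horizontal_transformation D E \<phi>" "horizontal_transformation D E \<psi>" "ht_dom \<psi> = ht_cod \<phi>"
  shows "hop_tr (trans_comp D E (oplax_comp_n D E) \<psi> \<phi>)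
    = trans_comp (hop D) (hop E) (lax_comp_n (hop D) (hop E)) (hop_tr \<phi>) (hop_tr \<psi>)"
  by (rule htrans.equality)
    (use assms in \<open>auto simp: trans_comp_def oplax_comp_n_def lax_comp_n_def Let_def
      intro!: restrict_ext\<close>)

lemma oplax_unit_transformation:
  assumes "lax_functor D E F"
  shows "oplax_transformation D E (trans_unit D E (oplax_unit_n E) F)"
  using assms oplax_transformation_hop hop.lax_unit_transformation[OF lax_functor_hop]
  by (simp add: hop_trans_unit)

lemma oplax_comp_transformation:
  assumes "oplax_transformation D E \<phi>" "oplax_transformation D E \<psi>" "ht_dom \<psi> = ht_cod \<phi>"
  shows "oplax_transformation D E (trans_comp D E (oplax_comp_n D E) \<psi> \<phi>)"
proof -
  note h = oplax_transformation_ht[OF assms(1)] oplax_transformation_ht[OF assms(2)]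
  have "lax_transformation (hop D) (hop E) (trans_comp (hop D) (hop E)
      (lax_comp_n (hop D) (hop E)) (hop_tr \<phi>) (hop_tr \<psi>))"
    by (rule hop.lax_comp_transformation) (use assms oplax_transformation_hopD in simp_all)
  then show ?thesis
    using h assms(3) oplax_transformation_hop[of "trans_comp D E (oplax_comp_n D E) \<psi> \<phi>"]
    by (simp add: hop_trans_comp)
qed

end

text \<open>Converse of \<open>is_conjoint_P\<close>: a conjoint is unpacked into its boundaries and
  its pointwise equations, the form in which it can be transported from the opposites.\<close>

lemma (in transformation_structure) is_conjoint_PD:
  assumes c: "is_conjoint P \<phi> \<zeta> \<Gamma> \<Delta>" and v: "vertical_transformation D E \<phi>"
  shows "\<zeta> \<in> T" "\<Gamma> \<in> M" "\<Delta> \<in> M"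
    and "ht_dom \<zeta> = vt_trg \<phi>" "ht_cod \<zeta> = vt_src \<phi>"
    and "md_src \<Gamma> = trans_unit D E nu (vt_src \<phi>)" "md_trg \<Gamma> = \<zeta>" "md_dom \<Gamma> = \<phi>"
      "md_cod \<Gamma> = Idt (lax_cat0 D E) (vt_src \<phi>)"
    and "md_src \<Delta> = \<zeta>" "md_trg \<Delta> = trans_unit D E nu (vt_trg \<phi>)"
      "md_dom \<Delta> = Idt (lax_cat0 D E) (vt_trg \<phi>)" "md_cod \<Delta> = \<phi>"
    and "\<And>x. x \<in> Obj (cat0 D) \<Longrightarrow> md_c \<Delta> x \<bullet>\<^bsub>E\<^esub> md_c \<Gamma> x = E.one1 (vt0 \<phi> x)"
    and "\<And>x. x \<in> Obj (cat0 D) \<Longrightarrow> md_c \<Gamma> x \<star>\<^bsub>E\<^esub> md_c \<Delta> x = gamma E (ob (ht_fun \<zeta>) x)"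
proof -
  show *: "\<zeta> \<in> T" "\<Gamma> \<in> M" "\<Delta> \<in> M"
    "ht_dom \<zeta> = vt_trg \<phi>" "ht_cod \<zeta> = vt_src \<phi>"
    "md_src \<Gamma> = trans_unit D E nu (vt_src \<phi>)" "md_trg \<Gamma> = \<zeta>" "md_dom \<Gamma> = \<phi>"
      "md_cod \<Gamma> = Idt (lax_cat0 D E) (vt_src \<phi>)"
    "md_src \<Delta> = \<zeta>" "md_trg \<Delta> = trans_unit D E nu (vt_trg \<phi>)"
      "md_dom \<Delta> = Idt (lax_cat0 D E) (vt_trg \<phi>)" "md_cod \<Delta> = \<phi>"
    using c by (auto simp: is_conjoint_def Let_def horizontal_def cells_def Hom_def)
  have e: "\<Delta> \<bullet>\<^bsub>P\<^esub> \<Gamma> = ar (hunit P) \<phi>" "\<Gamma> \<star>\<^bsub>P\<^esub> \<Delta> = vinv2 P (runitor P \<zeta>) \<bullet>\<^bsub>P\<^esub> lunitor P \<zeta>"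
    using c by (simp_all add: is_conjoint_def Let_def)
  fix x assume x: "x \<in> Obj (cat0 D)"
  show "md_c \<Delta> x \<bullet>\<^bsub>E\<^esub> md_c \<Gamma> x = E.one1 (vt0 \<phi> x)"
    using arg_cong[OF e(1), of "\<lambda>\<Theta>. md_c \<Theta> x"] x by simp
  show "md_c \<Gamma> x \<star>\<^bsub>E\<^esub> md_c \<Delta> x = gamma E (ob (ht_fun \<zeta>) x)"
    using arg_cong[OF e(2), of "\<lambda>\<Theta>. md_c \<Theta> x"] x *(1) by (simp add: inv_unitors gamma_def)
qed

section \<open>Oplax transformations and their companions\<close>

context pseudodouble_pair
begin

interpretation hop: pseudodouble_pair "hop D" "hop E"
  by (rule pseudodouble_pair_hop)

text \<open>The closure properties and compatibilities come from the lax case over the opposites.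
  Horizontal composites change order, the two unitors are exchanged, and the associator comes out
  inverted.\<close>

lemma transformation_structure_opl:
  "transformation_structure D E {\<phi>. oplax_transformation D E \<phi>} (oplax_compat D E) (oplax_unit_n E)
    (oplax_comp_n D E)"
proof (intro transformation_structure.intro transformation_structure_axioms.intro pseudodouble_pair_axioms)
  let ?T = "{\<phi>. oplax_transformation D E \<phi>}"
  let ?M = "{\<Gamma>. modification D E \<Gamma> \<and> md_src \<Gamma> \<in> ?T \<and> md_trg \<Gamma> \<in> ?T \<and> oplax_compat D E \<Gamma>}"
  have T: "horizontal_transformation D E \<zeta>" "lax_transformation (hop D) (hop E) (hop_tr \<zeta>)"
    if "\<zeta> \<in> ?T" for \<zeta>
    using that oplax_transformation_ht oplax_transformation_hopD by auto
  have M: "modification D E \<Gamma>" "modification (hop D) (hop E) (hop_md \<Gamma>)"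
    "md_src \<Gamma> \<in> ?T" "md_trg \<Gamma> \<in> ?T"
    "lax_transformation (hop D) (hop E) (md_src (hop_md \<Gamma>))"
    "lax_transformation (hop D) (hop E) (md_trg (hop_md \<Gamma>))"
    "lax_compat (hop D) (hop E) (hop_md \<Gamma>)" if "\<Gamma> \<in> ?M" for \<Gamma>
    using that modification_hop T by (auto simp: oplax_compat_hop)
  {
    fix \<zeta> assume "\<zeta> \<in> ?T"
    then show "horizontal_transformation D E \<zeta>" by (rule T)
    show "oplax_compat D E (mod_idt \<zeta>)"
      using hop.lax_transformation_n[OF T(2)[OF \<open>\<zeta> \<in> ?T\<close>]] T(1)[OF \<open>\<zeta> \<in> ?T\<close>]
      by (simp add: oplax_compat_hop hop.lax_compat_mk_mod)
  next
    fix F assume "lax_functor D E F"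
    then show "trans_unit D E (oplax_unit_n E) F \<in> ?T" by (simp add: oplax_unit_transformation)
  next
    fix \<psi> \<phi> assume "\<psi> \<in> ?T" "\<phi> \<in> ?T" "ht_dom \<psi> = ht_cod \<phi>"
    then show "trans_comp D E (oplax_comp_n D E) \<psi> \<phi> \<in> ?T" by (simp add: oplax_comp_transformation)
  next
    fix \<Gamma> \<Delta> assume G: "\<Gamma> \<in> ?M" and D: "\<Delta> \<in> ?M" and "md_trg \<Gamma> = md_src \<Delta>"
    then show "oplax_compat D E (mod_cmp \<Delta> \<Gamma>)"
      using hop.lax_compat_cmp[OF M(2,5-7)[OF G] M(2,5-7)[OF D]] by (simp add: oplax_compat_hop)
  next
    fix \<Gamma> F G assume G: "\<Gamma> \<in> ?M" and "md_dom \<Gamma> = Idt (lax_cat0 D E) F" "md_cod \<Gamma> = Idt (lax_cat0 D E) G"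
      "\<And>x. x \<in> Obj (cat0 D) \<Longrightarrow> E.iso2 (md_c \<Gamma> x)"
    then show "oplax_compat D E
        (mod_inv \<Gamma>)"
      using hop.lax_compat_inv[OF M(2,5-7)[OF G], of "hop_fun G" "hop_fun F"]
      by (simp add: oplax_compat_hop)
  next
    fix \<tau> assume "vertical_transformation D E \<tau>"
    then show "oplax_compat D E (mod_unit (oplax_unit_n E) \<tau>)"
      using hop.lax_compat_unit[OF vertical_transformation_hop] by (simp add: oplax_compat_hop hop_trans_unit)
  next
    fix \<Gamma> \<Delta> assume G: "\<Gamma> \<in> ?M" and D: "\<Delta> \<in> ?M" and m: "md_dom \<Delta> = md_cod \<Gamma>"
    have "ht_dom (md_src \<Delta>) = ht_cod (md_src \<Gamma>)" "ht_dom (md_trg \<Delta>) = ht_cod (md_trg \<Gamma>)"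
      using modification_cell(3-6)[OF M(1)[OF G]] modification_cell(3-6)[OF M(1)[OF D]] m by simp_all
    then show "oplax_compat D E (mod_hcomp (oplax_comp_n D E) \<Delta> \<Gamma>)"
      using hop.lax_compat_hcomp[OF M(2,5-7)[OF D] M(2,5-7)[OF G]] m T(1)[OF M(3)[OF G]]
        T(1)[OF M(3)[OF D]] T(1)[OF M(4)[OF G]] T(1)[OF M(4)[OF D]]
      by (simp add: oplax_compat_hop hop_trans_comp)
  next
    fix \<phi> assume p: "\<phi> \<in> ?T"
    note u = T(1)[of "trans_unit D E (oplax_unit_n E) _", simplified, OF oplax_unit_transformation]
    show "oplax_compat D E (mod_lunitor (oplax_unit_n E) (oplax_comp_n D E) \<phi>)"
      using hop.lax_compat_unitors(2)[OF T(2)[OF p]] T(1)[OF p] u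
      by (simp add: oplax_compat_hop hop_trans_comp hop_trans_unit)
    show "oplax_compat D E (mod_runitor (oplax_unit_n E) (oplax_comp_n D E) \<phi>)"
      using hop.lax_compat_unitors(1)[OF T(2)[OF p]] T(1)[OF p] u
      by (simp add: oplax_compat_hop hop_trans_comp hop_trans_unit)
  next
    fix \<chi> \<psi> \<phi> assume t: "\<chi> \<in> ?T" "\<psi> \<in> ?T" "\<phi> \<in> ?T" "ht_dom \<chi> = ht_cod \<psi>" "ht_dom \<psi> = ht_cod \<phi>"
    have h: "horizontal_transformation D E (trans_comp D E (oplax_comp_n D E) \<chi> \<psi>)"
      "horizontal_transformation D E (trans_comp D E (oplax_comp_n D E) \<psi> \<phi>)"
      using t by (auto intro!: oplax_transformation_ht oplax_comp_transformation)
    let ?hc = "trans_comp (hop D) (hop E) (lax_comp_n (hop D) (hop E))"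
    let ?\<Gamma> = "mk_mod (hop D) (?hc (?hc (hop_tr \<phi>) (hop_tr \<psi>)) (hop_tr \<chi>))
      (?hc (hop_tr \<phi>) (?hc (hop_tr \<psi>) (hop_tr \<chi>)))
      (Idt (lax_cat0 (hop D) (hop E)) (hop_fun (ht_cod \<chi>)))
      (Idt (lax_cat0 (hop D) (hop E)) (hop_fun (ht_dom \<phi>)))
      (\<lambda>x. associator (hop E) (ob (ht_fun \<phi>) x, ob (ht_fun \<psi>) x, ob (ht_fun \<chi>) x))"
    have "?\<Gamma> \<in> {\<Gamma>. modification (hop D) (hop E) \<Gamma> \<and> md_src \<Gamma> \<in> {\<phi>. lax_transformation (hop D) (hop E) \<phi>} \<and>
      md_trg \<Gamma> \<in> {\<phi>. lax_transformation (hop D) (hop E) \<phi>} \<and> lax_compat (hop D) (hop E) \<Gamma>}"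
      using transformation_structure.associator_M[OF hop.transformation_structure_lax,
        of "hop_tr \<phi>" "hop_tr \<psi>" "hop_tr \<chi>"] t T(2) by simp
    then have m: "modification (hop D) (hop E) ?\<Gamma>" "lax_transformation (hop D) (hop E) (md_src ?\<Gamma>)"
      "lax_transformation (hop D) (hop E) (md_trg ?\<Gamma>)" "lax_compat (hop D) (hop E) ?\<Gamma>" by auto
    \<comment> \<open>Over the opposites the lax associator leads from left to right bracketing of
      \<open>\<phi>\<close>, \<open>\<psi>\<close>, \<open>\<chi>\<close>, whereas the reversed
      oplax associator leads back. Its compatibility is therefore that of the inverse
      modification.\<close>
    have "lax_compat (hop D) (hop E) (mk_mod (hop D) (md_trg ?\<Gamma>) (md_src ?\<Gamma>) (md_dom ?\<Gamma>) (md_cod ?\<Gamma>)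
        (\<lambda>x. vinv2 (hop E) (md_c ?\<Gamma> x)))"
      by (rule hop.lax_compat_inv[OF m]) (use t T(1) in simp_all)
    then show "oplax_compat D E (mod_associator (oplax_comp_n D E) \<chi> \<psi> \<phi>)"
      using h t T(1) by (simp add: oplax_compat_hop hop_trans_comp hop.lax_compat_mk_mod)
  }
qed

lemma Lax_opl_eq:
  "Lax_opl D E = trans_pdcat D E {\<phi>. oplax_transformation D E \<phi>}
    {\<Gamma>. modification D E \<Gamma> \<and> md_src \<Gamma> \<in> {\<phi>. oplax_transformation D E \<phi>} \<and>
      md_trg \<Gamma> \<in> {\<phi>. oplax_transformation D E \<phi>} \<and> oplax_compat D E \<Gamma>}
    (oplax_unit_n E) (oplax_comp_n D E)"
  unfolding Lax_opl_def oplax_modification_iff ..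

lemma pseudodouble_category_Lax_opl: "pseudodouble_category (Lax_opl D E)"
  unfolding Lax_opl_eq
  by (rule transformation_structure.pseudodouble_category_P[OF transformation_structure_opl])

text \<open>For the way back from the opposites: naturality and components are unchanged there, so
  only the vertical boundaries have to be given over \<open>D\<close> and \<open>E\<close>.\<close>

lemma modification_hopI:
  assumes "modification (hop D) (hop E) (hop_md \<Gamma>)"
    and "vertical_transformation D E (md_dom \<Gamma>)" "vertical_transformation D E (md_cod \<Gamma>)"
    and "vt_src (md_dom \<Gamma>) = ht_dom (md_src \<Gamma>)" "vt_trg (md_dom \<Gamma>) = ht_dom (md_trg \<Gamma>)"
    and "vt_src (md_cod \<Gamma>) = ht_cod (md_src \<Gamma>)" "vt_trg (md_cod \<Gamma>) = ht_cod (md_trg \<Gamma>)"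
  shows "modification D E \<Gamma>"
proof (rule modification.intro)
  interpret hop_md: modification "hop D" "hop E" "hop_md \<Gamma>" by (rule assms)
  show "nat_trans (cat0 D) (cat1 E) (ht_fun (md_src \<Gamma>)) (ht_fun (md_trg \<Gamma>)) (md_c \<Gamma>)"
    using hop_md.natural by simp
qed (use assms modification.ext[OF assms(1)] modification.hdom_c[OF assms(1)]
  modification.hcod_c[OF assms(1)] in \<open>simp_all add: Hom_def\<close>)

text \<open>A conjoint of \<open>hop_vt \<phi>\<close> lives in the lax structure over the
  opposites, which is related to \<open>Lax_opl D E\<close> by a translation of records. It is
  unpacked by \<open>is_conjoint_PD\<close>, reversed with \<open>hop_tr\<close> and
  \<open>hop_md\<close>, and reassembled by \<open>is_companion_P\<close>.\<close>

lemma companion_closed_Lax_opl: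
  assumes "companion_closed E"
  shows "companion_closed (Lax_opl D E)"
  unfolding companion_closed_def
proof
  fix \<phi> assume "\<phi> \<in> Arr (cat0 (Lax_opl D E))"
  then have vt: "vertical_transformation D E \<phi>"
    by (simp add: Lax_opl_def trans_pdcat_def Let_def)
  then have vt': "vertical_transformation (hop D) (hop E) (hop_vt \<phi>)"
    by (rule vertical_transformation_hop)
  have "conjoint_closed (Lax_lax (hop D) (hop E))"
    using assms hop.conjoint_closed_Lax_lax by (simp add: conjoint_closed_hop)
  moreover have "hop_vt \<phi> \<in> Arr (cat0 (Lax_lax (hop D) (hop E)))"
    using vt' by (simp add: Lax_lax_def trans_pdcat_def Let_def)
  ultimately obtain \<zeta> \<Gamma> \<Delta> where "is_conjoint (Lax_lax (hop D) (hop E)) (hop_vt \<phi>) \<zeta> \<Gamma> \<Delta>"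
    by (auto simp: conjoint_closed_def)
  note c = transformation_structure.is_conjoint_PD[OF hop.transformation_structure_lax
      this[unfolded hop.Lax_lax_eq] vt']
  have F [simp]: "lax_functor D E (vt_src \<phi>)" "lax_functor D E (vt_trg \<phi>)" using vt by simp_all
  have d: "ht_dom (hop_tr \<zeta>) = vt_src \<phi>" "ht_cod (hop_tr \<zeta>) = vt_trg \<phi>"
    using c(4,5) by simp_all
  have z: "oplax_transformation D E (hop_tr \<zeta>)"
    using oplax_transformation_hop[of "hop_tr \<zeta>"] c(1) d by simp
  have s: "md_src (hop_md \<Gamma>) = trans_unit D E (oplax_unit_n E) (vt_src \<phi>)" "md_trg (hop_md \<Gamma>) = hop_tr \<zeta>"
    "md_dom (hop_md \<Gamma>) = Idt (lax_cat0 D E) (vt_src \<phi>)" "md_cod (hop_md \<Gamma>) = \<phi>"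
    "md_src (hop_md \<Delta>) = hop_tr \<zeta>" "md_trg (hop_md \<Delta>) = trans_unit D E (oplax_unit_n E) (vt_trg \<phi>)"
    "md_dom (hop_md \<Delta>) = \<phi>" "md_cod (hop_md \<Delta>) = Idt (lax_cat0 D E) (vt_trg \<phi>)"
    using c(6-13) by (simp_all flip: hop_trans_unit hop_lax_cat0(1))
  \<comment> \<open>The conjoint equation over the opposites contains the swap of
    \<open>hop E\<close>, which is the inverse swap that a companion requires.\<close>
  have g: "gamma (hop E) (ob (ht_fun \<zeta>) x) = E.inv2 (gamma E (ob (ht_fun \<zeta>) x))"
    if "x \<in> Obj (cat0 D)" for x
    using horizontal_transformation_cell(3)[OF oplax_transformation_ht[OF z] that]
    by (simp add: E.gamma_hop)
  have "modification D E (hop_md \<Gamma>)" "modification D E (hop_md \<Delta>)"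
    by (rule modification_hopI; use c(2,3) vt d in \<open>simp add: s del: hop_record_simps(13-16)\<close>)+
  moreover have "oplax_compat D E (hop_md \<Gamma>)" "oplax_compat D E (hop_md \<Delta>)"
    using c(2,3) by (simp_all add: oplax_compat_hop)
  ultimately have "hop_md \<Gamma> \<in> {\<Gamma>. modification D E \<Gamma> \<and> md_src \<Gamma> \<in> {\<phi>. oplax_transformation D E \<phi>} \<and>
      md_trg \<Gamma> \<in> {\<phi>. oplax_transformation D E \<phi>} \<and> oplax_compat D E \<Gamma>}"
    "hop_md \<Delta> \<in> {\<Gamma>. modification D E \<Gamma> \<and> md_src \<Gamma> \<in> {\<phi>. oplax_transformation D E \<phi>} \<and>
      md_trg \<Gamma> \<in> {\<phi>. oplax_transformation D E \<phi>} \<and> oplax_compat D E \<Gamma>}"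
    unfolding mem_Collect_eq s using z oplax_unit_transformation[OF F(1)]
      oplax_unit_transformation[OF F(2)] by blast+
  moreover have "hop_tr \<zeta> \<in> {\<phi>. oplax_transformation D E \<phi>}" using z by simp
  moreover have "md_c (hop_md \<Delta>) x \<bullet>\<^bsub>E\<^esub> md_c (hop_md \<Gamma>) x = E.one1 (vt0 \<phi> x)"
    "md_c (hop_md \<Delta>) x \<star>\<^bsub>E\<^esub> md_c (hop_md \<Gamma>) x = E.inv2 (gamma E (ob (ht_fun (hop_tr \<zeta>)) x))"
    if "x \<in> Obj (cat0 D)" for x
    using c(14,15) g that by simp_all
  ultimately have "is_companion (Lax_opl D E) \<phi> (hop_tr \<zeta>) (hop_md \<Gamma>) (hop_md \<Delta>)"
    unfolding Lax_opl_eq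
    using transformation_structure.is_companion_P[OF transformation_structure_opl vt _ _ _ d s]
    by blast
  then show "\<exists>\<zeta> \<Gamma> \<Delta>. is_companion (Lax_opl D E) \<phi> \<zeta> \<Gamma> \<Delta>" by blast
qed

end

theorem theorem3p6:
  fixes D :: "('o, 'v, 'h, 'c) pdcat"
    and E :: "('p, 'w, 'k, 'd) pdcat"
  assumes "pseudodouble_category D"
    and "pseudodouble_category E"
  shows "(conjoint_closed E \<longrightarrow>
            pseudodouble_category (Lax_lax D E) \<and> conjoint_closed (Lax_lax D E)) \<and>
         (companion_closed E \<longrightarrow>
            pseudodouble_category (Lax_opl D E) \<and> companion_closed (Lax_opl D E))"
proof -
  interpret pseudodouble_pair D E
    by (intro pseudodouble_pair.intro assms)
  show ?thesis
    using pseudodouble_category_Lax_lax conjoint_closed_Lax_lax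
      pseudodouble_category_Lax_opl companion_closed_Lax_opl by blast
qed

end
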